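(* Let $\mathcal{M}$ be an isosimple $F$-crystal over $k$ whose Newton slope is $s/r$ in reduced form, and let $e$ be its maximal Hodge slope, assumed $e \geq 1$. Then the isomorphism number of $\mathcal{M}$ satisfies \[n_{\mathcal{M}} \leq 2\max\Big\{\Big\lfloor \big(r-\lceil \tfrac{s}{e}\rceil\big)\tfrac{s}{r}\Big\rfloor,\ \Big\lfloor \big\lfloor \tfrac{s}{e}\big\rfloor \big(e - \tfrac{s}{r}\big)\Big\rfloor\Big\} + 1.\]
   Context: Let $p$ be a prime, $k$ an algebraically closed field of characteristic $p$, $W(k)$ its ring of Witt vectors, $B(k)=W(k)[1/p]$, $\sigma$ the Frobenius. An $F$-crystal over $k$ is a pair $(M,\varphi)$ with $M$ a free $W(k)$-module of finite rank and $\varphi$ an injective $\sigma$-linear endomorphism of $M$. Its Hodge slopes are the integers $e_1,\dots,e_r \ge 0$ such that there are $W(k)$-bases $\{u_i\}$, $\{w_i\}$ of $M$ with $\varphi(u_i) = p^{e_i}w_i$; its Newton slopes are those of the $F$-isocrystal $(M[1/p],\varphi[1/p])$. It is isosimple if this $F$-isocrystal is simple. The isomorphism number $n_{\mathcal{M}}$ is the smallest non-negative integer $n$ such that for every $W(k)$-linear automorphism $g$ of $M$ with $g \equiv \mathrm{id}_M \bmod p^n$, $(M, g\varphi) \cong (M,\varphi)$. *)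

theory Defs
  imports
    "HOL-Computational_Algebra.Computational_Algebra"
    "HOL-Library.Poly_Mapping"
    "HOL-Library.Multiset"
begin

section \<open>Integer polynomials in arbitrary sets of variables\<close>

type_synonym 'v int_mpoly = "('v \<Rightarrow>\<^sub>0 nat) \<Rightarrow>\<^sub>0 int"

definition mvar :: "'v \<Rightarrow> 'v int_mpoly" where
  "mvar v = Poly_Mapping.single (Poly_Mapping.single v 1) 1"

definition monom_eval :: "('v \<Rightarrow> 'a::comm_ring_1) \<Rightarrow> ('v \<Rightarrow>\<^sub>0 nat) \<Rightarrow> 'a" where
  "monom_eval f m = (\<Prod>v\<in>Poly_Mapping.keys m. f v ^ Poly_Mapping.lookup m v)"

definition mpoly_eval :: "('v \<Rightarrow> 'a::comm_ring_1) \<Rightarrow> 'v int_mpoly \<Rightarrow> 'a" where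
  "mpoly_eval f P = (\<Sum>m\<in>Poly_Mapping.keys P. of_int (Poly_Mapping.lookup P m) * monom_eval f m)"

lemma monom_eval_superset:
  assumes "finite K" "Poly_Mapping.keys m \<subseteq> K"
  shows "monom_eval f m = (\<Prod>v\<in>K. f v ^ Poly_Mapping.lookup m v)"
  unfolding monom_eval_def
  by (rule prod.mono_neutral_left) (use assms in \<open>auto simp: in_keys_iff\<close>)

lemma monom_eval_add: "monom_eval f (m + n) = monom_eval f m * monom_eval f n"
proof -
  let ?K = "Poly_Mapping.keys m \<union> Poly_Mapping.keys n"
  have "Poly_Mapping.keys (m + n) \<subseteq> ?K" by (rule Poly_Mapping.keys_add)
  then show ?thesis
    by (simp add: monom_eval_superset[of ?K] lookup_add power_add prod.distrib)
qed

lemma monom_eval_0 [simp]: "monom_eval f 0 = 1"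
  by (simp add: monom_eval_def)

lemma mpoly_eval_0 [simp]: "mpoly_eval f 0 = 0"
  by (simp add: mpoly_eval_def)

lemma mpoly_eval_single: "mpoly_eval f (Poly_Mapping.single m c) = of_int c * monom_eval f m"
  by (simp add: mpoly_eval_def)

lemma mpoly_eval_1 [simp]: "mpoly_eval f 1 = 1"
  unfolding single_one[symmetric] by (simp only: mpoly_eval_single) simp

lemma mpoly_eval_mvar [simp]: "mpoly_eval f (mvar v) = f v"
  by (simp add: mvar_def mpoly_eval_single monom_eval_def)

lemma mpoly_eval_add [simp]: "mpoly_eval f (P + Q) = mpoly_eval f P + mpoly_eval f Q"
  unfolding mpoly_eval_def
  by (rule setsum_keys_plus_distrib) (auto simp: algebra_simps)

lemma mpoly_eval_minus [simp]: "mpoly_eval f (- P) = - mpoly_eval f P"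
  using mpoly_eval_add[of f P "- P"] by (simp add: eq_neg_iff_add_eq_0 add.commute)

lemma mpoly_eval_diff [simp]: "mpoly_eval f (P - Q) = mpoly_eval f P - mpoly_eval f Q"
  using mpoly_eval_add[of f P "- Q"] by simp

lemma mpoly_eval_mult [simp]: "mpoly_eval f (P * Q) = mpoly_eval f P * mpoly_eval f Q"
proof (rule frag_induction[of P UNIV])
  fix m
  show "mpoly_eval f (frag_of m * Q) = mpoly_eval f (frag_of m) * mpoly_eval f Q"
    by (rule frag_induction[of Q UNIV])
       (auto simp: mult_single mpoly_eval_single monom_eval_add right_diff_distrib)
qed (auto simp: left_diff_distrib)

lemma mpoly_eval_power [simp]: "mpoly_eval f (P ^ n) = mpoly_eval f P ^ n"
  by (induction n) auto

lemma mpoly_eval_of_nat [simp]: "mpoly_eval f (of_nat n) = of_nat n"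
  by (induction n) auto

lemma mpoly_eval_sum [simp]: "mpoly_eval f (sum g A) = (\<Sum>i\<in>A. mpoly_eval f (g i))"
  by (induction A rule: infinite_finite_induct) auto

lemma mpoly_eval_prod [simp]: "mpoly_eval f (prod g A) = (\<Prod>i\<in>A. mpoly_eval f (g i))"
  by (induction A rule: infinite_finite_induct) auto

lemma mpoly_eval_monom_eval:
  "mpoly_eval f (monom_eval g m) = monom_eval (\<lambda>v. mpoly_eval f (g v)) m"
  by (simp add: monom_eval_def)

lemma mpoly_eval_mpoly_eval:
  "mpoly_eval f (mpoly_eval g P) = mpoly_eval (\<lambda>v. mpoly_eval f (g v)) P"
  by (rule frag_induction[of P UNIV]) (auto simp: mpoly_eval_single mpoly_eval_monom_eval)

lemma mvar_power: "mvar v ^ n = Poly_Mapping.single (Poly_Mapping.single v n) 1"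
  by (induction n) (auto simp: mvar_def mult_single single_add[symmetric])

lemma single_sum_eq_prod:
  "finite K \<Longrightarrow> Poly_Mapping.single (\<Sum>v\<in>K. g v) (1::int) = (\<Prod>v\<in>K. Poly_Mapping.single (g v) 1)"
proof (induction K rule: finite_induct)
  case (insert v K)
  have "Poly_Mapping.single (g v + sum g K) (1::int) = Poly_Mapping.single (g v) 1 * Poly_Mapping.single (sum g K) 1"
    by (simp only: mult_single mult_1)
  then show ?case using insert by simp
qed simp

lemma monom_eval_mvar: "monom_eval mvar m = frag_of m"
proof -
  have "m = (\<Sum>v\<in>Poly_Mapping.keys m. Poly_Mapping.single v (Poly_Mapping.lookup m v))"
    by (rule poly_mapping_eqI)
       (auto simp: lookup_sum lookup_single when_def in_keys_iff)
  then have "frag_of m = frag_of (\<Sum>v\<in>Poly_Mapping.keys m. Poly_Mapping.single v (Poly_Mapping.lookup m v))"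
    by simp
  also have "\<dots> = (\<Prod>v\<in>Poly_Mapping.keys m. mvar v ^ Poly_Mapping.lookup m v)"
    by (simp add: single_sum_eq_prod mvar_power)
  finally show ?thesis by (simp add: monom_eval_def)
qed

lemma lookup_of_nat_mult:
  "Poly_Mapping.lookup (of_nat n * P :: 'v int_mpoly) m = int n * Poly_Mapping.lookup P m"
  by (induction n) (auto simp: algebra_simps lookup_add)

lemma of_nat_mult_cancel_mpoly:
  fixes P Q :: "'v int_mpoly"
  assumes "of_nat n * P = of_nat n * Q" "n > 0"
  shows "P = Q"
proof (rule poly_mapping_eqI)
  fix m
  have "int n * Poly_Mapping.lookup P m = int n * Poly_Mapping.lookup Q m"
    by (metis assms(1) lookup_of_nat_mult)
  then show "Poly_Mapping.lookup P m = Poly_Mapping.lookup Q m"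
    using assms(2) by simp
qed


section \<open>Congruences modulo powers of a prime\<close>

lemma prime_dvd_binomial_diff:
  fixes x y :: "'a::comm_ring_1"
  assumes "prime p"
  shows "of_nat p dvd (x + y) ^ p - (x ^ p + y ^ p)"
proof -
  have p: "p > 0" using assms prime_gt_0_nat by blast
  have "(x + y) ^ p = (\<Sum>k\<le>p. of_nat (p choose k) * x ^ k * y ^ (p - k))"
    by (rule binomial_ring)
  also have "\<dots> = (\<Sum>k\<in>{0, p} \<union> {0<..<p}. of_nat (p choose k) * x ^ k * y ^ (p - k))"
    by (rule sum.cong) (use p in auto)
  also have "\<dots> = (x ^ p + y ^ p) + (\<Sum>k\<in>{0<..<p}. of_nat (p choose k) * x ^ k * y ^ (p - k))"
    using p by (subst sum.union_disjoint) (auto simp: add.commute)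
  finally have "(x + y) ^ p - (x ^ p + y ^ p) =
      (\<Sum>k\<in>{0<..<p}. of_nat (p choose k) * x ^ k * y ^ (p - k))" by simp
  also have "of_nat p dvd \<dots>"
  proof (rule dvd_sum)
    fix k assume "k \<in> {0<..<p}"
    then have "p dvd (p choose k)" using assms by (auto intro: dvd_choose_prime)
    then obtain c where "p choose k = p * c" by (rule dvdE)
    then have "(of_nat (p choose k) :: 'a) = of_nat p * of_nat c" by (simp only: of_nat_mult)
    then show "of_nat p dvd of_nat (p choose k) * x ^ k * y ^ (p - k)"
      by (simp only: mult.assoc dvd_triv_left)
  qed
  finally show ?thesis .
qed

lemma dvd_power_prime_step:
  fixes a b :: "'a::comm_ring_1"
  assumes "prime p" "of_nat p ^ Suc n dvd a - b"
  shows "of_nat p ^ Suc (Suc n) dvd a ^ p - b ^ p"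
proof -
  let ?S = "\<Sum>i<p. b ^ (p - Suc i) * a ^ i"
  have ab: "of_nat p dvd a - b"
    using assms(2) by (rule dvd_trans[rotated]) simp
  have ab_pow: "of_nat p dvd a ^ i - b ^ i" for i
    unfolding power_diff_sumr2[of a i b] by (rule dvd_mult2[OF ab])
  have "of_nat p dvd (\<Sum>i<p. b ^ (p - Suc i) * (a ^ i - b ^ i))"
    by (intro dvd_sum dvd_mult ab_pow)
  moreover have "(\<Sum>i<p. b ^ (p - Suc i) * b ^ i) = of_nat p * b ^ (p - 1)"
  proof -
    have "(\<Sum>i<p. b ^ (p - Suc i) * b ^ i) = (\<Sum>i<p. b ^ (p - 1))"
      by (rule sum.cong) (auto simp: power_add[symmetric])
    then show ?thesis by simp
  qed
  moreover have "?S = (\<Sum>i<p. b ^ (p - Suc i) * (a ^ i - b ^ i)) + (\<Sum>i<p. b ^ (p - Suc i) * b ^ i)"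
    unfolding sum.distrib[symmetric] by (rule sum.cong) (simp_all add: right_diff_distrib)
  ultimately have "of_nat p dvd ?S"
    by (simp only:) (rule dvd_add[OF _ dvd_triv_left])
  then have "of_nat p ^ Suc n * of_nat p dvd (a - b) * ?S"
    by (rule mult_dvd_mono[OF assms(2)])
  then show ?thesis
    unfolding power_diff_sumr2[of a p b] power_Suc2[of _ "Suc n"] .
qed

lemma dvd_power_prime_power:
  fixes a b :: "'a::comm_ring_1"
  assumes "prime p" "of_nat p dvd a - b"
  shows "of_nat p ^ Suc n dvd a ^ (p ^ n) - b ^ (p ^ n)"
proof (induction n)
  case 0
  then show ?case using assms by simp
next
  case (Suc n)
  have "of_nat p ^ Suc (Suc n) dvd (a ^ (p ^ n)) ^ p - (b ^ (p ^ n)) ^ p"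
    by (rule dvd_power_prime_step[OF assms(1) Suc.IH])
  then show ?case by (simp add: power_mult[symmetric] mult.commute)
qed


section \<open>Witt polynomials\<close>

definition witt_poly :: "nat \<Rightarrow> nat \<Rightarrow> (nat \<Rightarrow> 'a::comm_ring_1) \<Rightarrow> 'a" where
  "witt_poly p n x = (\<Sum>i\<le>n. of_nat p ^ i * x i ^ (p ^ (n - i)))"

text \<open>
  The universal polynomials of Witt: the variables \<open>Inl i\<close> and \<open>Inr i\<close> stand for the \<open>i\<close>-th
  component of the first and the second argument. Existence and uniqueness of the polynomials
  are shown below (\<open>witt_universal_add\<close> etc.).
\<close>

definition witt_universal :: "nat \<Rightarrow> (nat \<Rightarrow> 'v int_mpoly) \<Rightarrow> nat \<Rightarrow> 'v int_mpoly" where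
  "witt_universal p g = (THE S. \<forall>n. witt_poly p n S = g n)"

definition witt_add_poly :: "nat \<Rightarrow> nat \<Rightarrow> (nat + nat) int_mpoly" where
  "witt_add_poly p = witt_universal p
     (\<lambda>n. witt_poly p n (mvar \<circ> Inl) + witt_poly p n (mvar \<circ> Inr))"

definition witt_mult_poly :: "nat \<Rightarrow> nat \<Rightarrow> (nat + nat) int_mpoly" where
  "witt_mult_poly p = witt_universal p
     (\<lambda>n. witt_poly p n (mvar \<circ> Inl) * witt_poly p n (mvar \<circ> Inr))"

definition witt_neg_poly :: "nat \<Rightarrow> nat \<Rightarrow> nat int_mpoly" where
  "witt_neg_poly p = witt_universal p (\<lambda>n. - witt_poly p n mvar)"

lemma witt_poly_hom: "mpoly_eval f (witt_poly p n x) = witt_poly p n (\<lambda>i. mpoly_eval f (x i))"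
  by (simp add: witt_poly_def)

lemma witt_poly_cong: "(\<And>i. i \<le> n \<Longrightarrow> x i = y i) \<Longrightarrow> witt_poly p n x = witt_poly p n y"
  by (simp add: witt_poly_def)

lemma witt_poly_Suc:
  "witt_poly p (Suc n) x = witt_poly p n (\<lambda>i. x i ^ p) + of_nat p ^ Suc n * x (Suc n)"
proof -
  have "(\<Sum>i\<le>n. of_nat p ^ i * x i ^ (p ^ (Suc n - i))) =
        (\<Sum>i\<le>n. of_nat p ^ i * (x i ^ p) ^ (p ^ (n - i)))"
    by (rule sum.cong) (auto simp: Suc_diff_le power_mult[symmetric])
  then show ?thesis by (simp add: witt_poly_def)
qed

lemma witt_poly_dvd:
  assumes "prime p" "\<And>i. i \<le> n \<Longrightarrow> of_nat p dvd x i - y i"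
  shows "of_nat p ^ Suc n dvd witt_poly p n x - witt_poly p n y"
proof -
  have "of_nat p ^ Suc n dvd of_nat p ^ i * x i ^ (p ^ (n - i)) - of_nat p ^ i * y i ^ (p ^ (n - i))"
    if "i \<le> n" for i
  proof -
    have "of_nat p ^ i * of_nat p ^ Suc (n - i) dvd
        of_nat p ^ i * (x i ^ (p ^ (n - i)) - y i ^ (p ^ (n - i)))"
      by (intro mult_dvd_mono dvd_refl dvd_power_prime_power assms that)
    moreover have "of_nat p ^ i * of_nat p ^ Suc (n - i) = (of_nat p ^ Suc n :: 'a)"
      using that by (simp add: power_add[symmetric] del: power_Suc)
    ultimately show ?thesis by (simp add: right_diff_distrib del: power_Suc)
  qed
  then show ?thesis
    unfolding witt_poly_def sum_subtractf[symmetric] by (intro dvd_sum) auto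
qed

definition frob_lift :: "nat \<Rightarrow> 'v int_mpoly \<Rightarrow> 'v int_mpoly" where
  "frob_lift p = mpoly_eval (\<lambda>v. mvar v ^ p)"

lemma frob_lift_dvd:
  assumes "prime p"
  shows "of_nat p dvd frob_lift p P - P ^ p"
proof (rule frag_induction[of P UNIV])
  show "of_nat p dvd frob_lift p 0 - 0 ^ p"
    using assms prime_gt_0_nat[of p] by (simp add: frob_lift_def zero_power)
next
  fix m
  have "frob_lift p (frag_of m) = frag_of m ^ p"
    by (simp add: frob_lift_def mpoly_eval_single monom_eval_mvar[symmetric])
       (simp add: monom_eval_def prod_power_distrib power_mult[symmetric] mult.commute)
  then show "of_nat p dvd frob_lift p (frag_of m) - frag_of m ^ p" by simp
next
  fix a b :: "'a int_mpoly"
  assume a: "of_nat p dvd frob_lift p a - a ^ p" and b: "of_nat p dvd frob_lift p b - b ^ p"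
  have c: "of_nat p dvd ((a - b) + b) ^ p - ((a - b) ^ p + b ^ p)"
    by (rule prime_dvd_binomial_diff[OF assms])
  have "frob_lift p (a - b) - (a - b) ^ p =
      (frob_lift p a - a ^ p) - (frob_lift p b - b ^ p) + (((a - b) + b) ^ p - ((a - b) ^ p + b ^ p))"
    by (simp add: frob_lift_def)
  then show "of_nat p dvd frob_lift p (a - b) - (a - b) ^ p"
    using a b c by (metis dvd_add dvd_diff)
qed auto

definition dwork :: "nat \<Rightarrow> (nat \<Rightarrow> 'v int_mpoly) \<Rightarrow> bool" where
  "dwork p g \<longleftrightarrow> (\<forall>n. of_nat p ^ Suc n dvd g (Suc n) - frob_lift p (g n))"

lemma dwork_witt_poly:
  assumes "prime p"
  shows "dwork p (\<lambda>n. witt_poly p n x)"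
  unfolding dwork_def
proof
  fix n
  have "of_nat p ^ Suc n dvd witt_poly p n (\<lambda>i. frob_lift p (x i)) - witt_poly p n (\<lambda>i. x i ^ p)"
    by (intro witt_poly_dvd frob_lift_dvd assms)
  from dvd_diff[OF dvd_triv_left this]
  have "of_nat p ^ Suc n dvd of_nat p ^ Suc n * x (Suc n)
     - (witt_poly p n (\<lambda>i. frob_lift p (x i)) - witt_poly p n (\<lambda>i. x i ^ p))" .
  then show "of_nat p ^ Suc n dvd witt_poly p (Suc n) x - frob_lift p (witt_poly p n x)"
    by (simp add: witt_poly_Suc frob_lift_def witt_poly_hom algebra_simps del: power_Suc)
qed

lemma dwork_add: "dwork p g \<Longrightarrow> dwork p h \<Longrightarrow> dwork p (\<lambda>n. g n + h n)"
  unfolding dwork_def frob_lift_def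
proof
  fix n assume "\<forall>n. of_nat p ^ Suc n dvd g (Suc n) - mpoly_eval (\<lambda>v. mvar v ^ p) (g n)"
    and "\<forall>n. of_nat p ^ Suc n dvd h (Suc n) - mpoly_eval (\<lambda>v. mvar v ^ p) (h n)"
  then have "of_nat p ^ Suc n dvd (g (Suc n) - mpoly_eval (\<lambda>v. mvar v ^ p) (g n))
    + (h (Suc n) - mpoly_eval (\<lambda>v. mvar v ^ p) (h n))" by (intro dvd_add) blast+
  then show "of_nat p ^ Suc n dvd g (Suc n) + h (Suc n) - mpoly_eval (\<lambda>v. mvar v ^ p) (g n + h n)"
    by (simp add: algebra_simps del: power_Suc)
qed

lemma dwork_mult: "dwork p g \<Longrightarrow> dwork p h \<Longrightarrow> dwork p (\<lambda>n. g n * h n)"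
  unfolding dwork_def frob_lift_def
proof
  fix n assume "\<forall>n. of_nat p ^ Suc n dvd g (Suc n) - mpoly_eval (\<lambda>v. mvar v ^ p) (g n)"
    and "\<forall>n. of_nat p ^ Suc n dvd h (Suc n) - mpoly_eval (\<lambda>v. mvar v ^ p) (h n)"
  then have "of_nat p ^ Suc n dvd (g (Suc n) - mpoly_eval (\<lambda>v. mvar v ^ p) (g n)) * h (Suc n)
    + mpoly_eval (\<lambda>v. mvar v ^ p) (g n) * (h (Suc n) - mpoly_eval (\<lambda>v. mvar v ^ p) (h n))"
    by (intro dvd_add dvd_mult dvd_mult2) blast+
  then show "of_nat p ^ Suc n dvd g (Suc n) * h (Suc n) - mpoly_eval (\<lambda>v. mvar v ^ p) (g n * h n)"
    by (simp add: algebra_simps del: power_Suc)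
qed

lemma dwork_minus:
  assumes "dwork p g"
  shows "dwork p (\<lambda>n. - g n)"
  unfolding dwork_def
proof
  fix n
  have "of_nat p ^ Suc n dvd - (g (Suc n) - frob_lift p (g n))"
    using assms unfolding dwork_def dvd_minus_iff by blast
  then show "of_nat p ^ Suc n dvd - g (Suc n) - frob_lift p (- g n)"
    by (simp add: frob_lift_def del: power_Suc)
qed

lemma witt_poly_inj:
  fixes x y :: "nat \<Rightarrow> 'v int_mpoly"
  assumes "prime p" "\<And>i. i \<le> n \<Longrightarrow> witt_poly p i x = witt_poly p i y"
  shows "i \<le> n \<Longrightarrow> x i = y i"
proof (induction i rule: less_induct)
  case (less i)
  show ?case
  proof (cases i)
    case 0
    then show ?thesis using assms(2)[of 0] by (simp add: witt_poly_def)
  next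
    case (Suc j)
    have "witt_poly p j (\<lambda>i. x i ^ p) = witt_poly p j (\<lambda>i. y i ^ p)"
      by (rule witt_poly_cong) (use less Suc in simp)
    moreover have "witt_poly p (Suc j) x = witt_poly p (Suc j) y"
      using less Suc by (intro assms) auto
    ultimately have "of_nat (p ^ Suc j) * x (Suc j) = of_nat (p ^ Suc j) * y (Suc j)"
      by (simp add: witt_poly_Suc of_nat_power del: power_Suc)
    then show ?thesis
      using of_nat_mult_cancel_mpoly assms(1) prime_gt_0_nat Suc by (metis zero_less_power)
  qed
qed

lemma witt_poly_eqI:
  fixes x y :: "nat \<Rightarrow> 'v int_mpoly"
  assumes "prime p" "\<And>i. witt_poly p i x = witt_poly p i y"
  shows "x = y"
  using witt_poly_inj[OF assms(1)] assms(2) by blast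

lemma dwork_exists:
  assumes "prime p" "dwork p g"
  shows "\<exists>x. \<forall>n. witt_poly p n x = g n"
proof -
  have "\<exists>x. \<forall>n\<le>N. witt_poly p n x = g n" for N
  proof (induction N)
    case 0
    have "\<forall>n\<le>0. witt_poly p n (\<lambda>_. g 0) = g n" by (simp add: witt_poly_def)
    then show ?case by - (rule exI[where x = "\<lambda>_. g 0"])
  next
    case (Suc N)
    then obtain x where x: "\<forall>n\<le>N. witt_poly p n x = g n" by (rule exE)
    have "of_nat p ^ Suc N dvd witt_poly p N (\<lambda>i. frob_lift p (x i)) - witt_poly p N (\<lambda>i. x i ^ p)"
      by (rule witt_poly_dvd[OF assms(1) frob_lift_dvd[OF assms(1)]])
    moreover have "witt_poly p N (\<lambda>i. frob_lift p (x i)) = frob_lift p (g N)"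
    proof -
      have "g N = witt_poly p N x" using x by simp
      then show ?thesis by (simp only: frob_lift_def witt_poly_hom)
    qed
    ultimately have 1: "of_nat p ^ Suc N dvd frob_lift p (g N) - witt_poly p N (\<lambda>i. x i ^ p)"
      by (simp only:)
    have 2: "of_nat p ^ Suc N dvd g (Suc N) - frob_lift p (g N)"
      using assms(2) unfolding dwork_def by (rule spec)
    have "of_nat p ^ Suc N dvd g (Suc N) - witt_poly p N (\<lambda>i. x i ^ p)"
      using dvd_add[OF 2 1] by (simp only: diff_add_cancel add_diff_eq)
    then obtain y where y: "g (Suc N) - witt_poly p N (\<lambda>i. x i ^ p) = of_nat p ^ Suc N * y"
      by (rule dvdE)
    let ?x = "x(Suc N := y)"
    have "witt_poly p n ?x = g n" if "n \<le> Suc N" for n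
    proof (cases "n = Suc N")
      case True
      have "witt_poly p N (\<lambda>i. ?x i ^ p) = witt_poly p N (\<lambda>i. x i ^ p)"
        by (rule witt_poly_cong) simp
      then have "witt_poly p (Suc N) ?x = witt_poly p N (\<lambda>i. x i ^ p) + of_nat p ^ Suc N * y"
        by (simp only: witt_poly_Suc fun_upd_same)
      also have "\<dots> = g (Suc N)" by (simp only: y[symmetric] add_diff_eq add_diff_cancel_left')
      finally show ?thesis using True by (simp only:)
    next
      case False
      then have n: "n \<le> N" using that by simp
      have "witt_poly p n ?x = witt_poly p n x"
        by (rule witt_poly_cong) (use n in simp)
      then show ?thesis using x n by simp
    qed
    then have "\<forall>n\<le>Suc N. witt_poly p n ?x = g n" by blast
    then show ?case by - (rule exI[where x = ?x])
  qed
  then have "\<forall>N. \<exists>x. \<forall>n\<le>N. witt_poly p n x = g n" by (rule allI)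
  from choice[OF this] obtain X where X: "\<forall>N. \<forall>n\<le>N. witt_poly p n (X N) = g n"
    by (rule exE)
  have X_eq: "X N i = X i i" if "i \<le> N" for i N
  proof (rule witt_poly_inj[OF assms(1), where x = "X N" and y = "X i" and i = i and n = i])
    fix j assume j: "j \<le> i"
    have "witt_poly p j (X N) = g j" using X j that le_trans[of j i N] by simp
    moreover have "witt_poly p j (X i) = g j" using X j by simp
    ultimately show "witt_poly p j (X N) = witt_poly p j (X i)" by (rule trans[OF _ sym])
  qed (rule order_refl)
  have "witt_poly p n (\<lambda>i. X i i) = g n" for n
  proof -
    have "witt_poly p n (\<lambda>i. X i i) = witt_poly p n (X n)"
    proof (rule witt_poly_cong)
      fix i assume "i \<le> n"
      then show "X i i = X n i" by (rule X_eq[symmetric])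
    qed
    also have "\<dots> = g n" using X by simp
    finally show ?thesis .
  qed
  then have "\<forall>n. witt_poly p n (\<lambda>i. X i i) = g n" by (rule allI)
  then show ?thesis
    by - (rule exI[where x = "\<lambda>i. X i i"])
qed

lemma witt_universal:
  assumes "prime p" "dwork p g"
  shows "witt_poly p n (witt_universal p g) = g n"
proof -
  have "\<exists>!x. \<forall>n. witt_poly p n x = g n"
  proof (rule ex_ex1I[OF dwork_exists[OF assms]])
    fix x y :: "nat \<Rightarrow> 'a int_mpoly"
    assume "\<forall>n. witt_poly p n x = g n" "\<forall>n. witt_poly p n y = g n"
    then show "x = y" by (intro witt_poly_eqI[OF assms(1)]) simp
  qed
  from theI'[OF this] show ?thesis unfolding witt_universal_def by blast
qed

lemma witt_universal_add:
  "prime p \<Longrightarrow> witt_poly p n (witt_add_poly p) =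
     witt_poly p n (mvar \<circ> Inl) + witt_poly p n (mvar \<circ> Inr)"
  unfolding witt_add_poly_def
  using witt_universal[of p "\<lambda>n. witt_poly p n (mvar \<circ> Inl) + witt_poly p n (mvar \<circ> Inr)" n]
    dwork_add[OF dwork_witt_poly[of p "mvar \<circ> Inl"] dwork_witt_poly[of p "mvar \<circ> Inr"]]
  by simp

lemma witt_universal_mult:
  "prime p \<Longrightarrow> witt_poly p n (witt_mult_poly p) =
     witt_poly p n (mvar \<circ> Inl) * witt_poly p n (mvar \<circ> Inr)"
  unfolding witt_mult_poly_def
  using witt_universal[of p "\<lambda>n. witt_poly p n (mvar \<circ> Inl) * witt_poly p n (mvar \<circ> Inr)" n]
    dwork_mult[OF dwork_witt_poly[of p "mvar \<circ> Inl"] dwork_witt_poly[of p "mvar \<circ> Inr"]]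
  by simp

lemma witt_universal_neg:
  "prime p \<Longrightarrow> witt_poly p n (witt_neg_poly p) = - witt_poly p n mvar"
  unfolding witt_neg_poly_def
  using witt_universal[of p "\<lambda>n. - witt_poly p n mvar" n] dwork_minus[OF dwork_witt_poly[of p mvar]]
  by simp

definition wadd :: "nat \<Rightarrow> (nat \<Rightarrow> 'a::comm_ring_1) \<Rightarrow> (nat \<Rightarrow> 'a) \<Rightarrow> nat \<Rightarrow> 'a" where
  "wadd p x y n = mpoly_eval (case_sum x y) (witt_add_poly p n)"

definition wmult :: "nat \<Rightarrow> (nat \<Rightarrow> 'a::comm_ring_1) \<Rightarrow> (nat \<Rightarrow> 'a) \<Rightarrow> nat \<Rightarrow> 'a" where
  "wmult p x y n = mpoly_eval (case_sum x y) (witt_mult_poly p n)"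

definition wneg :: "nat \<Rightarrow> (nat \<Rightarrow> 'a::comm_ring_1) \<Rightarrow> nat \<Rightarrow> 'a" where
  "wneg p x n = mpoly_eval x (witt_neg_poly p n)"

definition wone :: "nat \<Rightarrow> 'a::comm_ring_1" where
  "wone n = (if n = 0 then 1 else 0)"

lemma witt_poly_wadd:
  assumes "prime p"
  shows "witt_poly p n (wadd p x y) = witt_poly p n x + witt_poly p n y"
proof -
  have "witt_poly p n (wadd p x y) = mpoly_eval (case_sum x y) (witt_poly p n (witt_add_poly p))"
    by (simp add: witt_poly_hom wadd_def[abs_def])
  then show ?thesis by (simp add: witt_universal_add[OF assms] witt_poly_hom)
qed

lemma witt_poly_wmult:
  assumes "prime p"
  shows "witt_poly p n (wmult p x y) = witt_poly p n x * witt_poly p n y"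
proof -
  have "witt_poly p n (wmult p x y) = mpoly_eval (case_sum x y) (witt_poly p n (witt_mult_poly p))"
    by (simp add: witt_poly_hom wmult_def[abs_def])
  then show ?thesis by (simp add: witt_universal_mult[OF assms] witt_poly_hom)
qed

lemma witt_poly_wneg:
  assumes "prime p"
  shows "witt_poly p n (wneg p x) = - witt_poly p n x"
proof -
  have "witt_poly p n (wneg p x) = mpoly_eval x (witt_poly p n (witt_neg_poly p))"
    by (simp add: witt_poly_hom wneg_def[abs_def])
  then show ?thesis by (simp add: witt_universal_neg[OF assms] witt_poly_hom)
qed

lemma witt_poly_zero: "prime p \<Longrightarrow> witt_poly p n (\<lambda>_. 0) = 0"
  using prime_gt_0_nat[of p] by (simp add: witt_poly_def zero_power)

lemma witt_poly_wone: "prime p \<Longrightarrow> witt_poly p n wone = 1"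
proof -
  assume "prime p"
  then have "(0::'a) ^ (p ^ k) = 0" for k using prime_gt_0_nat[of p] by (simp add: zero_power)
  then have "witt_poly p n wone = (\<Sum>i\<le>n. if i = 0 then 1 else 0::'a)"
    unfolding witt_poly_def wone_def by (intro sum.cong) auto
  then show ?thesis by simp
qed

lemma mpoly_eval_case_sum:
  "(\<lambda>v. mpoly_eval f (case_sum x y v)) = case_sum (\<lambda>i. mpoly_eval f (x i)) (\<lambda>i. mpoly_eval f (y i))"
  by (auto split: sum.splits)

lemma wadd_hom: "mpoly_eval f (wadd p x y n) = wadd p (\<lambda>i. mpoly_eval f (x i)) (\<lambda>i. mpoly_eval f (y i)) n"
  by (simp add: wadd_def mpoly_eval_mpoly_eval mpoly_eval_case_sum)

lemma wmult_hom: "mpoly_eval f (wmult p x y n) = wmult p (\<lambda>i. mpoly_eval f (x i)) (\<lambda>i. mpoly_eval f (y i)) n"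
  by (simp add: wmult_def mpoly_eval_mpoly_eval mpoly_eval_case_sum)

lemma wneg_hom: "mpoly_eval f (wneg p x n) = wneg p (\<lambda>i. mpoly_eval f (x i)) n"
  unfolding wneg_def mpoly_eval_mpoly_eval by simp

lemma wone_hom: "mpoly_eval f (wone n) = wone n"
  by (simp add: wone_def)

text \<open>
  Ring identities are transferred from the polynomial ring with one variable for each element
  of the ring, on which the Witt polynomials are jointly injective.
\<close>

lemma seq_lift: "x = (\<lambda>i. mpoly_eval (\<lambda>a. a) (mvar (x i)))"
  by simp

lemma seq_lift_witt_poly_eq:
  fixes X Y :: "nat \<Rightarrow> 'a::comm_ring_1 int_mpoly"
  assumes "prime p" "\<And>n. witt_poly p n X = witt_poly p n Y"
  shows "(\<lambda>i. mpoly_eval (\<lambda>a. a) (X i)) = (\<lambda>i. mpoly_eval (\<lambda>a. a) (Y i))"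
  using witt_poly_eqI[OF assms] by simp

lemmas witt_poly_ops = witt_poly_wadd witt_poly_wmult witt_poly_wneg witt_poly_zero witt_poly_wone

context
  fixes p :: nat assumes p: "prime p"
begin

lemma wadd_assoc: "wadd p (wadd p x y) z = wadd p x (wadd p y z)"
  using seq_lift_witt_poly_eq[OF p, of
    "wadd p (wadd p (mvar \<circ> x) (mvar \<circ> y)) (mvar \<circ> z)"
    "wadd p (mvar \<circ> x) (wadd p (mvar \<circ> y) (mvar \<circ> z))"]
  by (simp add: witt_poly_ops[OF p] wadd_hom add.assoc)

lemma wadd_commute: "wadd p x y = wadd p y x"
  using seq_lift_witt_poly_eq[OF p, of
    "wadd p (mvar \<circ> x) (mvar \<circ> y)" "wadd p (mvar \<circ> y) (mvar \<circ> x)"]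
  by (simp add: witt_poly_ops[OF p] wadd_hom add.commute)

lemma wadd_zero: "wadd p (\<lambda>_. 0) x = x"
  using seq_lift_witt_poly_eq[OF p, of "wadd p (\<lambda>_. 0) (mvar \<circ> x)" "mvar \<circ> x"]
  by (simp add: witt_poly_ops[OF p] wadd_hom)

lemma wadd_wneg: "wadd p (wneg p x) x = (\<lambda>_. 0)"
  using seq_lift_witt_poly_eq[OF p, of "wadd p (wneg p (mvar \<circ> x)) (mvar \<circ> x)" "\<lambda>_. 0"]
  by (simp add: witt_poly_ops[OF p] wadd_hom wneg_hom)

lemma wmult_assoc: "wmult p (wmult p x y) z = wmult p x (wmult p y z)"
  using seq_lift_witt_poly_eq[OF p, of
    "wmult p (wmult p (mvar \<circ> x) (mvar \<circ> y)) (mvar \<circ> z)"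
    "wmult p (mvar \<circ> x) (wmult p (mvar \<circ> y) (mvar \<circ> z))"]
  by (simp add: witt_poly_ops[OF p] wmult_hom mult.assoc)

lemma wmult_commute: "wmult p x y = wmult p y x"
  using seq_lift_witt_poly_eq[OF p, of
    "wmult p (mvar \<circ> x) (mvar \<circ> y)" "wmult p (mvar \<circ> y) (mvar \<circ> x)"]
  by (simp add: witt_poly_ops[OF p] wmult_hom mult.commute)

lemma wmult_one: "wmult p wone x = x"
  using seq_lift_witt_poly_eq[OF p, of "wmult p wone (mvar \<circ> x)" "mvar \<circ> x"]
  by (simp add: witt_poly_ops[OF p] wmult_hom wone_hom)

lemma wmult_wadd: "wmult p (wadd p x y) z = wadd p (wmult p x z) (wmult p y z)"
  using seq_lift_witt_poly_eq[OF p, of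
    "wmult p (wadd p (mvar \<circ> x) (mvar \<circ> y)) (mvar \<circ> z)"
    "wadd p (wmult p (mvar \<circ> x) (mvar \<circ> z)) (wmult p (mvar \<circ> y) (mvar \<circ> z))"]
  by (simp add: witt_poly_ops[OF p] wmult_hom wadd_hom distrib_right)

end


section \<open>The ring of Witt vectors over a ring of characteristic \<open>p\<close>\<close>

typedef 'k witt = "UNIV :: (nat \<Rightarrow> 'k) set"
  morphisms witt_nth Witt ..

setup_lifting type_definition_witt

instantiation witt :: (comm_ring_prime_char) comm_ring_1
begin

lift_definition zero_witt :: "'a witt" is "\<lambda>_. 0" .
lift_definition one_witt :: "'a witt" is wone .
lift_definition plus_witt :: "'a witt \<Rightarrow> 'a witt \<Rightarrow> 'a witt" is "wadd CHAR('a)" .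
lift_definition times_witt :: "'a witt \<Rightarrow> 'a witt \<Rightarrow> 'a witt" is "wmult CHAR('a)" .
lift_definition uminus_witt :: "'a witt \<Rightarrow> 'a witt" is "wneg CHAR('a)" .
definition minus_witt :: "'a witt \<Rightarrow> 'a witt \<Rightarrow> 'a witt" where "minus_witt x y = x + - y"

instance
proof
  fix a b c :: "'a witt"
  have p: "prime CHAR('a)" by simp
  show "a * b * c = a * (b * c)" by transfer (rule wmult_assoc[OF p])
  show "a * b = b * a" by transfer (rule wmult_commute[OF p])
  show "1 * a = a" by transfer (rule wmult_one[OF p])
  show "a + b + c = a + (b + c)" by transfer (rule wadd_assoc[OF p])
  show "a + b = b + a" by transfer (rule wadd_commute[OF p])
  show "0 + a = a" by transfer (rule wadd_zero[OF p])
  show "- a + a = 0" by transfer (rule wadd_wneg[OF p])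
  show "a - b = a + - b" by (rule minus_witt_def)
  show "(a + b) * c = a * c + b * c" by transfer (rule wmult_wadd[OF p])
  show "(0::'a witt) \<noteq> 1"
    by transfer (auto simp: wone_def fun_eq_iff)
qed

end

lift_definition witt_frob :: "'k::comm_ring_prime_char witt \<Rightarrow> 'k witt" is "\<lambda>x n. x n ^ CHAR('k)" .


subsection \<open>Characteristic\<close>

lemma witt_poly_dvd_components:
  fixes x y :: "nat \<Rightarrow> 'v int_mpoly"
  assumes p: "prime p" and "\<And>n. of_nat p ^ Suc n dvd witt_poly p n x - witt_poly p n y"
  shows "of_nat p dvd x n - y n"
proof (induction n rule: less_induct)
  case (less n)
  let ?x = "x(n := 0)" and ?y = "y(n := 0)"
  have split: "witt_poly p n z = witt_poly p n (z(n := 0)) + of_nat p ^ n * z n"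
    for z :: "nat \<Rightarrow> 'v int_mpoly"
  proof -
    have "witt_poly p n z = (\<Sum>i<n. of_nat p ^ i * z i ^ (p ^ (n - i))) + of_nat p ^ n * z n" for z :: "nat \<Rightarrow> 'v int_mpoly"
      unfolding witt_poly_def lessThan_Suc_atMost[symmetric] by simp
    from this[of z] this[of "z(n := 0)"] show ?thesis by simp
  qed
  have "of_nat p ^ Suc n dvd witt_poly p n ?x - witt_poly p n ?y"
    by (rule witt_poly_dvd[OF p]) (use less.IH in auto)
  from dvd_diff[OF assms(2)[of n] this]
  have "of_nat p ^ Suc n dvd of_nat p ^ n * (x n - y n)"
    unfolding split[of x] split[of y] by (simp add: algebra_simps del: power_Suc)
  then obtain c where "of_nat p ^ n * (x n - y n) = of_nat p ^ Suc n * c" by (rule dvdE)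
  then have "of_nat (p ^ n) * (x n - y n) = of_nat (p ^ n) * (of_nat p * c)"
    by (simp only: of_nat_power power_Suc2 mult.assoc)
  then have "x n - y n = of_nat p * c"
    by (rule of_nat_mult_cancel_mpoly) (use prime_gt_0_nat[OF p] in simp)
  then show ?case by (simp only: dvd_triv_left)
qed

definition wnat_mult :: "nat \<Rightarrow> nat \<Rightarrow> (nat \<Rightarrow> 'a::comm_ring_1) \<Rightarrow> nat \<Rightarrow> 'a" where
  "wnat_mult p k x = (wadd p x ^^ k) (\<lambda>_. 0)"

lemma witt_poly_wnat_mult:
  "prime p \<Longrightarrow> witt_poly p n (wnat_mult p k x) = of_nat k * witt_poly p n x"
  by (induction k) (auto simp: wnat_mult_def witt_poly_zero witt_poly_wadd algebra_simps)

lemma wnat_mult_hom: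
  "(\<lambda>n. mpoly_eval f (wnat_mult p k x n)) = wnat_mult p k (\<lambda>i. mpoly_eval f (x i))"
  by (induction k) (auto simp: wnat_mult_def wadd_hom)

lemma witt_nth_of_nat_mult:
  "witt_nth (of_nat n * x) = wnat_mult CHAR('k) n (witt_nth (x :: 'k::comm_ring_prime_char witt))"
proof (induction n)
  case 0
  then show ?case by (simp add: wnat_mult_def zero_witt.rep_eq)
next
  case (Suc n)
  have "witt_nth (of_nat (Suc n) * x) = wadd CHAR('k) (witt_nth x) (witt_nth (of_nat n * x))"
    by (simp add: distrib_right plus_witt.rep_eq)
  then show ?case by (simp add: wnat_mult_def Suc)
qed

lemma witt_nth_CHAR_mult:
  "witt_nth (of_nat CHAR('k) * x) n =
     (case n of 0 \<Rightarrow> 0 | Suc m \<Rightarrow> witt_nth (x :: 'k::comm_ring_prime_char witt) m ^ CHAR('k))"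
proof -
  define p where "p = CHAR('k)"
  have p: "prime p" by (simp add: p_def)
  define X where "X = (\<lambda>i. mvar (witt_nth x i) :: 'k int_mpoly)"
  define Y where "Y = (\<lambda>n. case n of 0 \<Rightarrow> 0 | Suc m \<Rightarrow> X m ^ p)"
  have "of_nat p ^ Suc n dvd witt_poly p n (wnat_mult p p X) - witt_poly p n Y" for n
  proof -
    have "witt_poly p n Y = (\<Sum>i<n. of_nat p ^ Suc i * (X i ^ p) ^ (p ^ (n - Suc i)))"
      unfolding witt_poly_def lessThan_Suc_atMost[symmetric] sum.lessThan_Suc_shift
      using prime_gt_0_nat[OF p] by (simp add: Y_def zero_power)
    also have "\<dots> = (\<Sum>i<n. of_nat p * (of_nat p ^ i * X i ^ (p ^ (n - i))))"
    proof (rule sum.cong)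
      fix i assume "i \<in> {..<n}"
      then have "p * p ^ (n - Suc i) = p ^ (n - i)"
        by (simp add: power_Suc[symmetric] Suc_diff_Suc del: power_Suc)
      then show "of_nat p ^ Suc i * (X i ^ p) ^ (p ^ (n - Suc i)) =
          of_nat p * (of_nat p ^ i * X i ^ (p ^ (n - i)))"
        by (simp add: power_mult[symmetric] mult.assoc)
    qed simp
    also have "\<dots> + of_nat p ^ Suc n * X n = of_nat p * witt_poly p n X"
      unfolding witt_poly_def lessThan_Suc_atMost[symmetric]
      by (simp add: sum_distrib_left distrib_left mult.assoc)
    finally have "witt_poly p n (wnat_mult p p X) - witt_poly p n Y = of_nat p ^ Suc n * X n"
      unfolding witt_poly_wnat_mult[OF p] by (simp add: eq_diff_eq diff_eq_eq add.commute)
    then show ?thesis by (simp only: dvd_triv_left)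
  qed
  then have "of_nat p dvd wnat_mult p p X n - Y n"
    by (rule witt_poly_dvd_components[OF p])
  then obtain c where "wnat_mult p p X n - Y n = of_nat p * c" by (rule dvdE)
  then have "mpoly_eval (\<lambda>a. a) (wnat_mult p p X n - Y n) = mpoly_eval (\<lambda>a. a) (of_nat p * c)"
    by (simp only:)
  then have "mpoly_eval (\<lambda>a. a) (wnat_mult p p X n) = mpoly_eval (\<lambda>a. a) (Y n)"
    by (simp add: p_def)
  moreover have "(\<lambda>n. mpoly_eval (\<lambda>a. a) (wnat_mult p p X n)) = wnat_mult p p (witt_nth x)"
    unfolding wnat_mult_hom by (simp add: X_def)
  ultimately have "wnat_mult p p (witt_nth x) n = mpoly_eval (\<lambda>a. a) (Y n)"
    by (metis (no_types))
  then show ?thesis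
    unfolding witt_nth_of_nat_mult p_def[symmetric] by (cases n) (auto simp: Y_def X_def)
qed

lemma CHAR_mult_witt_eq_0:
  fixes x :: "'k::idom_prime_char witt"
  assumes "of_nat CHAR('k) * x = 0"
  shows "x = 0"
proof -
  have "witt_nth x m = 0" for m
  proof -
    have "witt_nth x m ^ CHAR('k) = 0"
      using witt_nth_CHAR_mult[of x "Suc m"] assms by (simp add: zero_witt.rep_eq)
    then show ?thesis by simp
  qed
  then have "witt_nth x = witt_nth 0" by (simp add: zero_witt.rep_eq fun_eq_iff)
  then show ?thesis by (simp add: witt_nth_inject)
qed

lemma wadd_nth_0: "prime p \<Longrightarrow> wadd p x y 0 = x 0 + y 0"
  using witt_poly_wadd[of p 0 x y] by (simp add: witt_poly_def)

lemma witt_nth_of_nat_0: "witt_nth (of_nat n :: 'k::comm_ring_prime_char witt) 0 = of_nat n"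
  by (induction n) (auto simp: zero_witt.rep_eq plus_witt.rep_eq one_witt.rep_eq wadd_nth_0 wone_def)

instance witt :: (idom_prime_char) ring_char_0
proof
  have nz: "of_nat n \<noteq> (0 :: 'a witt)" if "n > 0" for n
    using that
  proof (induction n rule: less_induct)
    case (less n)
    show ?case
    proof
      assume 0: "of_nat n = (0 :: 'a witt)"
      then have "(of_nat n :: 'a) = 0"
        using witt_nth_of_nat_0[where 'k = 'a, of n] by (simp add: zero_witt.rep_eq)
      then have "CHAR('a) dvd n" by (simp only: of_nat_eq_0_iff_char_dvd)
      then obtain m where m: "n = CHAR('a) * m" by (rule dvdE)
      have "CHAR('a) > 1" using prime_gt_1_nat[OF CHAR_prime] .
      then have "m < n" "m > 0" using m less.prems by auto
      moreover have "of_nat m = (0 :: 'a witt)"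
        using 0 unfolding m of_nat_mult by (rule CHAR_mult_witt_eq_0)
      ultimately show False using less.IH by blast
    qed
  qed
  show "inj (of_nat :: nat \<Rightarrow> 'a witt)"
  proof (rule linorder_injI)
    fix a b :: nat assume "a < b"
    then have "of_nat (b - a) \<noteq> (0 :: 'a witt)" by (intro nz) simp
    then show "of_nat a \<noteq> (of_nat b :: 'a witt)" using \<open>a < b\<close> by (simp add: of_nat_diff)
  qed
qed


section \<open>Inverting \<open>p\<close>\<close>

definition nat_mult :: "nat \<Rightarrow> 'm::ab_group_add \<Rightarrow> 'm" where
  "nat_mult n x = (\<Sum>i<n. x)"

lemma nat_mult_simps [simp]: "nat_mult 0 x = 0" "nat_mult (Suc n) x = nat_mult n x + x"
  by (simp_all add: nat_mult_def)

lemma nat_mult_1 [simp]: "nat_mult 1 x = x"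
  by (simp add: nat_mult_def)

lemma nat_mult_zero [simp]: "nat_mult n 0 = 0"
  by (simp add: nat_mult_def)

lemma nat_mult_add: "nat_mult n (x + y) = nat_mult n x + nat_mult n y"
  by (simp add: nat_mult_def sum.distrib)

lemma nat_mult_minus: "nat_mult n (- x) = - nat_mult n x"
  by (simp add: nat_mult_def sum_negf)

lemma nat_mult_add_left: "nat_mult (m + n) x = nat_mult m x + nat_mult n x"
  by (induction n) (auto simp: add.assoc)

lemma nat_mult_nat_mult: "nat_mult m (nat_mult n x) = nat_mult (m * n) x"
  by (induction n) (auto simp: nat_mult_add nat_mult_add_left add.commute)

lemma nat_mult_of_nat: "nat_mult n (x :: 'a::comm_ring_1) = of_nat n * x"
  by (simp add: nat_mult_def)

lemma nat_mult_additive: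
  assumes "\<And>x y. f (x + y) = f x + f y"
  shows "f (nat_mult n x) = nat_mult n (f x)"
proof (induction n)
  case 0
  show ?case using assms[of 0 0] by simp
qed (simp add: assms)

text \<open>
  \<open>('m, 'k) ploc\<close> is \<open>M[1/p]\<close> for an abelian group \<open>'m\<close> and \<open>p = CHAR('k)\<close>: the pair \<open>(x, a)\<close>
  represents \<open>x / p ^ a\<close>. The type \<open>'k\<close> only serves to determine \<open>p\<close>.
\<close>

definition ploc_rel :: "'k::semiring_prime_char itself \<Rightarrow> 'm::ab_group_add \<times> nat \<Rightarrow> 'm \<times> nat \<Rightarrow> bool" where
  "ploc_rel _ = (\<lambda>(x, a) (y, b).
     \<exists>c. nat_mult (CHAR('k) ^ (c + b)) x = nat_mult (CHAR('k) ^ (c + a)) y)"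

lemma ploc_relI:
  "nat_mult (CHAR('k) ^ (c + b)) x = nat_mult (CHAR('k) ^ (c + a)) y \<Longrightarrow>
     ploc_rel TYPE('k::semiring_prime_char) (x, a) (y, b)"
  by (auto simp: ploc_rel_def)

lemma ploc_rel_scaled:
  assumes "nat_mult (CHAR('k) ^ (c + b)) x = nat_mult (CHAR('k) ^ (c + a)) y"
  shows "nat_mult (CHAR('k::semiring_prime_char) ^ (d + c + b)) x = nat_mult (CHAR('k) ^ (d + c + a)) y"
  using arg_cong[OF assms, of "nat_mult (CHAR('k) ^ d)"]
  by (simp add: nat_mult_nat_mult power_add[symmetric] add.assoc)

lemma equivp_ploc_rel: "equivp (ploc_rel TYPE('k::semiring_prime_char))"
proof (rule equivpI)
  show "reflp (ploc_rel TYPE('k))" by (rule reflpI) (auto simp: ploc_rel_def)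
  show "symp (ploc_rel TYPE('k))" by (rule sympI) (auto simp: ploc_rel_def, metis)
  show "transp (ploc_rel TYPE('k))"
  proof (rule transpI)
    fix u v w :: "'b \<times> nat"
    assume uv: "ploc_rel TYPE('k) u v" and vw: "ploc_rel TYPE('k) v w"
    obtain x a y b z e where [simp]: "u = (x, a)" "v = (y, b)" "w = (z, e)"
      by (cases u, cases v, cases w) auto
    from uv obtain c where 1: "nat_mult (CHAR('k) ^ (c + b)) x = nat_mult (CHAR('k) ^ (c + a)) y"
      by (auto simp: ploc_rel_def)
    from vw obtain d where 2: "nat_mult (CHAR('k) ^ (d + e)) y = nat_mult (CHAR('k) ^ (d + b)) z"
      by (auto simp: ploc_rel_def)
    have "nat_mult (CHAR('k) ^ (c + d + b + e)) x = nat_mult (CHAR('k) ^ (c + d + e + a)) y"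
      using ploc_rel_scaled[OF 1, of "d + e"] by (simp add: ac_simps)
    also have "\<dots> = nat_mult (CHAR('k) ^ (c + d + b + a)) z"
      using ploc_rel_scaled[OF 2, of "c + a"] by (simp add: ac_simps)
    finally show "ploc_rel TYPE('k) u w" by (auto simp: ploc_rel_def)
  qed
qed

quotient_type (overloaded) ('m, 'k) ploc =
    "'m::ab_group_add \<times> nat" / "ploc_rel TYPE('k::semiring_prime_char)"
  by (rule equivp_ploc_rel)

lift_definition loc_frac :: "'m::ab_group_add \<Rightarrow> nat \<Rightarrow> ('m, 'k::semiring_prime_char) ploc"
  is "\<lambda>x a. (x, a)" .

lemma loc_frac_eq_iff:
  "(loc_frac x a :: ('m::ab_group_add, 'k::semiring_prime_char) ploc) = loc_frac y b \<longleftrightarrow>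
     (\<exists>c. nat_mult (CHAR('k) ^ (c + b)) x = nat_mult (CHAR('k) ^ (c + a)) y)"
  by transfer (auto simp: ploc_rel_def)

lemma loc_frac_cases: obtains x a where "v = loc_frac x a"
  by transfer (auto simp: ploc_rel_def)

instantiation ploc :: (ab_group_add, semiring_prime_char) ab_group_add
begin

lift_definition zero_ploc :: "('a, 'b) ploc" is "(0, 0)" .

lift_definition plus_ploc :: "('a, 'b) ploc \<Rightarrow> ('a, 'b) ploc \<Rightarrow> ('a, 'b) ploc"
  is "\<lambda>(x, a) (y, b). (nat_mult (CHAR('b) ^ b) x + nat_mult (CHAR('b) ^ a) y, a + b)"
proof -
  fix u u' v v' :: "'a \<times> nat"
  assume uu: "ploc_rel TYPE('b) u u'" and vv: "ploc_rel TYPE('b) v v'"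
  obtain x a x' a' y b y' b' where [simp]: "u = (x, a)" "u' = (x', a')" "v = (y, b)" "v' = (y', b')"
    by (cases u, cases u', cases v, cases v') auto
  from uu obtain c where 1: "nat_mult (CHAR('b) ^ (c + a')) x = nat_mult (CHAR('b) ^ (c + a)) x'"
    by (auto simp: ploc_rel_def)
  from vv obtain d where 2: "nat_mult (CHAR('b) ^ (d + b')) y = nat_mult (CHAR('b) ^ (d + b)) y'"
    by (auto simp: ploc_rel_def)
  have 3: "nat_mult (CHAR('b) ^ (c + d + (a' + b') + b)) x = nat_mult (CHAR('b) ^ (c + d + (a + b) + b')) x'"
    using ploc_rel_scaled[OF 1, of "d + b + b'"] by (simp add: ac_simps)
  have 4: "nat_mult (CHAR('b) ^ (c + d + (a' + b') + a)) y = nat_mult (CHAR('b) ^ (c + d + (a + b) + a')) y'"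
    using ploc_rel_scaled[OF 2, of "c + a + a'"] by (simp add: ac_simps)
  have "ploc_rel TYPE('b) (nat_mult (CHAR('b) ^ b) x + nat_mult (CHAR('b) ^ a) y, a + b)
      (nat_mult (CHAR('b) ^ b') x' + nat_mult (CHAR('b) ^ a') y', a' + b')"
    by (rule ploc_relI[of "c + d"])
       (simp only: nat_mult_add nat_mult_nat_mult power_add[symmetric] 3 4)
  then show "ploc_rel TYPE('b)
     ((\<lambda>(x, a) (y, b). (nat_mult (CHAR('b) ^ b) x + nat_mult (CHAR('b) ^ a) y, a + b)) u v)
     ((\<lambda>(x, a) (y, b). (nat_mult (CHAR('b) ^ b) x + nat_mult (CHAR('b) ^ a) y, a + b)) u' v')"
    by simp
qed

lift_definition uminus_ploc :: "('a, 'b) ploc \<Rightarrow> ('a, 'b) ploc" is "\<lambda>(x, a). (- x, a)"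
  by (auto simp: ploc_rel_def nat_mult_minus)

definition minus_ploc :: "('a, 'b) ploc \<Rightarrow> ('a, 'b) ploc \<Rightarrow> ('a, 'b) ploc" where
  "minus_ploc u v = u + - v"

instance
proof
  fix u v w :: "('a, 'b) ploc"
  show "u + v + w = u + (v + w)"
  proof transfer
    fix u v w :: "'a \<times> nat"
    show "ploc_rel TYPE('b)
      ((\<lambda>(x, a) (y, b). (nat_mult (CHAR('b) ^ b) x + nat_mult (CHAR('b) ^ a) y, a + b))
        ((\<lambda>(x, a) (y, b). (nat_mult (CHAR('b) ^ b) x + nat_mult (CHAR('b) ^ a) y, a + b)) u v) w)
      ((\<lambda>(x, a) (y, b). (nat_mult (CHAR('b) ^ b) x + nat_mult (CHAR('b) ^ a) y, a + b)) u
        ((\<lambda>(x, a) (y, b). (nat_mult (CHAR('b) ^ b) x + nat_mult (CHAR('b) ^ a) y, a + b)) v w))"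
      by (cases u, cases v, cases w)
         (auto intro!: ploc_relI[of 0] simp: nat_mult_add nat_mult_nat_mult power_add[symmetric] ac_simps)
  qed
  show "u + v = v + u"
    by transfer (auto intro!: ploc_relI[of 0] simp: nat_mult_add nat_mult_nat_mult power_add[symmetric] ac_simps)
  show "0 + u = u"
    by transfer (auto intro!: ploc_relI[of 0])
  show "- u + u = 0"
    by transfer (auto intro!: ploc_relI[of 0] simp: nat_mult_minus)
  show "u - v = u + - v" by (rule minus_ploc_def)
qed

end

lemma loc_frac_add:
  "(loc_frac x a :: ('m::ab_group_add, 'k::semiring_prime_char) ploc) + loc_frac y b =
     loc_frac (nat_mult (CHAR('k) ^ b) x + nat_mult (CHAR('k) ^ a) y) (a + b)"
  by transfer (auto simp: ploc_rel_def)

instantiation ploc :: ("{comm_ring_1, ring_char_0}", semiring_prime_char) comm_ring_1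
begin

lift_definition one_ploc :: "('a, 'b) ploc" is "(1, 0)" .

lift_definition times_ploc :: "('a, 'b) ploc \<Rightarrow> ('a, 'b) ploc \<Rightarrow> ('a, 'b) ploc"
  is "\<lambda>(x, a) (y, b). (x * y, a + b)"
proof -
  fix u u' v v' :: "'a \<times> nat"
  assume uu: "ploc_rel TYPE('b) u u'" and vv: "ploc_rel TYPE('b) v v'"
  obtain x a x' a' y b y' b' where [simp]: "u = (x, a)" "u' = (x', a')" "v = (y, b)" "v' = (y', b')"
    by (cases u, cases u', cases v, cases v') auto
  from uu obtain c where 1: "of_nat (CHAR('b) ^ (c + a')) * x = of_nat (CHAR('b) ^ (c + a)) * x'"
    by (auto simp: ploc_rel_def nat_mult_of_nat)
  from vv obtain d where 2: "of_nat (CHAR('b) ^ (d + b')) * y = of_nat (CHAR('b) ^ (d + b)) * y'"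
    by (auto simp: ploc_rel_def nat_mult_of_nat)
  have "(of_nat (CHAR('b) ^ (c + a')) * x) * (of_nat (CHAR('b) ^ (d + b')) * y) =
        (of_nat (CHAR('b) ^ (c + a)) * x') * (of_nat (CHAR('b) ^ (d + b)) * y')"
    by (simp only: 1 2)
  then have "nat_mult (CHAR('b) ^ ((c + d) + (a' + b'))) (x * y) = nat_mult (CHAR('b) ^ ((c + d) + (a + b))) (x' * y')"
    by (simp add: nat_mult_of_nat power_add mult_ac)
  then have "ploc_rel TYPE('b) (x * y, a + b) (x' * y', a' + b')"
    by (rule ploc_relI)
  then show "ploc_rel TYPE('b) ((\<lambda>(x, a) (y, b). (x * y, a + b)) u v)
      ((\<lambda>(x, a) (y, b). (x * y, a + b)) u' v')"
    by simp
qed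

instance
proof
  fix u v w :: "('a, 'b) ploc"
  show "u * v * w = u * (v * w)"
    by transfer (auto intro!: ploc_relI[of 0] simp: ac_simps)
  show "u * v = v * u"
    by transfer (auto intro!: ploc_relI[of 0] simp: ac_simps)
  show "1 * u = u"
    by transfer (auto intro!: ploc_relI[of 0])
  show "(u + v) * w = u * w + v * w"
    by transfer (auto intro!: ploc_relI[of 0] simp: nat_mult_of_nat power_add algebra_simps)
  show "(0 :: ('a, 'b) ploc) \<noteq> 1"
    by transfer (auto simp: ploc_rel_def nat_mult_of_nat simp flip: of_nat_power)
qed

end

lemma loc_frac_mult: "loc_frac x a * loc_frac y b = loc_frac (x * y) (a + b)"
  by transfer (auto simp: ploc_rel_def)

text \<open>The ring \<open>B(k) = W(k)[1/p]\<close>.\<close>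

type_synonym 'k witt_rat = "('k witt, 'k) ploc"

text \<open>
  The action of \<open>B(k)\<close> on \<open>M[1/p]\<close> induced by an action of \<open>W(k)\<close> on \<open>M\<close>, and the extension
  of an additive map to the localizations.
\<close>

definition loc_scale ::
  "('k::idom_prime_char witt \<Rightarrow> 'm::ab_group_add \<Rightarrow> 'm) \<Rightarrow> 'k witt_rat \<Rightarrow> ('m, 'k) ploc \<Rightarrow> ('m, 'k) ploc"
where
  "loc_scale scale b v = (THE u. \<forall>w a x c. b = loc_frac w a \<longrightarrow> v = loc_frac x c \<longrightarrow>
     u = loc_frac (scale w x) (a + c))"

definition loc_map ::
  "('m::ab_group_add \<Rightarrow> 'n::ab_group_add) \<Rightarrow> ('m, 'k::semiring_prime_char) ploc \<Rightarrow> ('n, 'k) ploc"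
where
  "loc_map f v = (THE u. \<forall>x a. v = loc_frac x a \<longrightarrow> u = loc_frac (f x) a)"

lemma loc_map_frac:
  fixes f :: "'m::ab_group_add \<Rightarrow> 'n::ab_group_add"
  assumes "\<And>x y. f (x + y) = f x + f y"
  shows "loc_map f (loc_frac x a :: ('m, 'k::semiring_prime_char) ploc) = loc_frac (f x) a"
  unfolding loc_map_def
proof (rule the_equality)
  show "\<forall>y b. (loc_frac x a :: ('m, 'k) ploc) = loc_frac y b \<longrightarrow>
          (loc_frac (f x) a :: ('n, 'k) ploc) = loc_frac (f y) b"
    unfolding loc_frac_eq_iff nat_mult_additive[of f, OF assms, symmetric] by metis
qed auto

context module
begin

lemma nat_mult_eq_scale: "nat_mult n x = of_nat n *s x"
  by (induction n) (auto simp: scale_left_distrib add.commute)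

end

lemma loc_scale_frac:
  fixes scale :: "'k::idom_prime_char witt \<Rightarrow> 'm::ab_group_add \<Rightarrow> 'm"
  assumes "module scale"
  shows "loc_scale scale (loc_frac w a) (loc_frac x c) = loc_frac (scale w x) (a + c)"
proof -
  interpret module scale by fact
  have eq: "(loc_frac (scale w x) (a + c) :: ('m, 'k) ploc) = loc_frac (scale w' x') (a' + c')"
    if w: "(loc_frac w a :: 'k witt_rat) = loc_frac w' a'"
      and x: "(loc_frac x c :: ('m, 'k) ploc) = loc_frac x' c'" for w' a' x' c'
  proof -
    let ?p = "CHAR('k)"
    from w obtain d where d: "of_nat (?p ^ (d + a')) * w = of_nat (?p ^ (d + a)) * w'"
      unfolding loc_frac_eq_iff nat_mult_of_nat by blast
    from x obtain e where e: "scale (of_nat (?p ^ (e + c'))) x = scale (of_nat (?p ^ (e + c))) x'"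
      unfolding loc_frac_eq_iff nat_mult_eq_scale by blast
    have "scale (of_nat (?p ^ ((d + e) + (a' + c')))) (scale w x) =
        scale (of_nat (?p ^ (d + a')) * w) (scale (of_nat (?p ^ (e + c'))) x)"
      by (simp add: power_add mult_ac)
    also have "\<dots> = scale (of_nat (?p ^ (d + a)) * w') (scale (of_nat (?p ^ (e + c))) x')"
      by (simp only: d e)
    also have "\<dots> = scale (of_nat (?p ^ ((d + e) + (a + c)))) (scale w' x')"
      by (simp add: power_add mult_ac)
    finally show ?thesis
      unfolding loc_frac_eq_iff nat_mult_eq_scale by blast
  qed
  show ?thesis
    unfolding loc_scale_def by (rule the_equality) (use eq in blast)+
qed

lemma module_loc_scale:
  fixes scale :: "'k::idom_prime_char witt \<Rightarrow> 'm::ab_group_add \<Rightarrow> 'm"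
  assumes "module scale"
  shows "module (loc_scale scale)"
proof
  interpret module scale by fact
  note simps = loc_scale_frac[OF assms] loc_frac_add loc_frac_mult loc_frac_eq_iff
    nat_mult_eq_scale nat_mult_of_nat
  fix b c :: "'k witt_rat" and u v :: "('m, 'k) ploc"
  show "loc_scale scale b (u + v) = loc_scale scale b u + loc_scale scale b v"
    by (cases b rule: loc_frac_cases, cases u rule: loc_frac_cases, cases v rule: loc_frac_cases)
       (auto simp: simps power_add algebra_simps)
  show "loc_scale scale (b + c) u = loc_scale scale b u + loc_scale scale c u"
    by (cases b rule: loc_frac_cases, cases u rule: loc_frac_cases, cases c rule: loc_frac_cases)
       (auto simp: simps power_add algebra_simps)
  show "loc_scale scale b (loc_scale scale c u) = loc_scale scale (b * c) u"
    by (cases b rule: loc_frac_cases, cases u rule: loc_frac_cases, cases c rule: loc_frac_cases)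
       (auto simp: simps add.assoc)
  have one: "(1 :: 'k witt_rat) = loc_frac 1 0" by transfer (auto simp: ploc_rel_def)
  show "loc_scale scale 1 u = u"
  proof (cases u rule: loc_frac_cases)
    case (1 x a)
    have "loc_scale scale (loc_frac 1 0) (loc_frac x a) = loc_frac (scale 1 x) (0 + a)"
      by (rule loc_scale_frac[OF assms])
    then show ?thesis by (simp only: 1 one scale_one add_0)
  qed
qed


section \<open>\<open>F\<close>-crystals and \<open>F\<close>-isocrystals\<close>

definition is_basis :: "('a::comm_ring_1 \<Rightarrow> 'm::ab_group_add \<Rightarrow> 'm) \<Rightarrow> 'i set \<Rightarrow> ('i \<Rightarrow> 'm) \<Rightarrow> bool" where
  "is_basis scale I u \<longleftrightarrow> finite I \<and> inj_on u I \<and>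
     \<not> module.dependent scale (u ` I) \<and> module.span scale (u ` I) = UNIV"

locale f_crystal = module scale
  for scale :: "'k::{alg_closed_field, field_prime_char} witt \<Rightarrow> 'm::ab_group_add \<Rightarrow> 'm" +
  fixes \<phi> :: "'m \<Rightarrow> 'm"
  assumes free: "\<exists>B. finite B \<and> independent B \<and> span B = UNIV"
    and add: "\<phi> (x + y) = \<phi> x + \<phi> y"
    and semilinear: "\<phi> (scale a x) = scale (witt_frob a) (\<phi> x)"
    and inj: "inj \<phi>"

text \<open>
  \<open>hodge_slopes scale \<phi> E\<close>: the Hodge slopes of the crystal, listed with multiplicity, are \<open>E\<close>.
\<close>

definition hodge_slopes ::
  "('k::comm_ring_prime_char witt \<Rightarrow> 'm::ab_group_add \<Rightarrow> 'm) \<Rightarrow> ('m \<Rightarrow> 'm) \<Rightarrow> nat multiset \<Rightarrow> bool"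
where
  "hodge_slopes scale \<phi> E \<longleftrightarrow> (\<exists>(r::nat) e u w.
     is_basis scale {..<r} u \<and> is_basis scale {..<r} w \<and>
     (\<forall>i<r. \<phi> (u i) = scale (of_nat CHAR('k) ^ e i) (w i)) \<and>
     E = image_mset e (mset_set {..<r}))"

definition isocrystal_simple ::
  "('k::idom_prime_char witt_rat \<Rightarrow> 'v::ab_group_add \<Rightarrow> 'v) \<Rightarrow> ('v \<Rightarrow> 'v) \<Rightarrow> bool"
where
  "isocrystal_simple scale \<phi> \<longleftrightarrow> (UNIV :: 'v set) \<noteq> {0} \<and>
     (\<forall>U. module.subspace scale U \<longrightarrow> \<phi> ` U \<subseteq> U \<longrightarrow> U = {0} \<or> U = UNIV)"

definition p_power :: "int \<Rightarrow> 'k::idom_prime_char witt_rat" where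
  "p_power s = loc_frac (of_nat CHAR('k) ^ nat s) (nat (- s))"

text \<open>
  Newton slopes via the Dieudonne-Manin classification: over an algebraically closed field every
  isocrystal is isomorphic to a direct sum of isocrystals \<open>B(k)[F]/(F ^ r - p ^ s)\<close> with
  \<open>r > 0\<close> and \<open>s\<close> coprime, and such a summand contributes the slope \<open>s / r\<close> with multiplicity \<open>r\<close>.
  Below, \<open>u (j, 0), \<dots>, u (j, r j - 1)\<close> is the image of the basis \<open>1, F, \<dots>, F ^ (r j - 1)\<close>
  of the \<open>j\<close>-th summand.
\<close>

definition isocrystal_newton_slopes ::
  "('k::idom_prime_char witt_rat \<Rightarrow> 'v::ab_group_add \<Rightarrow> 'v) \<Rightarrow> ('v \<Rightarrow> 'v) \<Rightarrow> rat multiset \<Rightarrow> bool"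
where
  "isocrystal_newton_slopes scale \<phi> N \<longleftrightarrow> (\<exists>(m::nat) (s :: nat \<Rightarrow> int) (r :: nat \<Rightarrow> nat) u.
     (\<forall>j<m. r j > 0 \<and> coprime (s j) (int (r j))) \<and>
     is_basis scale (SIGMA j:{..<m}. {..<r j}) u \<and>
     (\<forall>j<m. \<forall>i<r j. \<phi> (u (j, i)) =
        (if Suc i < r j then u (j, Suc i) else scale (p_power (s j)) (u (j, 0)))) \<and>
     N = (\<Sum>j<m. replicate_mset (r j) (of_int (s j) / of_nat (r j))))"

definition isosimple ::
  "('k::idom_prime_char witt \<Rightarrow> 'm::ab_group_add \<Rightarrow> 'm) \<Rightarrow> ('m \<Rightarrow> 'm) \<Rightarrow> bool"
where
  "isosimple scale \<phi> \<longleftrightarrow> isocrystal_simple (loc_scale scale) (loc_map \<phi>)"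

definition newton_slopes ::
  "('k::idom_prime_char witt \<Rightarrow> 'm::ab_group_add \<Rightarrow> 'm) \<Rightarrow> ('m \<Rightarrow> 'm) \<Rightarrow> rat multiset \<Rightarrow> bool"
where
  "newton_slopes scale \<phi> N \<longleftrightarrow> isocrystal_newton_slopes (loc_scale scale) (loc_map \<phi>) N"

definition linear_automorphism ::
  "('a::comm_ring_1 \<Rightarrow> 'm::ab_group_add \<Rightarrow> 'm) \<Rightarrow> ('m \<Rightarrow> 'm) \<Rightarrow> bool"
where
  "linear_automorphism scale g \<longleftrightarrow> module_hom scale scale g \<and> bij g"

definition crystals_isomorphic ::
  "('a::comm_ring_1 \<Rightarrow> 'm::ab_group_add \<Rightarrow> 'm) \<Rightarrow> ('m \<Rightarrow> 'm) \<Rightarrow> ('m \<Rightarrow> 'm) \<Rightarrow> bool"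
where
  "crystals_isomorphic scale \<phi> \<psi> \<longleftrightarrow> (\<exists>h. linear_automorphism scale h \<and> h \<circ> \<phi> = \<psi> \<circ> h)"

definition isomorphism_number ::
  "('k::comm_ring_prime_char witt \<Rightarrow> 'm::ab_group_add \<Rightarrow> 'm) \<Rightarrow> ('m \<Rightarrow> 'm) \<Rightarrow> nat"
where
  "isomorphism_number scale \<phi> = (LEAST n. \<forall>g. linear_automorphism scale g \<longrightarrow>
     (\<forall>x. \<exists>y. g x - x = scale (of_nat CHAR('k) ^ n) y) \<longrightarrow>
     crystals_isomorphic scale (g \<circ> \<phi>) \<phi>)"

end

theory Submission
  imports Defs
begin

text \<open>
  Let \<open>V = M[1/p]\<close>. It has vectors \<open>e n\<close>, \<open>n\<close> an integer, with \<open>e (n + r) = p e n\<close> and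
  \<open>\<phi> (e n) = e (n + s)\<close>, and any \<open>r\<close> consecutive ones span a lattice \<open>H n\<close>. The lattices \<open>H n\<close> form a
  descending chain with one-dimensional quotients, so each nonzero vector has an order.

  Choose \<open>a\<close> maximal with \<open>M \<subseteq> H a\<close>. The set of orders of elements of \<open>M\<close> contains \<open>a\<close> and is stable
  under adding \<open>r\<close>, \<open>s\<close> (apply \<open>\<phi>\<close>) and \<open>d r - s\<close> (apply \<open>p ^ d \<phi> ^ (-1)\<close>, where \<open>d\<close> is the maximal Hodge
  slope). Hence it contains every integer from \<open>a + r j\<close> on, where \<open>j\<close> is the maximum in the theorem,
  and \<open>H (a + r j) \<subseteq> M \<subseteq> H a\<close>.

  If \<open>g\<close> is congruent to the identity modulo \<open>p ^ (2 j + 1)\<close>, then \<open>g - 1\<close> maps \<open>H n\<close> to \<open>H (n + D)\<close> for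
  all \<open>n\<close>, where \<open>D = r j + 1\<close>. Thus \<open>\<psi> = g \<phi>\<close> has a vector \<open>v\<close> close to some \<open>e n\<close> with
  \<open>\<psi> ^ r v = p ^ s v\<close>, obtained by solving Artin-Schreier equations digit by digit. The linear map \<open>h\<close>
  which sends \<open>p ^ l \<phi> ^ i (e n)\<close> to \<open>p ^ l \<psi> ^ i v\<close> conjugates \<open>\<phi>\<close> into \<open>\<psi>\<close>. As \<open>h - 1\<close> maps \<open>H a\<close> into
  \<open>H (a + D) \<subseteq> M\<close>, it restricts to an automorphism of \<open>M\<close>.
\<close>

section \<open>Witt vectors over a perfect field\<close>

lemma witt_eqI: "(\<And>n. witt_nth x n = witt_nth y n) \<Longrightarrow> x = y"
  by (metis ext witt_nth_inject)

text \<open>Over an integer polynomial ring the first \<open>n + 1\<close> Witt polynomials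
  determine the first \<open>n + 1\<close> components, so the claim can be checked on them;
  evaluating the variables transfers it to any ring.\<close>

lemma wadd_cong:
  fixes x y x' y' :: "nat \<Rightarrow> 'a::comm_ring_1"
  assumes p: "prime p" and "\<And>i. i \<le> n \<Longrightarrow> x i = x' i" and "\<And>i. i \<le> n \<Longrightarrow> y i = y' i"
  shows "wadd p x y n = wadd p x' y' n"
proof -
  have "wadd p (mvar \<circ> x) (mvar \<circ> y) n = wadd p (mvar \<circ> x') (mvar \<circ> y') n"
  proof (rule witt_poly_inj[OF p _ order_refl])
    fix i assume i: "i \<le> n"
    have "witt_poly p i (mvar \<circ> x) = witt_poly p i (mvar \<circ> x')"
      "witt_poly p i (mvar \<circ> y) = witt_poly p i (mvar \<circ> y')"
      by (rule witt_poly_cong; use i assms in simp)+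
    then show "witt_poly p i (wadd p (mvar \<circ> x) (mvar \<circ> y)) =
        witt_poly p i (wadd p (mvar \<circ> x') (mvar \<circ> y'))"
      by (simp only: witt_poly_wadd[OF p])
  qed
  then have "mpoly_eval (\<lambda>a. a) (wadd p (mvar \<circ> x) (mvar \<circ> y) n) =
      mpoly_eval (\<lambda>a. a) (wadd p (mvar \<circ> x') (mvar \<circ> y') n)" by (simp only:)
  then show ?thesis by (simp add: wadd_hom)
qed

lemma witt_nth_add_cong:
  fixes x y x' y' :: "'k::comm_ring_prime_char witt"
  assumes "\<And>i. i \<le> n \<Longrightarrow> witt_nth x i = witt_nth x' i" "\<And>i. i \<le> n \<Longrightarrow> witt_nth y i = witt_nth y' i"
  shows "witt_nth (x + y) n = witt_nth (x' + y') n"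
  unfolding plus_witt.rep_eq by (rule wadd_cong) (use assms in auto)

lemma witt_nth_0 [simp]: "witt_nth 0 n = (0 :: 'k::comm_ring_prime_char)"
  by (simp add: zero_witt.rep_eq)

lemma witt_nth_add_0 [simp]:
  "witt_nth (x + y) 0 = witt_nth x 0 + witt_nth (y :: 'k::comm_ring_prime_char witt) 0"
  by (simp add: plus_witt.rep_eq wadd_nth_0)

lemma witt_nth_mult_0 [simp]:
  "witt_nth (x * y) 0 = witt_nth x 0 * witt_nth (y :: 'k::comm_ring_prime_char witt) 0"
  using witt_poly_wmult[of "CHAR('k)" 0 "witt_nth x" "witt_nth y"]
  by (simp add: witt_poly_def times_witt.rep_eq)

lemma witt_nth_uminus_0 [simp]:
  "witt_nth (- x) 0 = - witt_nth (x :: 'k::comm_ring_prime_char witt) 0"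
  using witt_nth_add_0[of x "- x"] by (simp add: eq_neg_iff_add_eq_0 add.commute del: witt_nth_add_0)

lemma witt_nth_diff_0 [simp]:
  "witt_nth (x - y) 0 = witt_nth x 0 - witt_nth (y :: 'k::comm_ring_prime_char witt) 0"
  using witt_nth_add_0[of x "- y"] by simp

lemma witt_nth_diff_eq_0:
  fixes x y :: "'k::comm_ring_prime_char witt"
  assumes "\<And>i. i \<le> n \<Longrightarrow> witt_nth x i = witt_nth y i"
  shows "witt_nth (x - y) n = 0"
  using witt_nth_add_cong[of n x y "- y" "- y"] assms by simp

text \<open>In characteristic p the p-th power map is a ring endomorphism, hence commutes with every
  integer polynomial. Applied to the universal Witt polynomials this makes \<open>witt_frob\<close>
  a ring homomorphism.\<close>

lemma mpoly_eval_power_CHAR: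
  fixes f :: "'v \<Rightarrow> 'a::comm_ring_prime_char"
  shows "mpoly_eval (\<lambda>v. f v ^ CHAR('a)) P = mpoly_eval f P ^ CHAR('a)"
proof (rule frag_induction[of P UNIV])
  fix m
  show "mpoly_eval (\<lambda>v. f v ^ CHAR('a)) (frag_of m) = mpoly_eval f (frag_of m) ^ CHAR('a)"
    by (simp add: mpoly_eval_single monom_eval_def prod_power_distrib mult.commute flip: power_mult)
next
  fix P Q :: "'v int_mpoly"
  assume "mpoly_eval (\<lambda>v. f v ^ CHAR('a)) P = mpoly_eval f P ^ CHAR('a)"
    "mpoly_eval (\<lambda>v. f v ^ CHAR('a)) Q = mpoly_eval f Q ^ CHAR('a)"
  moreover have "(x - y) ^ CHAR('a) = x ^ CHAR('a) - y ^ CHAR('a)" for x y :: 'a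
    using freshmans_dream[OF CHAR_prime refl, of "x - y" y] by (simp add: algebra_simps)
  ultimately show "mpoly_eval (\<lambda>v. f v ^ CHAR('a)) (P - Q) = mpoly_eval f (P - Q) ^ CHAR('a)"
    by simp
qed (auto simp: power_0_left)

lemma witt_frob_add:
  "witt_frob (x + y) = witt_frob x + witt_frob (y :: 'k::comm_ring_prime_char witt)"
proof (rule witt_eqI)
  fix n
  have "case_sum (\<lambda>n. witt_nth x n ^ CHAR('k)) (\<lambda>n. witt_nth y n ^ CHAR('k)) =
      (\<lambda>v. case_sum (witt_nth x) (witt_nth y) v ^ CHAR('k))"
    by (auto split: sum.splits)
  then show "witt_nth (witt_frob (x + y)) n = witt_nth (witt_frob x + witt_frob y) n"
    by (simp add: witt_frob.rep_eq plus_witt.rep_eq wadd_def mpoly_eval_power_CHAR)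
qed

lemma witt_frob_mult:
  "witt_frob (x * y) = witt_frob x * witt_frob (y :: 'k::comm_ring_prime_char witt)"
proof (rule witt_eqI)
  fix n
  have "case_sum (\<lambda>n. witt_nth x n ^ CHAR('k)) (\<lambda>n. witt_nth y n ^ CHAR('k)) =
      (\<lambda>v. case_sum (witt_nth x) (witt_nth y) v ^ CHAR('k))"
    by (auto split: sum.splits)
  then show "witt_nth (witt_frob (x * y)) n = witt_nth (witt_frob x * witt_frob y) n"
    by (simp add: witt_frob.rep_eq times_witt.rep_eq wmult_def mpoly_eval_power_CHAR)
qed

lemma witt_frob_1 [simp]: "witt_frob 1 = (1 :: 'k::comm_ring_prime_char witt)"
  by (rule witt_eqI) (simp add: witt_frob.rep_eq one_witt.rep_eq wone_def power_0_left)

lemma witt_frob_0 [simp]: "witt_frob 0 = (0 :: 'k::comm_ring_prime_char witt)"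
  by (rule witt_eqI) (simp add: witt_frob.rep_eq power_0_left)

lemma witt_frob_of_nat [simp]: "witt_frob (of_nat n) = (of_nat n :: 'k::comm_ring_prime_char witt)"
  by (induction n) (auto simp: witt_frob_add)

lemma witt_frob_power: "witt_frob (x ^ n) = witt_frob (x :: 'k::comm_ring_prime_char witt) ^ n"
  by (induction n) (auto simp: witt_frob_mult)

lemma witt_nth_frob_0 [simp]:
  "witt_nth (witt_frob x) 0 = witt_nth (x :: 'k::comm_ring_prime_char witt) 0 ^ CHAR('k)"
  by (simp add: witt_frob.rep_eq)

section \<open>Roots in the residue field, divisibility by p and p-adic completeness of W(k)\<close>

lemma alg_closed_root:
  assumes "n > 0"
  shows "\<exists>x. x ^ n = (a :: 'k::alg_closed_field)"
proof -
  have "degree (monom 1 n + [:- a:]) = n"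
    using assms by (subst degree_add_eq_left) (auto simp: degree_monom_eq)
  then obtain x where "poly (monom 1 n + [:- a:]) x = 0"
    using alg_closed_imp_poly_has_root assms by metis
  then show ?thesis by (auto simp: poly_monom)
qed

text \<open>Used with \<open>n = p ^ r\<close> to determine the digits of a slope vector. Unlike the
  p-th roots above, this asks for more than a perfect field.\<close>

lemma artin_schreier_root:
  assumes "n > 1"
  shows "\<exists>x. x ^ n - x = (a :: 'k::alg_closed_field)"
proof -
  have "degree (monom 1 n + [:- a, - 1:]) = n"
    using assms by (subst degree_add_eq_left) (auto simp: degree_monom_eq)
  then obtain x where "poly (monom 1 n + [:- a, - 1:]) x = 0"
    using alg_closed_imp_poly_has_root assms by (metis gr_implies_not0 neq0_conv)
  then show ?thesis by (intro exI[of _ x]) (simp add: poly_monom algebra_simps)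
qed

lemma surj_witt_frob: "surj (witt_frob :: 'k::{alg_closed_field, field_prime_char} witt \<Rightarrow> _)"
proof (rule surjI)
  fix x :: "'k witt"
  show "witt_frob (Witt (\<lambda>n. SOME z. z ^ CHAR('k) = witt_nth x n)) = x"
    by (rule witt_eqI)
       (simp add: witt_frob.rep_eq Witt_inverse someI_ex[OF alg_closed_root])
qed

text \<open>Multiplication by p shifts the components by one place and raises them to the p-th
  power. It is undone by shifting back and taking p-th roots.\<close>

lemma CHAR_dvd_witt_iff:
  fixes x :: "'k::{alg_closed_field, field_prime_char} witt"
  shows "of_nat CHAR('k) dvd x \<longleftrightarrow> witt_nth x 0 = 0"
proof
  assume "witt_nth x 0 = 0"
  have "x = of_nat CHAR('k) * Witt (\<lambda>n. SOME z. z ^ CHAR('k) = witt_nth x (Suc n))"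
    by (rule witt_eqI)
       (auto simp: witt_nth_CHAR_mult Witt_inverse someI_ex[OF alg_closed_root] \<open>witt_nth x 0 = 0\<close>
             split: nat.split)
  then show "of_nat CHAR('k) dvd x" by (rule dvdI)
qed (auto simp: dvd_def witt_nth_of_nat_0)

lemma CHAR_power_dvd_witt_iff:
  fixes x :: "'k::{alg_closed_field, field_prime_char} witt"
  shows "of_nat CHAR('k) ^ n dvd x \<longleftrightarrow> (\<forall>i<n. witt_nth x i = 0)"
proof (induction n arbitrary: x)
  case (Suc n)
  have "of_nat CHAR('k) ^ Suc n dvd x \<longleftrightarrow> (\<exists>y. x = of_nat CHAR('k) * y \<and> of_nat CHAR('k) ^ n dvd y)"
    by (auto simp: dvd_def mult.assoc)
  also have "\<dots> \<longleftrightarrow> (\<exists>y. x = of_nat CHAR('k) * y \<and> (\<forall>i<n. witt_nth y i = 0))"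
    by (simp only: Suc.IH)
  also have "\<dots> \<longleftrightarrow> of_nat CHAR('k) dvd x \<and> (\<forall>i<n. witt_nth x (Suc i) = 0)"
    by (auto simp: dvd_def witt_nth_CHAR_mult)
  also have "\<dots> \<longleftrightarrow> (\<forall>i<Suc n. witt_nth x i = 0)"
    by (simp add: CHAR_dvd_witt_iff All_less_Suc2)
  finally show ?case .
qed simp

lemma witt_eq_0_if_CHAR_power_dvd:
  fixes x :: "'k::{alg_closed_field, field_prime_char} witt"
  assumes "\<And>n. of_nat CHAR('k) ^ n dvd x"
  shows "x = 0"
  by (rule witt_eqI) (use assms CHAR_power_dvd_witt_iff in \<open>auto intro: lessI\<close>)

text \<open>Adding \<open>p ^ n * a n\<close> leaves the components below \<open>n\<close>
  unchanged. The \<open>i\<close>-th component of the partial sums is therefore constant from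
  \<open>S (Suc i)\<close> on, and these stable values form the limit.\<close>

lemma witt_complete:
  fixes a :: "nat \<Rightarrow> 'k::{alg_closed_field, field_prime_char} witt"
  shows "\<exists>x. \<forall>n. of_nat CHAR('k) ^ n dvd x - (\<Sum>l<n. of_nat CHAR('k) ^ l * a l)"
proof -
  let ?p = "of_nat CHAR('k) :: 'k witt"
  define S where "S = (\<lambda>n. \<Sum>l<n. ?p ^ l * a l)"
  have stable: "witt_nth (S (Suc n)) i = witt_nth (S n) i" if "i < n" for i n
  proof -
    have "witt_nth (?p ^ n * a n) j = 0" if "j < n" for j
      using CHAR_power_dvd_witt_iff[of n "?p ^ n * a n"] that by simp
    then have "witt_nth (S n + ?p ^ n * a n) i = witt_nth (S n + 0) i"
      using that by (intro witt_nth_add_cong) auto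
    then show ?thesis by (simp add: S_def)
  qed
  define x where "x = Witt (\<lambda>i. witt_nth (S (Suc i)) i)"
  have x: "witt_nth (S n) i = witt_nth x i" if "i < n" for i n
    using that
  proof (induction n)
    case (Suc n)
    then show ?case by (cases "i = n") (auto simp: x_def Witt_inverse stable)
  qed simp
  have "?p ^ n dvd x - S n" for n
    unfolding CHAR_power_dvd_witt_iff using x by (auto intro!: witt_nth_diff_eq_0)
  then show ?thesis unfolding S_def by blast
qed

lemma CHAR_mult_witt_cancel:
  fixes x y :: "'k::idom_prime_char witt"
  assumes "of_nat CHAR('k) ^ n * x = of_nat CHAR('k) ^ n * y"
  shows "x = y"
  using assms
proof (induction n)
  case (Suc n)
  have "of_nat CHAR('k) * (of_nat CHAR('k) ^ n * x - of_nat CHAR('k) ^ n * y) = 0"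
    using Suc.prems by (simp add: algebra_simps)
  then have "of_nat CHAR('k) ^ n * x - of_nat CHAR('k) ^ n * y = 0"
    by (rule CHAR_mult_witt_eq_0)
  then show ?case using Suc.IH by simp
qed simp

lemma ex_witt_nth_0: "\<exists>x. witt_nth x 0 = c"
  by (rule exI[of _ "Witt (\<lambda>_. c)"]) (simp add: Witt_inverse)

section \<open>The standard filtration of an isoclinic space\<close>

text \<open>Only the action of W(k) is recorded. Division by p is encoded in the integer index, as
  \<open>e (n - r)\<close> plays the role of \<open>e n / p\<close>; this is why
  \<open>e_spans\<close> can hold with coefficients in W(k).\<close>

locale lattice_chain = module sc
  for sc :: "'k::{alg_closed_field, field_prime_char} witt \<Rightarrow> 'v::ab_group_add \<Rightarrow> 'v" +
  fixes e :: "int \<Rightarrow> 'v" and r :: nat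
  assumes r_pos: "r > 0"
    and e_shift: "e (n + int r) = sc (of_nat CHAR('k)) (e n)"
    and e_independent: "(\<Sum>b<r. sc (w b) (e (n + int b))) = 0 \<Longrightarrow> b < r \<Longrightarrow> w b = 0"
    and e_spans: "span (range e) = UNIV"
begin

abbreviation \<pi> :: "'k witt" where "\<pi> \<equiv> of_nat CHAR('k)"

definition H :: "int \<Rightarrow> 'v set" where
  "H n = range (\<lambda>w. \<Sum>b<r. sc (w b) (e (n + int b)))"

lemma H_I: "(\<Sum>b<r. sc (w b) (e (n + int b))) \<in> H n"
  unfolding H_def by blast

lemma subspace_H: "subspace (H n)"
  unfolding subspace_def
proof (intro conjI ballI allI)
  show "0 \<in> H n"
    using H_I[of "\<lambda>_. 0"] by simp
next
  fix x y assume "x \<in> H n" "y \<in> H n"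
  then obtain v w where "x = (\<Sum>b<r. sc (v b) (e (n + int b)))" "y = (\<Sum>b<r. sc (w b) (e (n + int b)))"
    by (auto simp: H_def)
  then have "x + y = (\<Sum>b<r. sc (v b + w b) (e (n + int b)))"
    by (simp add: scale_left_distrib sum.distrib)
  then show "x + y \<in> H n" using H_I[of "\<lambda>b. v b + w b"] by simp
next
  fix c x assume "x \<in> H n"
  then obtain w where "x = (\<Sum>b<r. sc (w b) (e (n + int b)))" by (auto simp: H_def)
  then have "sc c x = (\<Sum>b<r. sc (c * w b) (e (n + int b)))"
    by (simp add: scale_sum_right)
  then show "sc c x \<in> H n" using H_I[of "\<lambda>b. c * w b"] by simp
qed

lemmas H_0 [simp] = subspace_0[OF subspace_H]
lemmas H_add = subspace_add[OF subspace_H]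
lemmas H_diff = subspace_diff[OF subspace_H]
lemmas H_neg = subspace_neg[OF subspace_H]
lemmas H_scale = subspace_scale[OF subspace_H]
lemmas H_sum = subspace_sum[OF subspace_H]

lemma H_diff_iff: "y \<in> H n \<Longrightarrow> x - y \<in> H n \<longleftrightarrow> x \<in> H n"
  using H_add[of "x - y" n y] H_diff[of x n y] by auto

lemma H_diff_trans: "x - y \<in> H n \<Longrightarrow> y - z \<in> H n \<Longrightarrow> x - z \<in> H n"
  using H_add[of "x - y" n "y - z"] by simp

lemma shift_power:
  assumes "\<And>n. g (n + int r) = sc \<pi> (g n)"
  shows "g (n + int (r * k)) = sc (\<pi> ^ k) (g n)"
proof (induction k)
  case (Suc k)
  have "g (n + int (r * Suc k)) = sc \<pi> (g (n + int (r * k)))"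
    using assms[of "n + int (r * k)"] by (simp add: algebra_simps)
  then show ?case using Suc by (simp del: of_nat_mult)
qed simp

lemma e_in_H: 
  assumes "n \<le> m" 
  shows "e m \<in> H n"
proof -
  define b where "b = nat (m - n) mod r"
  define k where "k = nat (m - n) div r"
  have "nat (m - n) = b + r * k" by (simp add: b_def k_def)
  then have m: "m = n + int b + int (r * k)" using assms by linarith
  have b: "b < r" using r_pos by (simp add: b_def)
  have "e (n + int b) = (\<Sum>i<r. sc (if i = b then 1 else 0) (e (n + int i)))"
    using b by (simp add: if_distrib[of "\<lambda>a. sc a _"] cong: if_cong)
  then have "e (n + int b) \<in> H n" using H_I[of "\<lambda>i. if i = b then 1 else 0"] by simp
  then show ?thesis
    unfolding m by (subst shift_power[of e]) (auto simp: e_shift H_scale)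
qed

lemma H_antimono: "n \<le> m \<Longrightarrow> H m \<subseteq> H n"
  by (auto simp: H_def[of m] intro!: H_sum H_scale e_in_H)

lemma H_mono: "x \<in> H m \<Longrightarrow> n \<le> m \<Longrightarrow> x \<in> H n"
  using H_antimono by blast

lemma H_exhaustive: "\<exists>n. v \<in> H n"
proof -
  have "v \<in> span (range e)" by (simp add: e_spans)
  then show ?thesis
  proof (induction rule: span_induct_alt)
    case base
    show ?case by simp
  next
    case (step c x y)
    then obtain k n where "x = e k" "y \<in> H n" by blast
    then have "sc c x + y \<in> H (min k n)"
      by (intro H_add H_scale) (auto intro: e_in_H H_mono)
    then show ?case by blast
  qed
qed

text \<open>Together with \<open>scale_e_in_H_iff\<close> this says that
  \<open>H n / H (n + 1)\<close> is a line over k spanned by \<open>e n\<close>, on which a vector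
  has the coordinate \<open>witt_nth a 0\<close>.\<close>

lemma H_leading:
  assumes "v \<in> H n"
  obtains a where "v - sc a (e n) \<in> H (n + 1)"
proof -
  obtain w where v: "v = (\<Sum>b<r. sc (w b) (e (n + int b)))" using assms by (auto simp: H_def)
  have "v = sc (w 0) (e n) + (\<Sum>b\<in>{..<r} - {0}. sc (w b) (e (n + int b)))"
    unfolding v using r_pos by (subst sum.remove[of _ 0]) auto
  moreover have "(\<Sum>b\<in>{..<r} - {0}. sc (w b) (e (n + int b))) \<in> H (n + 1)"
    by (intro H_sum H_scale e_in_H) auto
  ultimately show ?thesis using that[of "w 0"] by simp
qed

text \<open>The basis of \<open>H (n + 1)\<close> differs from that of \<open>H n\<close> only in
  having \<open>e (n + r) = p e n\<close> in place of \<open>e n\<close>. Comparing the coefficients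
  of \<open>e n\<close> gives divisibility by p.\<close>

lemma scale_e_in_H_iff: "sc a (e n) \<in> H (n + 1) \<longleftrightarrow> witt_nth a 0 = 0"
proof
  assume "witt_nth a 0 = 0"
  then obtain c where "a = \<pi> * c" using CHAR_dvd_witt_iff by (metis dvdE)
  then have "sc a (e n) = sc c (e (n + int r))" by (simp add: e_shift mult.commute)
  also have "\<dots> \<in> H (n + 1)" using r_pos by (intro H_scale e_in_H) simp
  finally show "sc a (e n) \<in> H (n + 1)" .
next
  assume "sc a (e n) \<in> H (n + 1)"
  then obtain w where w: "sc a (e n) = (\<Sum>b<r. sc (w b) (e (n + 1 + int b)))"
    by (auto simp: H_def)
  obtain q where r: "r = Suc q" using r_pos by (cases r) auto
  have "e (n + 1 + int q) = sc \<pi> (e n)" using e_shift[of n] by (simp add: r algebra_simps)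
  then have "sc a (e n) = (\<Sum>b<q. sc (w b) (e (n + int (Suc b)))) + sc (w q * \<pi>) (e n)"
    using w by (simp add: r algebra_simps)
  then have "(\<Sum>b<r. sc (case b of 0 \<Rightarrow> a - w q * \<pi> | Suc b \<Rightarrow> - w b) (e (n + int b))) = 0"
    unfolding r sum.lessThan_Suc_shift by (simp add: scale_left_diff_distrib sum_negf)
  from e_independent[OF this r_pos] have "a = w q * \<pi>" by simp
  then have "\<pi> dvd a" by simp
  then show "witt_nth a 0 = 0" by (simp add: CHAR_dvd_witt_iff)
qed

text \<open>Multiplication by \<open>p ^ k\<close> carries the basis of \<open>H n\<close> to that
  of \<open>H (n + r k)\<close>, and it is injective on the whole space because W(k) has no
  p-torsion.\<close>

lemma H_shift_iff: "sc (\<pi> ^ k) v \<in> H (n + int (r * k)) \<longleftrightarrow> v \<in> H n"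
proof -
  have inj: "v = w" if "sc (\<pi> ^ k) v = sc (\<pi> ^ k) w" for v w
  proof -
    obtain m c where c: "v - w = (\<Sum>b<r. sc (c b) (e (m + int b)))"
      using H_exhaustive[of "v - w"] by (auto simp: H_def)
    have "(\<Sum>b<r. sc (\<pi> ^ k * c b) (e (m + int b))) = sc (\<pi> ^ k) (v - w)"
      unfolding c by (simp add: scale_sum_right)
    also have "\<dots> = 0" using that by (simp add: scale_right_diff_distrib)
    finally have "\<pi> ^ k * c b = \<pi> ^ k * 0" if "b < r" for b using e_independent that by simp
    then have "c b = 0" if "b < r" for b using CHAR_mult_witt_cancel that by blast
    then show ?thesis using c by simp
  qed
  have eq: "(\<Sum>b<r. sc (w b) (e (n + int (r * k) + int b))) =
      sc (\<pi> ^ k) (\<Sum>b<r. sc (w b) (e (n + int b)))" for w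
  proof -
    have "e (n + int (r * k) + int b) = sc (\<pi> ^ k) (e (n + int b))" for b
      using shift_power[of e "n + int b" k] e_shift by (simp add: algebra_simps)
    then show ?thesis by (simp add: scale_sum_right mult.commute)
  qed
  show ?thesis unfolding H_def eq by (auto dest: inj)
qed

lemma H_separated:
  assumes "\<And>T::nat. v \<in> H (n + int T)"
  shows "v = 0"
proof -
  from assms[of 0] obtain w where w: "v = (\<Sum>b<r. sc (w b) (e (n + int b)))" by (auto simp: H_def)
  have "\<pi> ^ k dvd w b" if "b < r" for b k
  proof -
    from assms[of "r * k"] obtain c where c: "v = (\<Sum>b<r. sc (c b) (e (n + int (r * k) + int b)))"
      by (auto simp: H_def)
    have "e (n + int (r * k) + int b) = sc (\<pi> ^ k) (e (n + int b))" for b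
      using shift_power[of e "n + int b" k] e_shift by (simp add: algebra_simps)
    then have "(\<Sum>b<r. sc (w b - c b * \<pi> ^ k) (e (n + int b))) = 0"
      using w c by (simp add: scale_left_diff_distrib sum_subtractf)
    from e_independent[OF this that] show ?thesis by simp
  qed
  then have "w b = 0" if "b < r" for b using witt_eq_0_if_CHAR_power_dvd that by blast
  then show ?thesis unfolding w by simp
qed

text \<open>The series of the \<open>w t\<close> times \<open>g t\<close> is regrouped by the
  residue of \<open>t\<close> modulo \<open>r\<close>, so that the coefficient of \<open>g b\<close>
  becomes a p-adic series with a limit in W(k). The sequence \<open>g\<close> is kept general
  because both \<open>e\<close> and its perturbation are used in this role.\<close>

lemma H_complete:
  assumes shift: "\<And>t. g (t + r) = sc \<pi> (g t)" and g: "\<And>t. g t \<in> H (n + int t)"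
  shows "\<exists>c. \<forall>T. (\<Sum>b<r. sc (c b) (g b)) - (\<Sum>t<T. sc (w t) (g t)) \<in> H (n + int T)"
proof -
  have "\<forall>b. \<exists>x. \<forall>k. \<pi> ^ k dvd x - (\<Sum>l<k. \<pi> ^ l * w (b + l * r))"
    by (rule allI, rule witt_complete)
  from choice[OF this] obtain c where "\<forall>b k. \<pi> ^ k dvd c b - (\<Sum>l<k. \<pi> ^ l * w (b + l * r))"
    by (rule exE)
  then have c: "\<pi> ^ k dvd c b - (\<Sum>l<k. \<pi> ^ l * w (b + l * r))" for b k by simp
  have g_pow: "g (b + l * r) = sc (\<pi> ^ l) (g b)" for b l
  proof (induction l)
    case (Suc l)
    then show ?case using shift[of "b + l * r"] by (simp add: ac_simps)
  qed simp
  have multiple: "(\<Sum>b<r. sc (c b) (g b)) - (\<Sum>t<k * r. sc (w t) (g t)) \<in> H (n + int (k * r))"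
    for k
  proof -
    have "(\<Sum>t<k * r. sc (w t) (g t)) = (\<Sum>l<k. \<Sum>t\<in>{l * r..<l * r + r}. sc (w t) (g t))"
      by (rule sum.nat_group[symmetric])
    also have "\<dots> = (\<Sum>l<k. \<Sum>b<r. sc (w (b + l * r)) (g (b + l * r)))"
    proof (rule sum.cong[OF refl])
      fix l
      show "(\<Sum>t\<in>{l * r..<l * r + r}. sc (w t) (g t)) = (\<Sum>b<r. sc (w (b + l * r)) (g (b + l * r)))"
        using sum.shift_bounds_nat_ivl[of "\<lambda>t. sc (w t) (g t)" 0 "l * r" r]
        by (simp add: lessThan_atLeast0 add.commute[of r])
    qed
    also have "\<dots> = (\<Sum>b<r. sc (\<Sum>l<k. \<pi> ^ l * w (b + l * r)) (g b))"
      unfolding g_pow by (subst sum.swap) (simp add: scale_sum_left mult.commute)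
    finally have "(\<Sum>b<r. sc (c b) (g b)) - (\<Sum>t<k * r. sc (w t) (g t)) =
        (\<Sum>b<r. sc (c b - (\<Sum>l<k. \<pi> ^ l * w (b + l * r))) (g b))"
      by (simp add: scale_left_diff_distrib sum_subtractf)
    also have "\<dots> \<in> H (n + int (k * r))"
    proof (rule H_sum)
      fix b
      obtain d where "c b - (\<Sum>l<k. \<pi> ^ l * w (b + l * r)) = \<pi> ^ k * d"
        using c by (rule dvdE)
      then have "sc (c b - (\<Sum>l<k. \<pi> ^ l * w (b + l * r))) (g b) = sc d (g (b + k * r))"
        by (simp only: g_pow) (simp add: mult.commute)
      also have "\<dots> \<in> H (n + int (k * r))"
        by (intro H_scale H_mono[OF g]) simp
      finally show "sc (c b - (\<Sum>l<k. \<pi> ^ l * w (b + l * r))) (g b) \<in> H (n + int (k * r))" .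
    qed
    finally show ?thesis .
  qed
  have "(\<Sum>b<r. sc (c b) (g b)) - (\<Sum>t<T. sc (w t) (g t)) \<in> H (n + int T)" for T
  proof -
    \<comment> \<open>An arbitrary truncation at \<open>T\<close> is compared with the one at the
      multiple \<open>T * r\<close>; the terms in between already lie in
      \<open>H (n + T)\<close>.\<close>
    have T: "T \<le> T * r" using r_pos by simp
    have 1: "(\<Sum>b<r. sc (c b) (g b)) - (\<Sum>t<T * r. sc (w t) (g t)) \<in> H (n + int T)"
      by (rule H_mono[OF multiple]) (use T in \<open>simp only: add_le_cancel_left zle_int\<close>)
    have 2: "(\<Sum>t\<in>{T..<T * r}. sc (w t) (g t)) \<in> H (n + int T)"
      by (intro H_sum H_scale H_mono[OF g]) auto
    have "(\<Sum>t<T * r. sc (w t) (g t)) = (\<Sum>t<T. sc (w t) (g t)) + (\<Sum>t\<in>{T..<T * r}. sc (w t) (g t))"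
      using sum.atLeastLessThan_concat[OF le0 T, of "\<lambda>t. sc (w t) (g t)"]
      by (simp add: lessThan_atLeast0)
    then show ?thesis using H_add[OF 1 2] by (simp add: diff_add_eq_diff_diff_swap)
  qed
  then show ?thesis by blast
qed

lemma H_map:
  assumes "\<And>x y. f (x + y) = f x + f y" "\<And>a x. f (sc a x) = sc (\<tau> a) (f x)"
    and "\<And>n. f (e n) \<in> H (n + d)" and "v \<in> H n"
  shows "f v \<in> H (n + d)"
proof -
  have f0: "f 0 = 0" using assms(1)[of 0 0] by simp
  obtain w where v: "v = (\<Sum>b<r. sc (w b) (e (n + int b)))" using assms(4) by (auto simp: H_def)
  have "f (\<Sum>b\<in>B. sc (w b) (e (n + int b))) = (\<Sum>b\<in>B. sc (\<tau> (w b)) (f (e (n + int b))))" for B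
    by (induction B rule: infinite_finite_induct) (auto simp: f0 assms)
  then show ?thesis
    unfolding v by (auto intro!: H_sum H_scale H_mono[OF assms(3)])
qed

section \<open>Orders of vectors with respect to the filtration\<close>

definition has_order :: "'v \<Rightarrow> int \<Rightarrow> bool" where
  "has_order v n \<longleftrightarrow> v \<in> H n \<and> v \<notin> H (n + 1)"

lemma ex_has_order:
  assumes "v \<noteq> 0"
  shows "\<exists>n. has_order v n"
proof -
  obtain m where m: "v \<in> H m" using H_exhaustive by blast
  have ex: "\<exists>T::nat. v \<notin> H (m + int T)" using H_separated assms by blast
  define T where "T = (LEAST T::nat. v \<notin> H (m + int T))"
  have T: "v \<notin> H (m + int T)" unfolding T_def using LeastI_ex[OF ex] .
  then have "T \<noteq> 0" using m by (intro notI) simp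
  then obtain q where q: "T = Suc q" by (cases T) auto
  have "v \<in> H (m + int q)"
    using not_less_Least[of q "\<lambda>T. v \<notin> H (m + int T)"] q by (simp add: T_def[symmetric])
  then show ?thesis
    using T by (intro exI[of _ "m + int q"]) (simp add: has_order_def q algebra_simps)
qed

lemma has_order_unique:
  assumes "has_order v n" "has_order v m"
  shows "n = m"
proof (rule ccontr)
  assume "n \<noteq> m"
  then consider "n + 1 \<le> m" | "m + 1 \<le> n" by linarith
  then show False using assms H_mono unfolding has_order_def by cases blast+
qed

lemma has_order_e: "has_order (e n) n"
  using e_in_H[of n n] scale_e_in_H_iff[of 1 n] by (simp add: has_order_def one_witt.rep_eq wone_def)

lemma has_order_leading:
  assumes "has_order v n"
  obtains a where "v - sc a (e n) \<in> H (n + 1)" "witt_nth a 0 \<noteq> 0"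
proof -
  from assms obtain a where a: "v - sc a (e n) \<in> H (n + 1)"
    unfolding has_order_def using H_leading by blast
  have "witt_nth a 0 \<noteq> 0"
    using a assms H_diff_iff scale_e_in_H_iff unfolding has_order_def by blast
  with a show ?thesis by (rule that)
qed

lemma has_order_shift_iff: "has_order (sc (\<pi> ^ k) v) (n + int (r * k)) \<longleftrightarrow> has_order v n"
  using H_shift_iff[of k v n] H_shift_iff[of k v "n + 1"] by (simp add: has_order_def algebra_simps)

text \<open>Descending induction from \<open>m\<close>. As the quotients of the chain are lines, a
  multiple of an element of \<open>M\<close> of order \<open>k\<close> cancels the leading term of
  any vector in \<open>H k\<close>, and the rest lies in \<open>H (k + 1)\<close>.\<close>

lemma H_subset_of_orders:
  assumes M: "subspace M" and "H m \<subseteq> M" and "\<And>k. n \<le> k \<Longrightarrow> \<exists>v\<in>M. has_order v k"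
  shows "H n \<subseteq> M"
proof -
  have step: "H k \<subseteq> M" if IH: "H (k + 1) \<subseteq> M" and k: "n \<le> k" for k
  proof
    fix x assume "x \<in> H k"
    then obtain a where a: "x - sc a (e k) \<in> H (k + 1)" by (rule H_leading)
    obtain v where v: "v \<in> M" "has_order v k" using assms(3) k by blast
    obtain c where c: "v - sc c (e k) \<in> H (k + 1)" "witt_nth c 0 \<noteq> 0"
      using v(2) by (rule has_order_leading)
    \<comment> \<open>Any lift to W(k) of the ratio of the two leading coefficients works.\<close>
    obtain d where d: "witt_nth d 0 = witt_nth a 0 / witt_nth c 0" using ex_witt_nth_0 by metis
    have 1: "sc (a - d * c) (e k) \<in> H (k + 1)"
      using c(2) d by (simp add: scale_e_in_H_iff)
    have 2: "sc d (v - sc c (e k)) \<in> H (k + 1)" using c(1) by (rule H_scale)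
    have "(x - sc a (e k)) + sc (a - d * c) (e k) - sc d (v - sc c (e k)) \<in> H (k + 1)"
      by (rule H_diff[OF H_add[OF a 1] 2])
    then have "x - sc d v \<in> H (k + 1)"
      by (simp add: scale_right_diff_distrib scale_left_diff_distrib)
    then have "(x - sc d v) + sc d v \<in> M"
      using IH v(1) M by (intro subspace_add subspace_scale) auto
    then show "x \<in> M" by simp
  qed
  have "H (m - int t) \<subseteq> M" if "n \<le> m - int t" for t
    using that
  proof (induction t)
    case 0
    then show ?case using assms(2) by simp
  next
    case (Suc t)
    then have "H (m - int (Suc t) + 1) \<subseteq> M" by simp
    then show ?case using Suc.prems by (rule step)
  qed
  from this[of "nat (m - n)"] have "n \<le> m \<Longrightarrow> H n \<subseteq> M" by simp
  moreover have "m \<le> n \<Longrightarrow> H n \<subseteq> M" using H_antimono[of m n] assms(2) by (rule subset_trans)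
  ultimately show ?thesis by linarith
qed

end

section \<open>Lattices in a simple isocrystal\<close>

text \<open>A Bezout coefficient \<open>x\<close> inverts \<open>s\<close> modulo \<open>r\<close>,
  so the residue of \<open>x * n\<close> is the required \<open>i\<close>.\<close>

lemma ex_dvd_diff_mult:
  assumes "coprime s (int r)" "r > 0"
  shows "\<exists>i<r. int r dvd n - int i * s"
proof -
  obtain x y where xy: "x * s + y * int r = 1"
    using bezout_int[of s "int r"] assms by (auto simp: coprime_iff_gcd_eq_1)
  have "n - (x * n) mod int r * s = n * (x * s + y * int r) - (x * n) mod int r * s"
    by (simp add: xy)
  also have "\<dots> = (x * n - (x * n) mod int r) * s + int r * (n * y)"
    by (simp add: algebra_simps)
  also have "int r dvd \<dots>" by (intro dvd_add dvd_mult2 dvd_minus_mod) simp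
  finally show ?thesis
    using assms(2) by (intro exI[of _ "nat ((x * n) mod int r)"]) (simp add: nat_less_iff)
qed

lemma int_dvd_diff_imp_eq: "int r dvd int i - int j \<Longrightarrow> i < r \<Longrightarrow> j < r \<Longrightarrow> i = j"
  by (metis mod_eq_dvd_iff mod_less of_nat_eq_iff of_nat_mod)

text \<open>The slope is s / r because \<open>\<Phi> ^ r\<close> sends \<open>e n\<close> to
  \<open>e (n + r s)\<close>, which is \<open>p ^ s\<close> times \<open>e n\<close>. The sign of
  \<open>s\<close> is left open here; \<open>ex_sandwich\<close> derives that it is non-negative
  from a stable lattice.\<close>

locale isoclinic_chain = lattice_chain sc e r
  for sc :: "'k::{alg_closed_field, field_prime_char} witt \<Rightarrow> 'v::ab_group_add \<Rightarrow> 'v"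
    and e :: "int \<Rightarrow> 'v" and r :: nat +
  fixes \<Phi> :: "'v \<Rightarrow> 'v" and s :: int
  assumes \<Phi>_add: "\<Phi> (x + y) = \<Phi> x + \<Phi> y"
    and \<Phi>_scale: "\<Phi> (sc a x) = sc (witt_frob a) (\<Phi> x)"
    and \<Phi>_e: "\<Phi> (e n) = e (n + s)"
    and coprime: "coprime s (int r)"
begin

lemma \<Phi>_H: "v \<in> H n \<Longrightarrow> \<Phi> v \<in> H (n + s)"
  by (rule H_map[of \<Phi> witt_frob]) (simp_all add: \<Phi>_add \<Phi>_scale \<Phi>_e e_in_H)

lemma \<Phi>_diff: "\<Phi> (x - y) = \<Phi> x - \<Phi> y"
  using \<Phi>_add[of "x - y" y] by (simp add: algebra_simps)

lemma \<Phi>_0 [simp]: "\<Phi> 0 = 0"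
  using \<Phi>_diff[of 0 0] by simp

text \<open>The residue of the leading coefficient is replaced by its p-th power, which stays
  nonzero.\<close>

lemma has_order_\<Phi>:
  assumes "has_order v n"
  shows "has_order (\<Phi> v) (n + s)"
proof -
  obtain a where a: "v - sc a (e n) \<in> H (n + 1)" "witt_nth a 0 \<noteq> 0"
    using assms by (rule has_order_leading)
  have d: "\<Phi> v - sc (witt_frob a) (e (n + s)) \<in> H (n + s + 1)"
    using \<Phi>_H[OF a(1)] by (simp add: \<Phi>_diff \<Phi>_scale \<Phi>_e ac_simps)
  have "\<Phi> v \<notin> H (n + s + 1)"
  proof
    assume "\<Phi> v \<in> H (n + s + 1)"
    from H_diff[OF this d] have "witt_nth (witt_frob a) 0 = 0"
      by (simp add: scale_e_in_H_iff)
    then show False using a(2) by simp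
  qed
  moreover have "\<Phi> v \<in> H (n + s)" using assms \<Phi>_H by (simp add: has_order_def)
  ultimately show ?thesis by (simp add: has_order_def)
qed

lemma has_order_\<Phi>_imp:
  assumes "has_order (\<Phi> v) n"
  shows "has_order v (n - s)"
proof -
  have "v \<noteq> 0" using assms by (auto simp: has_order_def)
  then obtain m where m: "has_order v m" using ex_has_order by blast
  then have "m + s = n" using has_order_unique[OF has_order_\<Phi> assms] by blast
  with m show ?thesis by auto
qed

text \<open>
  The orders of elements of \<open>M\<close> contain the least one, \<open>a\<close>, and are stable under adding \<open>r\<close>,
  \<open>s\<close> and \<open>h r - s\<close>. Each residue class modulo \<open>r\<close> has the form \<open>a + i s\<close>, and its elements
  from \<open>a + i s\<close> on, as well as those from \<open>a + (r - i) (h r - s)\<close> on, are such orders.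
\<close>

lemma ex_sandwich:
  assumes M: "subspace M" and \<Phi>_M: "\<And>x. x \<in> M \<Longrightarrow> \<Phi> x \<in> M"
    and V_M: "\<And>x. x \<in> M \<Longrightarrow> \<exists>y\<in>M. sc (\<pi> ^ h) x = \<Phi> y"
    and m0: "H m0 \<subseteq> M" and m1: "M \<subseteq> H m1"
  obtains a where "M \<subseteq> H a" "0 \<le> s" "s \<le> int h * int r"
    "\<And>j. (\<And>i. i < r \<Longrightarrow> int i * s div int r \<le> j \<or> (int r - int i) * (int h * int r - s) div int r \<le> j)
      \<Longrightarrow> H (a + int r * j) \<subseteq> M"
proof -
  define S where "S n \<longleftrightarrow> (\<exists>v\<in>M. has_order v n)" for n
  \<comment> \<open>The vector \<open>e m0\<close> of \<open>M\<close> has order \<open>m0\<close>.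
    This bounds the indices \<open>n\<close> with \<open>M \<subseteq> H n\<close> from above, so a
    largest one exists.\<close>
  have not: "\<not> M \<subseteq> H (m0 + 1 + int T)" for T
    using m0 e_in_H[of m0 m0] has_order_e[of m0] H_antimono[of "m0 + 1" "m0 + 1 + int T"]
    unfolding has_order_def by auto
  have ex: "\<exists>T::nat. \<not> M \<subseteq> H (m1 + int T)"
  proof (cases "m1 \<le> m0 + 1")
    case True
    then show ?thesis using not[of 0] by (intro exI[of _ "nat (m0 + 1 - m1)"]) simp
  next
    case False
    then show ?thesis using not[of "nat (m1 - (m0 + 1))"] by (intro exI[of _ 0]) simp
  qed
  define T where "T = (LEAST T::nat. \<not> M \<subseteq> H (m1 + int T))"
  have T: "\<not> M \<subseteq> H (m1 + int T)" unfolding T_def using LeastI_ex[OF ex] .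
  then have "T \<noteq> 0" using m1 by (intro notI) simp
  then obtain q where q: "T = Suc q" by (cases T) auto
  define a where "a = m1 + int q"
  have a: "M \<subseteq> H a"
    using not_less_Least[of q "\<lambda>T. \<not> M \<subseteq> H (m1 + int T)"] q by (simp add: T_def[symmetric] a_def)
  have "\<not> M \<subseteq> H (a + 1)" using T by (simp add: q a_def algebra_simps)
  then have S_a: "S a" unfolding S_def has_order_def using a by blast
  have S_ge: "a \<le> n" if "S n" for n
  proof (rule ccontr)
    assume "\<not> a \<le> n"
    then have "M \<subseteq> H (n + 1)" using a H_antimono[of "n + 1" a] by auto
    then show False using that unfolding S_def has_order_def by blast
  qed
  have S_s: "S (n + s)" if "S n" for n
    using that \<Phi>_M has_order_\<Phi> unfolding S_def by blast
  have S_h: "S (n + (int h * int r - s))" if "S n" for n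
  proof -
    from that obtain v where v: "v \<in> M" "has_order v n" unfolding S_def by blast
    obtain y where y: "y \<in> M" "sc (\<pi> ^ h) v = \<Phi> y" using V_M v(1) by blast
    have "has_order (\<Phi> y) (n + int (r * h))" using v(2) y(2) has_order_shift_iff by metis
    from has_order_\<Phi>_imp[OF this] show ?thesis
      using y(1) unfolding S_def by (intro bexI[of _ y]) (simp_all add: algebra_simps)
  qed
  have S_r: "S (n + int k * int r)" if "S n" for n k
    using that has_order_shift_iff[of k _ n] subspace_scale[OF M] unfolding S_def
    by (simp add: mult.commute) blast
  have S_mult: "S (n + int k * d)" if "S n" "\<And>n. S n \<Longrightarrow> S (n + d)" for n k d
  proof (induction k)
    case (Suc k)
    then show ?case using that(2)[of "n + int k * d"] by (simp add: algebra_simps)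
  qed (use that in simp)
  \<comment> \<open>Neither of the two moves may lead below the least order
    \<open>a\<close>.\<close>
  have nonneg: "0 \<le> s" "s \<le> int h * int r"
    using S_ge[OF S_s[OF S_a]] S_ge[OF S_h[OF S_a]] by auto
  have sub: "H (a + int r * j) \<subseteq> M"
    if j: "\<And>i. i < r \<Longrightarrow> int i * s div int r \<le> j \<or> (int r - int i) * (int h * int r - s) div int r \<le> j"
    for j
  proof (rule H_subset_of_orders[OF M m0])
    fix n assume n: "a + int r * j \<le> n"
    have reach: "S n" if "S (a + d)" "int r dvd n - a - d" "d div int r \<le> j" for d
    proof -
      obtain t where t: "n - a - d = int r * t" using \<open>int r dvd n - a - d\<close> by (rule dvdE)
      \<comment> \<open>Rounding down is harmless: \<open>n - a - d\<close> is a multiple of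
        \<open>r\<close> larger than \<open>- r\<close>, hence non-negative.\<close>
      have "d < int r * (d div int r + 1)"
        using r_pos by (simp add: distrib_left) (smt (verit) of_nat_0_less_iff pos_mod_bound mult_div_mod_eq)
      also have "\<dots> \<le> int r * (j + 1)" using that(3) by (intro mult_left_mono) auto
      finally have "int r * (t + 1) > 0" using n t by (simp add: algebra_simps)
      then have "t \<ge> 0" using r_pos by (simp add: zero_less_mult_iff)
      then have "n = a + d + int (nat t) * int r" using t by (simp add: algebra_simps)
      then show ?thesis using S_r[OF that(1)] by metis
    qed
    obtain i where i: "i < r" "int r dvd n - a - int i * s" 
      using ex_dvd_diff_mult[OF coprime r_pos] by blast
    from j[OF i(1)] have "S n"
    proof
      assume "int i * s div int r \<le> j"
      then show ?thesis using i(2) by (intro reach[of "int i * s"] S_mult S_a S_s)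
    next
      assume le: "(int r - int i) * (int h * int r - s) div int r \<le> j"
      \<comment> \<open>Modulo \<open>r\<close> the product \<open>(r - i) (h r - s)\<close> is
        congruent to \<open>i s\<close>, so both routes reach the same residue class.\<close>
      have "n - a - (int r - int i) * (int h * int r - s) =
          n - a - int i * s + int r * (s - (int r - int i) * int h)"
        by (simp add: algebra_simps)
      then have "int r dvd n - a - (int r - int i) * (int h * int r - s)"
        using i(2) by (metis dvd_add dvd_triv_left)
      moreover have "S (a + int (r - i) * (int h * int r - s))"
        by (intro S_mult S_a S_h)
      ultimately show ?thesis using le i(1) by (intro reach[of "(int r - int i) * (int h * int r - s)"]) (simp_all add: of_nat_diff)
    qed
    then show "\<exists>v\<in>M. has_order v n" by (simp add: S_def)
  qed
  show ?thesis by (rule that[OF a nonneg sub])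
qed

end

section \<open>Small perturbations of the Frobenius\<close>

lemma witt_nth_frob_funpow_0:
  "witt_nth ((witt_frob ^^ i) x) 0 = witt_nth (x :: 'k::comm_ring_prime_char witt) 0 ^ (CHAR('k) ^ i)"
  by (induction i) (auto simp: mult.commute simp flip: power_mult)

text \<open>\<open>\<Psi>\<close> stands for the extension of \<open>g \<circ> \<phi>\<close>, and
  \<open>D\<close> measures how many steps of the filtration the difference from
  \<open>\<Phi>\<close> gains. Since \<open>s\<close> is non-negative, \<open>p ^ s\<close> lies in
  W(k) and is written \<open>\<pi> ^ nat s\<close>.\<close>

locale perturbed_chain = isoclinic_chain sc e r \<Phi> s
  for sc :: "'k::{alg_closed_field, field_prime_char} witt \<Rightarrow> 'v::ab_group_add \<Rightarrow> 'v"
    and e :: "int \<Rightarrow> 'v" and r :: nat and \<Phi> :: "'v \<Rightarrow> 'v" and s :: int +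
  fixes \<Psi> :: "'v \<Rightarrow> 'v" and D :: int
  assumes \<Psi>_add: "\<Psi> (x + y) = \<Psi> x + \<Psi> y"
    and \<Psi>_scale: "\<Psi> (sc a x) = sc (witt_frob a) (\<Psi> x)"
    and \<Psi>_e: "\<Psi> (e n) - e (n + s) \<in> H (n + s + D)"
    and D_pos: "D \<ge> 1" and s_nonneg: "s \<ge> 0"
begin

lemma \<Psi>_funpow_add: "(\<Psi> ^^ i) (x + y) = (\<Psi> ^^ i) x + (\<Psi> ^^ i) y"
  by (induction i) (auto simp: \<Psi>_add)

lemma \<Psi>_funpow_diff: "(\<Psi> ^^ i) (x - y) = (\<Psi> ^^ i) x - (\<Psi> ^^ i) y"
  using \<Psi>_funpow_add[of i "x - y" y] by (simp add: algebra_simps)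

lemma \<Psi>_funpow_scale: "(\<Psi> ^^ i) (sc a x) = sc ((witt_frob ^^ i) a) ((\<Psi> ^^ i) x)"
  by (induction i) (auto simp: \<Psi>_scale)

lemma \<Psi>_funpow_scale_CHAR: "(\<Psi> ^^ i) (sc (\<pi> ^ k) x) = sc (\<pi> ^ k) ((\<Psi> ^^ i) x)"
proof -
  have "(witt_frob ^^ i) (\<pi> ^ k) = \<pi> ^ k" by (induction i) (auto simp: witt_frob_power)
  then show ?thesis by (simp add: \<Psi>_funpow_scale)
qed

lemma \<Psi>_e_in_H: "\<Psi> (e n) \<in> H (n + s)"
  using H_add[OF H_mono[OF \<Psi>_e[of n]] e_in_H[of "n + s" "n + s"]] D_pos by simp

lemma \<Psi>_H: "v \<in> H n \<Longrightarrow> \<Psi> v \<in> H (n + s)"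
  by (rule H_map[of \<Psi> witt_frob]) (simp_all add: \<Psi>_add \<Psi>_scale \<Psi>_e_in_H)

lemma \<Psi>_funpow_H: "v \<in> H n \<Longrightarrow> (\<Psi> ^^ i) v \<in> H (n + int i * s)"
proof (induction i)
  case (Suc i)
  then show ?case using \<Psi>_H[of "(\<Psi> ^^ i) v" "n + int i * s"] by (simp add: algebra_simps)
qed simp

lemma \<Psi>_funpow_e: "(\<Psi> ^^ i) (e n) - e (n + int i * s) \<in> H (n + int i * s + D)"
proof (induction i)
  case (Suc i)
  let ?m = "n + int i * s"
  have "\<Psi> ((\<Psi> ^^ i) (e n) - e ?m) \<in> H (?m + s + D)"
    using \<Psi>_H[OF Suc] by (simp add: algebra_simps)
  moreover have "\<Psi> ((\<Psi> ^^ i) (e n) - e ?m) = (\<Psi> ^^ Suc i) (e n) - \<Psi> (e ?m)"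
    using \<Psi>_funpow_diff[of 1] by simp
  ultimately have "(\<Psi> ^^ Suc i) (e n) - e (?m + s) \<in> H (?m + s + D)"
    using H_diff_trans \<Psi>_e by metis
  then show ?case by (simp add: algebra_simps)
qed simp

text \<open>The defect of \<open>v\<close> as a slope vector. It is additive but not linear, which
  turns the condition on a single digit into an Artin-Schreier equation.\<close>

definition dev :: "'v \<Rightarrow> 'v" where
  "dev v = (\<Psi> ^^ r) v - sc (\<pi> ^ nat s) v"

lemma dev_add: "dev (x + y) = dev x + dev y"
  by (simp add: dev_def \<Psi>_funpow_add scale_right_distrib)

lemma scale_CHAR_power_s_H: "v \<in> H n \<Longrightarrow> sc (\<pi> ^ nat s) v \<in> H (n + int r * s)"
  using H_shift_iff[of "nat s" v n] s_nonneg by simp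

lemma dev_H: "v \<in> H n \<Longrightarrow> dev v \<in> H (n + int r * s)"
  unfolding dev_def using \<Psi>_funpow_H scale_CHAR_power_s_H by (intro H_diff)

lemma scale_CHAR_power_s_e: "sc (\<pi> ^ nat s) (e n) = e (n + int r * s)"
  using shift_power[of e n "nat s"] e_shift s_nonneg by simp

text \<open>Replacing \<open>(\<Psi> ^^ r) (e n)\<close> by \<open>e (n + r s)\<close> costs an
  error \<open>D\<close> steps deeper, and what remains is the coefficient map sending
  \<open>c\<close> to its \<open>r\<close>-fold Frobenius transform minus \<open>c\<close>.\<close>

lemma dev_scale_e: "dev (sc c (e n)) - sc ((witt_frob ^^ r) c - c) (e (n + int r * s)) \<in> H (n + int r * s + D)"
proof -
  have "dev (sc c (e n)) - sc ((witt_frob ^^ r) c - c) (e (n + int r * s)) =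
      sc ((witt_frob ^^ r) c) ((\<Psi> ^^ r) (e n) - e (n + int r * s))"
    using scale_CHAR_power_s_e[of n]
    by (simp add: dev_def \<Psi>_funpow_scale scale_right_diff_distrib scale_left_diff_distrib
        scale_left_commute[of _ c] del: scale_scale)
  also have "\<dots> \<in> H (n + int r * s + D)" by (rule H_scale[OF \<Psi>_funpow_e])
  finally show ?thesis .
qed

text \<open>
  A slope-\<open>s / r\<close> vector of \<open>\<Psi>\<close> is found by successive approximation. In each step the leading
  coefficient \<open>c\<close> of the correction solves an Artin-Schreier equation \<open>c ^ (p ^ r) - c = d\<close>.
\<close>

lemma improve_approximation:
  assumes "dev v \<in> H (n + int r * s)"
  obtains c where "dev (v + sc c (e n)) \<in> H (n + int r * s + 1)"
proof -
  let ?m = "n + int r * s"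
  obtain a where a: "dev v - sc a (e ?m) \<in> H (?m + 1)" using assms by (rule H_leading)
  have "CHAR('k) ^ r > 1"
    using r_pos prime_gt_1_nat[OF CHAR_prime] by (intro one_less_power)
  then obtain x :: 'k where x: "x ^ (CHAR('k) ^ r) - x = - witt_nth a 0"
    using artin_schreier_root by metis
  obtain c where c: "witt_nth c 0 = x" using ex_witt_nth_0 by metis
  have 1: "sc (a + ((witt_frob ^^ r) c - c)) (e ?m) \<in> H (?m + 1)"
    by (simp add: scale_e_in_H_iff witt_nth_frob_funpow_0 c x)
  have 2: "dev (sc c (e n)) - sc ((witt_frob ^^ r) c - c) (e ?m) \<in> H (?m + 1)"
    using H_mono[OF dev_scale_e] D_pos by simp
  have "dev (v + sc c (e n)) = (dev v - sc a (e ?m)) +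
      (dev (sc c (e n)) - sc ((witt_frob ^^ r) c - c) (e ?m)) + sc (a + ((witt_frob ^^ r) c - c)) (e ?m)"
    unfolding dev_add scale_left_distrib[of a] by (simp only: algebra_simps)
  then have "dev (v + sc c (e n)) \<in> H (?m + 1)"
    using H_add[OF H_add[OF a 2] 1] by (simp only:)
  then show ?thesis by (rule that)
qed

text \<open>The iteration starts at \<open>e n\<close>, whose defect is already \<open>D\<close>
  steps deeper than its index suggests. All corrections thus have index at least
  \<open>n + D\<close>, their series converges by \<open>H_complete\<close>, and
  \<open>dev_H\<close> lets the defect pass to the limit.\<close>

lemma ex_slope_vector:
  obtains v where "v - e n \<in> H (n + D)" "(\<Psi> ^^ r) v = sc (\<pi> ^ nat s) v"
proof -
  define N where "N T = n + D + int T" for T :: nat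
  have "\<exists>v. \<forall>T. (dev (v T) \<in> H (N T + int r * s) \<and> (T = 0 \<longrightarrow> v T = e n)) \<and>
      (\<exists>c. v (Suc T) = v T + sc c (e (N T)))"
  proof (rule dependent_nat_choice)
    \<comment> \<open>For the coefficient 1 the Artin-Schreier term vanishes.\<close>
    have "dev (e n) = dev (sc 1 (e n)) - sc ((witt_frob ^^ r) 1 - 1) (e (n + int r * s))"
    proof -
      have "(witt_frob ^^ r) 1 = (1 :: 'k witt)" by (induction r) auto
      then show ?thesis by simp
    qed
    also have "\<dots> \<in> H (N 0 + int r * s)"
      using dev_scale_e[of 1 n] by (simp add: N_def algebra_simps)
    finally show "\<exists>v. dev v \<in> H (N 0 + int r * s) \<and> (0 = (0::nat) \<longrightarrow> v = e n)" by blast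
  next
    fix v T assume "dev v \<in> H (N T + int r * s) \<and> (T = 0 \<longrightarrow> v = e n)"
    then obtain c where "dev (v + sc c (e (N T))) \<in> H (N T + int r * s + 1)"
      using improve_approximation by blast
    then have "dev (v + sc c (e (N T))) \<in> H (N (Suc T) + int r * s)" 
      by (simp add: N_def algebra_simps)
    then show "\<exists>v'. (dev v' \<in> H (N (Suc T) + int r * s) \<and> (Suc T = 0 \<longrightarrow> v' = e n)) \<and>
        (\<exists>c. v' = v + sc c (e (N T)))" by blast
  qed
  then obtain v where v: "\<And>T. dev (v T) \<in> H (N T + int r * s)" "v 0 = e n"
    "\<And>T. \<exists>c. v (Suc T) = v T + sc c (e (N T))" by blast
  from v(3) obtain w where w: "\<And>T. v (Suc T) = v T + sc (w T) (e (N T))" by metis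
  have v_sum: "v T = e n + (\<Sum>t<T. sc (w t) (e (N t)))" for T
    by (induction T) (auto simp: v(2) w)
  have "e (N (t + r)) = sc \<pi> (e (N t))" for t
    using e_shift[of "N t"] by (simp add: N_def add.assoc)
  moreover have "e (N t) \<in> H (n + D + int t)" for t by (simp add: N_def e_in_H)
  ultimately obtain c where
    c: "\<And>T. (\<Sum>b<r. sc (c b) (e (N b))) - (\<Sum>t<T. sc (w t) (e (N t))) \<in> H (n + D + int T)"
    using H_complete[of "\<lambda>t. e (N t)" "n + D" w] by blast
  define u where "u = (\<Sum>b<r. sc (c b) (e (N b)))"
  have "dev (e n + u) \<in> H (n + D + int r * s + int T)" for T
  proof -
    \<comment> \<open>Both the defect of the \<open>T\<close>-th approximation and that of the tail
      of the series lie in \<open>H (N T + r s)\<close>.\<close>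
    have "e n + u = v T + (u - (\<Sum>t<T. sc (w t) (e (N t))))" by (simp add: v_sum)
    then have "dev (e n + u) = dev (v T) + dev (u - (\<Sum>t<T. sc (w t) (e (N t))))"
      by (simp only: dev_add)
    also have "\<dots> \<in> H (N T + int r * s)"
      using v(1) dev_H[OF c[of T]] by (intro H_add) (simp_all add: u_def N_def)
    finally show ?thesis by (simp add: N_def algebra_simps)
  qed
  then have "dev (e n + u) = 0" by (rule H_separated)
  moreover have "(e n + u) - e n \<in> H (n + D)" using c[of 0] by (simp add: u_def)
  ultimately show ?thesis by (intro that[of "e n + u"]) (auto simp: dev_def)
qed

text \<open>The vectors \<open>f t\<close> are the multiples \<open>p ^ l \<Psi> ^ i v\<close> of the transforms of a slope vector \<open>v\<close>, which
  depend only on \<open>i s + l r\<close>.\<close>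

lemma ex_perturbed_basis:
  obtains f :: "nat \<Rightarrow> 'v" where
    "\<And>t. f (t + r) = sc \<pi> (f t)" "\<And>t. \<Psi> (f t) = f (t + nat s)"
    "\<And>t. f t - e (a + int t) \<in> H (a + int t + D)"
proof -
  define k where "k = nat s"
  have s: "s = int k" using s_nonneg by (simp add: k_def)
  \<comment> \<open>Starting \<open>r k\<close> below \<open>a\<close> makes every index
    \<open>a + t\<close> with \<open>t \<ge> 0\<close> of the form \<open>n + i k + r l\<close> with
    \<open>i < r\<close> and \<open>l \<ge> 0\<close>, so no division by p is required.\<close>
  define n where "n = a - int (r * k)"
  obtain v where v: "v - e n \<in> H (n + D)" "(\<Psi> ^^ r) v = sc (\<pi> ^ k) v"
    using ex_slope_vector unfolding k_def by blast
  define F where "F i l = sc (\<pi> ^ l) ((\<Psi> ^^ i) v)" for i l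
  have F_wrap: "F (i + r * q) l = F i (l + k * q)" for i q l
  proof (induction q arbitrary: l)
    case (Suc q)
    have "F (i + r * Suc q) l = sc (\<pi> ^ l) ((\<Psi> ^^ (i + r * q)) ((\<Psi> ^^ r) v))"
      by (simp add: F_def funpow_add[symmetric, THEN fun_cong, simplified] ac_simps)
    also have "\<dots> = F (i + r * q) (l + k)"
      by (simp add: F_def v(2) \<Psi>_funpow_scale_CHAR power_add)
    also have "\<dots> = F i (l + k * Suc q)" using Suc[of "l + k"] by (simp add: ac_simps)
    finally show ?case .
  qed simp
  \<comment> \<open>Equal indices force \<open>r\<close> to divide \<open>(i - i') k\<close>, hence
    \<open>i - i'\<close> by coprimality; then \<open>F_wrap\<close> trades \<open>r\<close>
    applications of \<open>\<Psi>\<close> for a factor \<open>p ^ k\<close>.\<close>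
  have F_eq_le: "F i l = F i' l'" if eq: "i * k + r * l = i' * k + r * l'" and le: "i' \<le> i" for i l i' l'
  proof -
    obtain d where d: "i = i' + d" using le le_Suc_ex by blast
    have dk: "d * k + r * l = r * l'" using eq by (simp add: d algebra_simps)
    then have "r dvd d * k" by (metis dvd_add_left_iff dvd_triv_left)
    moreover have "coprime r k" using coprime by (simp add: s coprime_commute)
    ultimately have "r dvd d" by (simp add: coprime_dvd_mult_left_iff)
    then obtain q where q: "d = r * q" by (rule dvdE)
    have "r * (q * k + l) = r * l'" using dk q by (simp add: algebra_simps)
    then have "l' = l + k * q" using r_pos by (simp add: mult.commute)
    moreover have "i = i' + r * q" using q d by simp
    ultimately show ?thesis using F_wrap by simp
  qed
  have F_eq: "F i l = F i' l'" if "i * k + r * l = i' * k + r * l'" for i l i' l'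
    using F_eq_le[of i l i' l'] F_eq_le[of i' l' i l] that by (cases "i' \<le> i") auto
  have "\<exists>i l. t + r * k = i * k + r * l" for t
  proof -
    obtain i where i: "i < r" "int r dvd int t - int i * s" 
      using ex_dvd_diff_mult[OF coprime r_pos] by blast
    have "int (t + r * k) - int (i * k) = (int t - int i * s) + int r * int k" by (simp add: s)
    then have "int r dvd int (t + r * k) - int (i * k)" using i(2) by (simp only: dvd_add dvd_triv_left)
    moreover have "i * k \<le> t + r * k" using i(1) by (simp add: trans_le_add2)
    ultimately have "r dvd t + r * k - i * k" by (metis of_nat_diff int_dvd_int_iff)
    then obtain l where "t + r * k - i * k = r * l" by (rule dvdE)
    then show ?thesis using \<open>i * k \<le> t + r * k\<close> by (intro exI[of _ i] exI[of _ l]) simp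
  qed
  then obtain I L where IL: "\<And>t. t + r * k = I t * k + r * L t" by metis
  define f where "f t = F (I t) (L t)" for t
  have f_eq: "f t = F i l" if "t + r * k = i * k + r * l" for t i l
    unfolding f_def by (rule F_eq) (use that IL in metis)
  show ?thesis
  proof (rule that)
    fix t
    have "f (t + r) = F (I t) (L t + 1)" by (rule f_eq) (use IL[of t] in \<open>simp add: algebra_simps\<close>)
    then show "f (t + r) = sc \<pi> (f t)" by (simp add: f_def F_def)
    have "f (t + k) = F (I t + 1) (L t)" by (rule f_eq) (use IL[of t] in \<open>simp add: algebra_simps\<close>)
    then show "\<Psi> (f t) = f (t + nat s)"
      using \<Psi>_funpow_scale_CHAR[of 1] by (simp add: f_def F_def k_def)
    have nt: "n + int (I t) * s + int (r * L t) = a + int t"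
      using arg_cong[OF IL[of t], of int] by (simp add: n_def s)
    have "(\<Psi> ^^ I t) (v - e n) \<in> H (n + D + int (I t) * s)" using v(1) by (rule \<Psi>_funpow_H)
    then have "(\<Psi> ^^ I t) v - e (n + int (I t) * s) \<in> H (n + int (I t) * s + D)"
      using H_diff_trans[OF _ \<Psi>_funpow_e[of "I t" n]] by (simp add: \<Psi>_funpow_diff algebra_simps)
    then have "sc (\<pi> ^ L t) ((\<Psi> ^^ I t) v - e (n + int (I t) * s)) \<in> H (n + int (I t) * s + D + int (r * L t))"
      by (simp only: H_shift_iff)
    moreover have "sc (\<pi> ^ L t) (e (n + int (I t) * s)) = e (a + int t)"
      using shift_power[of e "n + int (I t) * s" "L t", OF e_shift] nt by simp
    ultimately show "f t - e (a + int t) \<in> H (a + int t + D)"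
      using nt by (simp add: f_def F_def scale_right_diff_distrib algebra_simps)
  qed
qed

text \<open>The linear map \<open>h\<close> takes \<open>e (a + b)\<close> to \<open>f b\<close>. It
  intertwines \<open>\<Phi>\<close> and \<open>\<Psi>\<close> because both shift the index by
  \<open>s\<close>. Since \<open>h - 1\<close> raises the filtration by \<open>D\<close>, it is
  bijective on \<open>H a\<close> and changes elements of \<open>M\<close> only by elements of
  \<open>M\<close>.\<close>

lemma ex_conjugation:
  assumes M: "subspace M" "\<And>x. x \<in> M \<Longrightarrow> \<Phi> x \<in> M" and Ma: "M \<subseteq> H a" and aM: "H (a + D) \<subseteq> M"
  obtains h where "\<And>x. x \<in> M \<Longrightarrow> h x \<in> M" "bij_betw h M M"
    "\<And>x y. x \<in> M \<Longrightarrow> y \<in> M \<Longrightarrow> h (x + y) = h x + h y"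
    "\<And>c x. x \<in> M \<Longrightarrow> h (sc c x) = sc c (h x)"
    "\<And>x. x \<in> M \<Longrightarrow> h (\<Phi> x) = \<Psi> (h x)"
proof -
  obtain f where f: "\<And>t. f (t + r) = sc \<pi> (f t)" "\<And>t. \<Psi> (f t) = f (t + nat s)"
    "\<And>t. f t - e (a + int t) \<in> H (a + int t + D)"
    using ex_perturbed_basis by blast
  define comb where "comb w = (\<Sum>b<r. sc (w b) (e (a + int b)))" for w
  have H_a: "\<exists>w. x = comb w" if "x \<in> H a" for x
    using that by (auto simp: H_def comb_def)
  have comb_H: "comb w \<in> H a" for w unfolding comb_def by (rule H_I)
  define coord where "coord x = (SOME w. x = comb w)" for x
  define h where "h x = (\<Sum>b<r. sc (coord x b) (f b))" for x
  have h_comb: "h (comb w) = (\<Sum>b<r. sc (w b) (f b))" for w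
  proof -
    have "comb w = comb (coord (comb w))" unfolding coord_def by (rule someI[of _ w]) simp
    then have "(\<Sum>b<r. sc (w b - coord (comb w) b) (e (a + int b))) = 0"
      by (simp add: comb_def scale_left_diff_distrib sum_subtractf)
    then have "w b - coord (comb w) b = 0" if "b < r" for b
      using that by (rule e_independent[where w = "\<lambda>b. w b - coord (comb w) b"])
    then show ?thesis unfolding h_def by (intro sum.cong) auto
  qed
  have h_add: "h (x + y) = h x + h y" if xy: "x \<in> H a" "y \<in> H a" for x y
  proof -
    obtain v w where x: "x = comb v" and y: "y = comb w" using H_a[OF xy(1)] H_a[OF xy(2)] by blast
    have "x + y = comb (\<lambda>b. v b + w b)" by (simp add: x y comb_def scale_left_distrib sum.distrib)
    then show ?thesis by (simp add: x y h_comb scale_left_distrib sum.distrib)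
  qed
  have h_scale: "h (sc c x) = sc c (h x)" if xa: "x \<in> H a" for c x
  proof -
    obtain w where x: "x = comb w" using H_a[OF xa] by blast
    have "sc c x = comb (\<lambda>b. c * w b)" by (simp add: x comb_def scale_sum_right)
    then show ?thesis by (simp add: x h_comb scale_sum_right)
  qed
  have h_diff: "h (x - y) = h x - h y" if "x \<in> H a" "y \<in> H a" for x y
    using h_add[of "x - y" y] that H_diff by (simp add: algebra_simps)
  \<comment> \<open>Beyond the first \<open>r\<close> indices both sequences are continued by
    multiplication by p, which \<open>h\<close> respects.\<close>
  have h_e: "h (e (a + int t)) = f t" for t
  proof (induction t rule: less_induct)
    case (less t)
    show ?case
    proof (cases "t < r")
      case True
      have "e (a + int t) = comb (\<lambda>b. if b = t then 1 else 0)"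
        using True by (simp add: comb_def if_distrib[of "\<lambda>c. sc c _"] cong: if_cong)
      then show ?thesis
        using True by (simp add: h_comb if_distrib[of "\<lambda>c. sc c _"] cong: if_cong)
    next
      case False
      then have "e (a + int t) = sc \<pi> (e (a + int (t - r)))"
        using e_shift[of "a + int (t - r)"] by (simp add: of_nat_diff)
      then show ?thesis
        using False r_pos less[of "t - r"] f(1)[of "t - r"] by (simp add: h_scale e_in_H)
    qed
  qed
  have h_sum: "h (\<Sum>b\<in>B. sc (w b) (e (a + int (g b)))) = (\<Sum>b\<in>B. sc (w b) (f (g b)))" for B :: "nat set" and w g
  proof (induction B rule: infinite_finite_induct)
    case (insert x F)
    moreover have "(\<Sum>b\<in>F. sc (w b) (e (a + int (g b)))) \<in> H a"
      by (intro H_sum H_scale e_in_H) simp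
    ultimately show ?case by (simp add: h_add h_scale h_e H_scale e_in_H)
  qed (use h_scale[of 0 0] in auto)
  have h_near: "h x - x \<in> H (a + int t + D)" if xt: "x \<in> H (a + int t)" for x t
  proof -
    obtain w where "x = (\<Sum>b<r. sc (w b) (e (a + int t + int b)))" using xt by (auto simp: H_def)
    then have x: "x = (\<Sum>b<r. sc (w b) (e (a + int (t + b))))" by (simp add: add.assoc)
    have "h x - x = (\<Sum>b<r. sc (w b) (f (t + b) - e (a + int (t + b))))"
      unfolding x h_sum by (simp add: scale_right_diff_distrib sum_subtractf)
    also have "\<dots> \<in> H (a + int t + D)"
      by (intro H_sum H_scale H_mono[OF f(3)]) simp
    finally show ?thesis .
  qed
  have h_in: "h x \<in> H a" if "x \<in> H a" for x
    using H_add[OF H_mono[OF h_near[of x 0]], of a x] that D_pos by simp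
  have h_M: "h x \<in> M" if "x \<in> M" for x
  proof -
    have "h x - x \<in> M" using h_near[of x 0] that Ma aM by auto
    then show ?thesis using subspace_add[OF M(1) _ that, of "h x - x"] by simp
  qed
  have \<Psi>0: "\<Psi> 0 = 0" using \<Psi>_scale[of 0 0] by simp
  have h_\<Phi>: "h (\<Phi> x) = \<Psi> (h x)" if xa: "x \<in> H a" for x
  proof -
    obtain w where x: "x = comb w" using H_a[OF xa] by blast
    have "\<Phi> (\<Sum>b\<in>B. sc (w b) (e (a + int b))) =
        (\<Sum>b\<in>B. sc (witt_frob (w b)) (e (a + int (b + nat s))))" for B
      using s_nonneg
      by (induction B rule: infinite_finite_induct) (simp_all add: \<Phi>_add \<Phi>_scale \<Phi>_e add.assoc)
    then have "h (\<Phi> x) = (\<Sum>b<r. sc (witt_frob (w b)) (f (b + nat s)))"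
      by (simp only: x comb_def h_sum)
    moreover have "\<Psi> (\<Sum>b\<in>B. sc (w b) (f b)) = (\<Sum>b\<in>B. sc (witt_frob (w b)) (f (b + nat s)))" for B
      by (induction B rule: infinite_finite_induct) (simp_all add: \<Psi>_add \<Psi>_scale f(2) \<Psi>0)
    ultimately show ?thesis by (simp only: x h_comb)
  qed
  \<comment> \<open>If \<open>h x = 0\<close>, then \<open>h x - x = - x\<close> lies strictly
    deeper than \<open>x\<close> is known to lie, so \<open>x\<close> is in every member of the
    chain.\<close>
  have h_inj: "x = 0" if x: "x \<in> H a" "h x = 0" for x
  proof (rule H_separated)
    fix T
    show "x \<in> H (a + int T)"
    proof (induction T)
      case (Suc T)
      have "x \<in> H (a + int T + D)" using H_neg[OF h_near[OF Suc]] x(2) by simp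
      then show ?case by (rule H_mono) (use D_pos in simp)
    qed (use x in simp)
  qed
  have h_surj: "\<exists>x\<in>H a. h x = y" if y: "y \<in> H a" for y
  proof -
    have near1: "f t - e (a + int t) \<in> H (a + int t + 1)" for t
      using H_mono[OF f(3)] D_pos by simp
    \<comment> \<open>The target \<open>y\<close> is expanded digit by digit in the
      \<open>f t\<close>, which have the same leading terms as the \<open>e (a + t)\<close>;
      \<open>z T\<close> is the remainder after \<open>T\<close> digits.\<close>
    have "\<exists>z. \<forall>T. (z T \<in> H (a + int T) \<and> (T = 0 \<longrightarrow> z T = y)) \<and>
        (\<exists>c. z (Suc T) = z T - sc c (f T))"
    proof (rule dependent_nat_choice)
      show "\<exists>z. z \<in> H (a + int 0) \<and> (0 = (0::nat) \<longrightarrow> z = y)" using y by simp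
    next
      fix z T assume "z \<in> H (a + int T) \<and> (T = 0 \<longrightarrow> z = y)"
      then obtain c where "z - sc c (e (a + int T)) \<in> H (a + int T + 1)" using H_leading by blast
      then have "(z - sc c (e (a + int T))) - sc c (f T - e (a + int T)) \<in> H (a + int T + 1)"
        using H_scale[OF near1] by (rule H_diff)
      then have "z - sc c (f T) \<in> H (a + int (Suc T))"
        by (simp add: scale_right_diff_distrib add.assoc add.commute[of 1])
      then show "\<exists>z'. (z' \<in> H (a + int (Suc T)) \<and> (Suc T = 0 \<longrightarrow> z' = y)) \<and>
          (\<exists>c. z' = z - sc c (f T))" by blast
    qed
    then obtain z where z: "\<And>T. z T \<in> H (a + int T)" "z 0 = y"
      "\<And>T. \<exists>c. z (Suc T) = z T - sc c (f T)" by blast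
    from z(3) obtain w where w: "\<And>T. z (Suc T) = z T - sc (w T) (f T)" by metis
    have z_sum: "z T = y - (\<Sum>t<T. sc (w t) (f t))" for T
      by (induction T) (auto simp: z(2) w)
    have "f t \<in> H (a + int t)" for t
      using H_add[OF H_mono[OF near1[of t], of "a + int t"] e_in_H[of "a + int t" "a + int t"]] by simp
    then obtain c where c: "\<And>T. (\<Sum>b<r. sc (c b) (f b)) - (\<Sum>t<T. sc (w t) (f t)) \<in> H (a + int T)"
      using H_complete[of f a w, OF f(1)] by blast
    have "h (comb c) - y \<in> H (a + int T)" for T
      using H_diff[OF c[of T] z(1)[of T]] by (simp add: h_comb z_sum)
    then have "h (comb c) - y = 0" by (rule H_separated)
    then show ?thesis using comb_H by (intro bexI[of _ "comb c"]) auto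
  qed
  have "inj_on h M"
  proof (rule inj_onI)
    fix x y assume "x \<in> M" "y \<in> M" and eq: "h x = h y"
    then have xy: "x \<in> H a" "y \<in> H a" using Ma by auto
    have "x - y = 0" by (rule h_inj) (simp_all add: xy eq h_diff H_diff)
    then show "x = y" by simp
  qed
  moreover have "h ` M = M"
  proof (intro subset_antisym subsetI)
    fix y assume y: "y \<in> M"
    then obtain x where x: "x \<in> H a" "h x = y" using h_surj Ma by blast
    \<comment> \<open>A preimage is so far known only in \<open>H a\<close>; its distance from
      \<open>y\<close> lies in \<open>H (a + D)\<close>, which puts it into
      \<open>M\<close>.\<close>
    have "y - x \<in> M" using h_near[of x 0] x aM by auto
    from subspace_diff[OF M(1) y this] have "x \<in> M" by simp
    then show "y \<in> h ` M" using x(2) by auto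
  qed (use h_M in auto)
  ultimately have bij: "bij_betw h M M" by (simp add: bij_betw_def)
  show ?thesis
  proof (rule that)
    show "h x \<in> M" if "x \<in> M" for x using that by (rule h_M)
    show "bij_betw h M M" by (rule bij)
    show "h (x + y) = h x + h y" if "x \<in> M" "y \<in> M" for x y
      using that[THEN subsetD[OF Ma]] by (rule h_add)
    show "h (sc c x) = sc c (h x)" if "x \<in> M" for c x
      using subsetD[OF Ma that] by (rule h_scale)
    show "h (\<Phi> x) = \<Psi> (h x)" if "x \<in> M" for x
      using subsetD[OF Ma that] by (rule h_\<Phi>)
  qed
qed

end

section \<open>The isocrystal of a crystal\<close>

lemma p_power_0 [simp]: "p_power 0 = (1 :: 'k::idom_prime_char witt_rat)"
  unfolding p_power_def by transfer (simp add: ploc_rel_def)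

lemma p_power_of_nat: "(p_power (int n) :: 'k::idom_prime_char witt_rat) = loc_frac (of_nat CHAR('k) ^ n) 0"
  by (simp add: p_power_def)

lemma p_power_minus_of_nat: "(p_power (- int n) :: 'k::idom_prime_char witt_rat) = loc_frac 1 n"
  by (simp add: p_power_def)

lemma p_power_add:
  "p_power (a + b) = (p_power a * p_power b :: 'k::idom_prime_char witt_rat)"
proof -
  have "nat a + nat b + nat (- (a + b)) = nat (- a) + nat (- b) + nat (a + b)" by linarith
  then show ?thesis
    unfolding p_power_def loc_frac_mult loc_frac_eq_iff
    by (intro exI[of _ 0]) (simp add: nat_mult_of_nat ac_simps flip: power_add)
qed

lemma p_power_mult_uminus [simp]: "p_power a * p_power (- a) = (1 :: 'k::idom_prime_char witt_rat)"
  using p_power_add[of a "- a"] by simp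

lemma loc_frac_0_left [simp]: "(loc_frac 0 a :: ('m::ab_group_add, 'k::semiring_prime_char) ploc) = 0"
  by transfer (simp add: ploc_rel_def)

lemma loc_frac_0_right_add:
  "(loc_frac (x + y) 0 :: ('m::ab_group_add, 'k::semiring_prime_char) ploc) = loc_frac x 0 + loc_frac y 0"
  by (simp add: loc_frac_add)

lemma loc_frac_witt_eq_0_iff:
  "(loc_frac w 0 :: 'k::idom_prime_char witt_rat) = 0 \<longleftrightarrow> w = 0"
proof
  assume "(loc_frac w 0 :: 'k witt_rat) = 0"
  then have "(loc_frac w 0 :: 'k witt_rat) = loc_frac 0 0" by simp
  then obtain c where "of_nat CHAR('k) ^ c * w = of_nat CHAR('k) ^ c * 0"
    unfolding loc_frac_eq_iff by (auto simp: nat_mult_of_nat)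
  then show "w = 0" by (rule CHAR_mult_witt_cancel)
qed simp

lemma loc_map_add:
  assumes "\<And>x y. f (x + y) = f x + f y"
  shows "loc_map f (u + v) = loc_map f u + loc_map f (v :: ('m::ab_group_add, 'k::semiring_prime_char) ploc)"
proof -
  obtain x a y b where "u = loc_frac x a" "v = loc_frac y b" by (metis loc_frac_cases)
  then show ?thesis
    by (simp add: loc_frac_add loc_map_frac assms nat_mult_additive[of f, OF assms])
qed

lemma sum_reindex_bij: "bij_betw h A B \<Longrightarrow> (\<And>x. x \<in> A \<Longrightarrow> f x = g (h x)) \<Longrightarrow> sum f A = sum g B"
  using sum.reindex_bij_betw[of h A B g] by (metis (mono_tags, lifting) sum.cong)

text \<open>Selects the standard basis vector of which \<open>e n\<close> will be a p-power
  multiple; the quotient of \<open>n - i s\<close> by \<open>r\<close> is the exponent.\<close>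

definition residue_index :: "nat \<Rightarrow> int \<Rightarrow> int \<Rightarrow> nat" where
  "residue_index r s n = (THE i. i < r \<and> int r dvd n - int i * s)"

lemma residue_index_unique:
  assumes "coprime s (int r)" "i < r" "int r dvd n - int i * s" "j < r" "int r dvd n - int j * s"
  shows "i = j"
proof -
  have "int r dvd (n - int i * s) - (n - int j * s)" by (rule dvd_diff[OF assms(3,5)])
  moreover have "(n - int i * s) - (n - int j * s) = s * (int j - int i)" by (simp add: algebra_simps)
  ultimately have "int r dvd int j - int i"
    using assms(1) by (simp add: coprime_dvd_mult_right_iff coprime_commute)
  then show ?thesis using int_dvd_diff_imp_eq assms(2,4) by metis
qed

lemma residue_index:
  assumes "coprime s (int r)" "r > 0"
  shows "residue_index r s n < r" "int r dvd n - int (residue_index r s n) * s"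
proof -
  have "\<exists>!i. i < r \<and> int r dvd n - int i * s"
    using ex_dvd_diff_mult[OF assms] residue_index_unique[OF assms(1)] by blast
  from theI'[OF this] show "residue_index r s n < r" "int r dvd n - int (residue_index r s n) * s"
    by (auto simp: residue_index_def)
qed

lemma residue_index_eqI:
  assumes "coprime s (int r)" "i < r" "int r dvd n - int i * s"
  shows "residue_index r s n = i"
  using residue_index[of s r n] residue_index_unique[of s r _ n i] assms by auto

text \<open>Consecutive integers run through all residues, so \<open>r\<close> consecutive vectors
  \<open>e n\<close> involve each standard basis vector exactly once.\<close>

lemma bij_betw_residue_index:
  assumes "coprime s (int r)" "r > 0"
  shows "bij_betw (\<lambda>b. residue_index r s (n + int b)) {..<r} {..<r}"
proof -
  have "inj_on (\<lambda>b. residue_index r s (n + int b)) {..<r}"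
  proof (rule inj_onI)
    fix b c assume bc: "b \<in> {..<r}" "c \<in> {..<r}"
      and eq: "residue_index r s (n + int b) = residue_index r s (n + int c)"
    have "int r dvd (n + int b - int (residue_index r s (n + int b)) * s) -
        (n + int c - int (residue_index r s (n + int c)) * s)"
      by (intro dvd_diff residue_index assms)
    then have "int r dvd int b - int c" by (simp add: eq)
    then show "b = c" using int_dvd_diff_imp_eq bc by auto
  qed
  moreover have "(\<lambda>b. residue_index r s (n + int b)) ` {..<r} \<subseteq> {..<r}"
    using residue_index(1)[OF assms] by auto
  ultimately show ?thesis by (simp add: bij_betw_def endo_inj_surj)
qed

lemma (in module) is_basis_independent:
  assumes "is_basis scale I u" "J \<subseteq> I" "(\<Sum>i\<in>J. scale (c i) (u i)) = 0" "i \<in> J"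
  shows "c i = 0"
proof -
  have fin: "finite J" and inj: "inj_on u J" and ind: "independent (u ` I)"
    using assms(1,2) by (auto simp: is_basis_def intro: finite_subset inj_on_subset)
  have "(\<Sum>v\<in>u ` J. scale (c (the_inv_into J u v)) v) = (\<Sum>i\<in>J. scale (c i) (u i))"
    using inj by (subst sum.reindex) (auto simp: the_inv_into_f_f intro: sum.cong)
  then have "c (the_inv_into J u (u i)) = 0"
    using assms fin by (intro independentD[OF ind, of "u ` J" "\<lambda>v. c (the_inv_into J u v)"]) auto
  then show ?thesis using inj assms(4) by (simp add: the_inv_into_f_f)
qed

lemma (in module) nonzero_if_is_basis:
  assumes "is_basis scale I u" "i \<in> I"
  shows "u i \<noteq> 0"
proof
  assume "u i = 0"
  then have "(\<Sum>i\<in>{i}. scale 1 (u i)) = 0" by simp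
  from is_basis_independent[OF assms(1) _ this, of i] assms(2) show False by simp
qed

lemma eq_if_eq_quotient:
  fixes s s' :: int and r r' :: nat
  assumes "of_int s / of_nat r = (of_int s' / of_nat r' :: rat)"
    and "r > 0" "coprime s (int r)" "r' > 0" "coprime s' (int r')"
  shows "s = s' \<and> r = r'"
proof -
  have "of_int (s * int r') = (of_int (s' * int r) :: rat)"
    using assms(1,2,4) by (simp add: field_simps)
  then have eq: "s * int r' = s' * int r" by (simp only: of_int_eq_iff)
  have "int r dvd s * int r'" "int r' dvd s' * int r" by (simp_all add: eq) (simp flip: eq)
  then have "int r dvd int r'" "int r' dvd int r"
    using assms(3,5) by (simp_all add: coprime_dvd_mult_right_iff coprime_commute)
  then have "r = r'" by (simp add: dvd_antisym)
  then show ?thesis using eq assms(2) by simp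
qed

section \<open>The crystal as a lattice in its isocrystal\<close>

context f_crystal
begin

abbreviation vscale :: "'k witt_rat \<Rightarrow> ('m, 'k) ploc \<Rightarrow> ('m, 'k) ploc" where
  "vscale \<equiv> loc_scale scale"

interpretation loc: module vscale
  by (rule module_loc_scale[OF module_axioms])

definition wscale :: "'k witt \<Rightarrow> ('m, 'k) ploc \<Rightarrow> ('m, 'k) ploc" where
  "wscale w = vscale (loc_frac w 0)"

definition incl :: "'m \<Rightarrow> ('m, 'k) ploc" where
  "incl x = loc_frac x 0"

lemma loc_frac_1_0: "loc_frac 1 0 = (1 :: 'k witt_rat)"
  using p_power_of_nat[where 'k = 'k, of 0] by simp

lemma module_wscale: "module wscale"
proof
  fix a b :: "'k witt" and x y
  show "wscale a (x + y) = wscale a x + wscale a y"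
    by (simp add: wscale_def loc.scale_right_distrib)
  show "wscale (a + b) x = wscale a x + wscale b x"
    by (simp add: wscale_def loc_frac_0_right_add loc.scale_left_distrib)
  show "wscale a (wscale b x) = wscale (a * b) x"
    by (simp add: wscale_def loc_frac_mult)
  show "wscale 1 x = x"
    by (simp add: wscale_def loc_frac_1_0)
qed

lemma vscale_frac: "vscale (loc_frac w a) (loc_frac x c) = loc_frac (scale w x) (a + c)"
  by (rule loc_scale_frac[OF module_axioms])

lemma wscale_frac: "wscale w (loc_frac x c) = loc_frac (scale w x) c"
  by (simp add: wscale_def vscale_frac)

lemma wscale_incl: "wscale w (incl x) = incl (scale w x)"
  by (simp add: incl_def wscale_frac)

lemma wscale_CHAR_power: "wscale (of_nat CHAR('k) ^ k) = vscale (p_power (int k))"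
  by (simp add: wscale_def p_power_of_nat)

lemma incl_add: "incl (x + y) = incl x + incl y"
  by (simp add: incl_def loc_frac_0_right_add)

text \<open>Coordinates in a basis reduce this to W(k). It makes the map from \<open>M\<close> to
  \<open>M[1/p]\<close> injective.\<close>

lemma CHAR_torsion_free:
  assumes "scale (of_nat CHAR('k) ^ c) x = 0"
  shows "x = 0"
proof -
  obtain B where B: "finite B" "independent B" "span B = UNIV" using free by blast
  then obtain w where x: "x = (\<Sum>b\<in>B. scale (w b) b)" using span_finite[OF B(1)] by auto
  have "(\<Sum>b\<in>B. scale (of_nat CHAR('k) ^ c * w b) b) = 0"
    using assms by (simp add: x scale_sum_right)
  then have "of_nat CHAR('k) ^ c * w b = of_nat CHAR('k) ^ c * 0" if "b \<in> B" for b
    using independentD[OF B(2,1) subset_refl, of "\<lambda>b. of_nat CHAR('k) ^ c * w b"] that by simp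
  then have "w b = 0" if "b \<in> B" for b using CHAR_mult_witt_cancel that by blast
  then show ?thesis by (simp add: x)
qed

lemma incl_eq_iff: "incl x = incl y \<longleftrightarrow> x = y"
proof
  assume "incl x = incl y"
  then obtain c where "scale (of_nat CHAR('k) ^ c) x = scale (of_nat CHAR('k) ^ c) y"
    unfolding incl_def loc_frac_eq_iff by (auto simp: nat_mult_eq_scale)
  then have "scale (of_nat CHAR('k) ^ c) (x - y) = 0" by (simp add: scale_right_diff_distrib)
  then show "x = y" using CHAR_torsion_free[of c "x - y"] by simp
qed simp

lemma ex_wscale_CHAR_incl: "\<exists>c x. wscale (of_nat CHAR('k) ^ c) v = incl x"
proof -
  obtain x c where v: "v = loc_frac x c" by (rule loc_frac_cases)
  have "loc_frac (scale (of_nat CHAR('k) ^ c) x) c = (loc_frac x 0 :: ('m, 'k) ploc)"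
    unfolding loc_frac_eq_iff by (intro exI[of _ 0]) (simp add: nat_mult_eq_scale)
  then show ?thesis unfolding v wscale_frac incl_def by blast
qed

text \<open>Powers of p are integers or inverses of integers, and additive maps commute with integer
  multiples.\<close>

lemma loc_map_vscale_p_power:
  assumes "\<And>x y. f (x + y) = f x + f y"
  shows "loc_map f (vscale (p_power l) v) = vscale (p_power l) (loc_map f v)"
proof -
  have f: "f (scale (of_nat CHAR('k) ^ c) x) = scale (of_nat CHAR('k) ^ c) (f x)" for c x
    using nat_mult_additive[of f, OF assms, of "CHAR('k) ^ c" x] by (simp add: nat_mult_eq_scale)
  obtain x a where v: "v = loc_frac x a" by (rule loc_frac_cases)
  show ?thesis
    unfolding v p_power_def by (simp add: vscale_frac loc_map_frac[OF assms] f)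
qed

lemma loc_map_wscale:
  assumes "\<And>x y. f (x + y) = f x + f y" "\<And>x. f (scale a x) = scale b (f x)"
  shows "loc_map f (wscale a v) = wscale b (loc_map f v)"
proof -
  obtain x c where v: "v = loc_frac x c" by (rule loc_frac_cases)
  show ?thesis
    unfolding v by (simp add: wscale_frac loc_map_frac[OF assms(1)] assms(2))
qed

lemma loc_map_incl:
  assumes "\<And>x y. f (x + y) = f x + f y"
  shows "loc_map f (incl x) = incl (f x)"
  by (simp add: incl_def loc_map_frac[OF assms])

text \<open>A standard basis \<open>u\<close> of the isocrystal yields \<open>e n = p ^ l u i\<close> for \<open>n = i s + l r\<close>.\<close>

lemma isoclinic_chain_of_standard_basis:
  assumes r: "r > 0" and coprime: "coprime s (int r)"
    and independent: "\<And>c i. (\<Sum>i<r. vscale (c i) (u i)) = 0 \<Longrightarrow> i < r \<Longrightarrow> c i = 0"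
    and spans: "loc.span (u ` {..<r}) = UNIV"
    and u: "\<And>i. i < r \<Longrightarrow> loc_map \<phi> (u i) = (if Suc i < r then u (Suc i) else vscale (p_power s) (u 0))"
  shows "\<exists>e. isoclinic_chain wscale e r (loc_map \<phi>) s"
proof -
  define I where "I = residue_index r s"
  note I = residue_index[OF coprime r, folded I_def]
  note I_eqI = residue_index_eqI[OF coprime, folded I_def]
  define e where "e n = vscale (p_power ((n - int (I n) * s) div int r)) (u (I n))" for n
  have e_eq: "e (int i * s + int r * l) = vscale (p_power l) (u i)" if "i < r" for i l
  proof -
    have "I (int i * s + int r * l) = i" by (rule I_eqI) (use that in auto)
    then show ?thesis using r by (simp add: e_def)
  qed
  have e_form: "\<exists>i l. i < r \<and> n = int i * s + int r * l" for n
  proof -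
    obtain l where "n - int (I n) * s = int r * l" using I(2) by (rule dvdE)
    then show ?thesis using I(1)[of n] by (intro exI[of _ "I n"] exI[of _ l]) simp
  qed
  interpret W: module wscale by (rule module_wscale)
  have "isoclinic_chain wscale e r (loc_map \<phi>) s"
  proof
    show "r > 0" "coprime s (int r)" by fact+
    fix n
    show "e (n + int r) = wscale (of_nat CHAR('k)) (e n)"
    proof -
      obtain i l where il: "i < r" "n = int i * s + int r * l" using e_form by blast
      have "n + int r = int i * s + int r * (1 + l)" by (simp add: il algebra_simps)
      then have "e (n + int r) = vscale (p_power 1) (vscale (p_power l) (u i))"
        using il(1) by (simp only: e_eq p_power_add loc.scale_scale)
      also have "vscale (p_power l) (u i) = e n" using il by (simp only: e_eq)
      finally show ?thesis using wscale_CHAR_power[of 1] by simp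
    qed
    show "loc_map \<phi> (e n) = e (n + s)"
    proof -
      obtain i l where il: "i < r" "n = int i * s + int r * l" using e_form by blast
      have 1: "loc_map \<phi> (e n) = vscale (p_power l) (loc_map \<phi> (u i))"
        unfolding il(2) e_eq[OF il(1)] by (rule loc_map_vscale_p_power) (rule add)
      show ?thesis
      proof (cases "Suc i < r")
        case True
        have "n + s = int (Suc i) * s + int r * l" by (simp add: il algebra_simps)
        then have "e (n + s) = vscale (p_power l) (u (Suc i))" by (simp only: e_eq[OF True])
        then show ?thesis using 1 u[OF il(1)] True by simp
      next
        case False
        then have "r = Suc i" using il(1) by simp
        \<comment> \<open>At \<open>i = r - 1\<close> the first index returns to 0, and the surplus
          \<open>r s\<close> becomes the factor \<open>p ^ s\<close> from the relation for the last
          basis vector.\<close>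
        then have "n + s = int 0 * s + int r * (l + s)" by (simp add: il algebra_simps)
        then have "e (n + s) = vscale (p_power l) (vscale (p_power s) (u 0))"
          by (simp only: e_eq[OF r] p_power_add loc.scale_scale)
        then show ?thesis using 1 u[OF il(1)] False by simp
      qed
    qed
  next
    fix x y show "loc_map \<phi> (x + y) = loc_map \<phi> x + loc_map \<phi> (y :: ('m, 'k) ploc)"
      by (rule loc_map_add) (rule add)
  next
    fix a x show "loc_map \<phi> (wscale a x) = wscale (witt_frob a) (loc_map \<phi> x)"
      by (rule loc_map_wscale) (rule add semilinear)+
  next
    fix n w b assume sum: "(\<Sum>b<r. wscale (w b) (e (n + int b))) = 0" and b: "b < r"
    \<comment> \<open>A relation among the \<open>e (n + b)\<close> is a relation among the
      \<open>u i\<close>, permuted and with coefficients multiplied by powers of p, which are units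
      of B(k).\<close>
    have bij: "bij_betw (\<lambda>b. I (n + int b)) {..<r} {..<r}"
      unfolding I_def by (rule bij_betw_residue_index[OF coprime r])
    define inv where "inv = the_inv_into {..<r} (\<lambda>b. I (n + int b))"
    have inv: "inv (I (n + int b)) = b" if "b < r" for b
      unfolding inv_def using bij that by (intro the_inv_into_f_f) (auto simp: bij_betw_def)
    define L where "L b = (n + int b - int (I (n + int b)) * s) div int r" for b
    define c where "c b = loc_frac (w b) 0 * p_power (L b)" for b
    have "(\<Sum>b<r. wscale (w b) (e (n + int b))) = (\<Sum>b<r. vscale (c b) (u (I (n + int b))))"
      by (simp add: wscale_def e_def c_def L_def)
    also have "\<dots> = (\<Sum>i<r. vscale (c (inv i)) (u i))"
      by (rule sum_reindex_bij[OF bij]) (simp add: inv)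
    finally have "(\<Sum>i<r. vscale (c (inv i)) (u i)) = 0" using sum by simp
    from independent[OF this I(1)[of "n + int b"]] have "c b = 0" by (simp add: inv b)
    then have "c b * p_power (- L b) = 0" by simp
    then have "loc_frac (w b) 0 = (0 :: 'k witt_rat)" by (simp add: c_def mult.assoc)
    then show "w b = 0" by (simp add: loc_frac_witt_eq_0_iff)
  next
    \<comment> \<open>A denominator \<open>p ^ a\<close> is absorbed by lowering the index by
      \<open>r a\<close>, so the W(k)-span of all \<open>e n\<close> is stable under B(k).\<close>
    have frac: "vscale b (e n) \<in> W.span (range e)" for b n
    proof -
      obtain w a where b: "b = loc_frac w a" by (rule loc_frac_cases)
      obtain i l where il: "i < r" "n = int i * s + int r * l" using e_form by blast
      have "b = loc_frac w 0 * p_power (- int a)"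
        by (simp add: b p_power_minus_of_nat loc_frac_mult)
      then have "vscale b (e n) = wscale w (vscale (p_power (- int a + l)) (u i))"
        unfolding il(2) e_eq[OF il(1)] by (simp only: wscale_def p_power_add mult.assoc loc.scale_scale)
      also have "\<dots> = wscale w (e (int i * s + int r * (- int a + l)))" using il by (simp only: e_eq)
      also have "\<dots> \<in> W.span (range e)" by (intro W.span_scale W.span_base) simp
      finally show ?thesis .
    qed
    have vscale_span: "vscale b x \<in> W.span (range e)" if "x \<in> W.span (range e)" for b x
      using that
    proof (induction rule: W.span_induct_alt)
      case (step c x y)
      then obtain n where x: "x = e n" by blast
      have "vscale b (wscale c x + y) = wscale c (vscale b x) + vscale b y"
        by (simp add: wscale_def loc.scale_right_distrib mult.commute)
      then show ?case using step frac x by (simp add: W.span_add W.span_scale)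
    qed (simp add: W.span_zero)
    have "loc.subspace (W.span (range e))"
      unfolding loc.subspace_def by (auto intro: W.span_add W.span_zero vscale_span)
    moreover have "u ` {..<r} \<subseteq> W.span (range e)"
    proof
      fix x assume "x \<in> u ` {..<r}"
      then obtain i where "i < r" "x = u i" by auto
      then have "x = e (int i * s)" using e_eq[of i 0] by simp
      then show "x \<in> W.span (range e)" by (auto intro: W.span_base)
    qed
    ultimately have "loc.span (u ` {..<r}) \<subseteq> W.span (range e)" by (rule loc.span_minimal[rotated])
    then show "W.span (range e) = UNIV" using spans by auto
  qed
  then show ?thesis by blast
qed

end

section \<open>Consequences of the Newton and Hodge slopes\<close>

context f_crystal
begin

interpretation loc: module vscale
  by (rule module_loc_scale[OF module_axioms])

text \<open>The span of the first Dieudonne-Manin summand is nonzero and stable, hence everything by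
  simplicity. Its slope must be the only one in \<open>N\<close>, and uniqueness of reduced
  fractions identifies its parameters with \<open>s\<close> and \<open>r\<close>.\<close>

lemma ex_isoclinic_chain:
  assumes simple: "isosimple scale \<phi>" and newton: "newton_slopes scale \<phi> N"
    and r: "r > 0" and coprime: "coprime s (int r)" and N: "set_mset N = {of_int s / of_nat r}"
  shows "\<exists>e. isoclinic_chain wscale e r (loc_map \<phi>) s"
proof -
  obtain m :: nat and s' r' u where s'r'_u: "\<forall>j<m. r' j > 0 \<and> coprime (s' j) (int (r' j))"
    "\<forall>j<m. \<forall>i<r' j. loc_map \<phi> (u (j, i)) =
      (if Suc i < r' j then u (j, Suc i) else vscale (p_power (s' j)) (u (j, 0)))"
    and basis: "is_basis vscale (SIGMA j:{..<m}. {..<r' j}) u"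
    and N_eq: "N = (\<Sum>j<m. replicate_mset (r' j) (of_int (s' j) / of_nat (r' j)))"
    using newton unfolding newton_slopes_def isocrystal_newton_slopes_def
    by (elim exE conjE) (rule that; assumption)
  note s'r' = s'r'_u(1)[rule_format] and u = s'r'_u(2)[rule_format]
  have nontrivial: "(UNIV :: ('m, 'k) ploc set) \<noteq> {0}"
    and simple: "\<And>U. loc.subspace U \<Longrightarrow> loc_map \<phi> ` U \<subseteq> U \<Longrightarrow> U = {0} \<or> U = UNIV"
    using simple by (auto simp: isosimple_def isocrystal_simple_def)
  have "m \<noteq> 0"
  proof
    assume "m = 0"
    then have "loc.span {} = UNIV" using basis by (simp add: is_basis_def)
    then show False using nontrivial by simp
  qed
  then have m: "0 < m" by simp
  have "of_int (s' 0) / of_nat (r' 0) \<in> set_mset N"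
    unfolding N_eq using m s'r'[OF m] by (force simp: set_mset_sum)
  then have "of_int s / of_nat r = (of_int (s' 0) / of_nat (r' 0) :: rat)" using N by auto
  then have [simp]: "s' 0 = s" "r' 0 = r"
    using eq_if_eq_quotient[of s r "s' 0" "r' 0"] s'r'[OF m] r coprime by auto
  define v where "v i = u (0, i)" for i
  have v: "loc_map \<phi> (v i) = (if Suc i < r then v (Suc i) else vscale (p_power s) (v 0))" if "i < r" for i
    using u[OF m, of i] that by (simp add: v_def)
  have independent: "c i = 0" if "(\<Sum>i<r. vscale (c i) (v i)) = 0" "i < r" for c i
  proof -
    have "(\<Sum>x\<in>Pair 0 ` {..<r}. vscale (c (snd x)) (u x)) = 0"
      using that(1) by (subst sum.reindex) (auto simp: inj_on_def v_def)
    moreover have "Pair 0 ` {..<r} \<subseteq> (SIGMA j:{..<m}. {..<r' j})" using m by auto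
    ultimately show ?thesis
      using loc.is_basis_independent[OF basis, of "Pair 0 ` {..<r}" "\<lambda>x. c (snd x)" "(0, i)"] that(2)
      by auto
  qed
  have "loc.span (v ` {..<r}) = UNIV"
  proof -
    have \<phi>_add: "loc_map \<phi> (x + y) = loc_map \<phi> x + loc_map \<phi> y" for x y :: "('m, 'k) ploc"
      by (rule loc_map_add) (rule add)
    have \<phi>_0: "loc_map \<phi> 0 = (0 :: ('m, 'k) ploc)" using \<phi>_add[of 0 0] by simp
    have "loc_map \<phi> x \<in> loc.span (v ` {..<r})" if "x \<in> loc.span (v ` {..<r})" for x
      using that
    proof (induction rule: loc.span_induct_alt)
      case (step c x y)
      obtain w a where c: "c = loc_frac w a" by (rule loc_frac_cases)
      obtain i where i: "i < r" "x = v i" using step by auto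
      have "loc_map \<phi> x \<in> loc.span (v ` {..<r})"
        using r v[OF i(1)] i(2) by (auto intro: loc.span_scale loc.span_base)
      \<comment> \<open>The Frobenius of B(k) acts on the numerator alone.\<close>
      moreover have "loc_map \<phi> (vscale c x) = vscale (loc_frac (witt_frob w) a) (loc_map \<phi> x)"
      proof -
        obtain y b where "x = loc_frac y b" by (rule loc_frac_cases)
        then show ?thesis by (simp add: c vscale_frac loc_map_frac[OF add] semilinear)
      qed
      ultimately show ?case using step by (simp add: \<phi>_add loc.span_add loc.span_scale)
    qed (simp add: \<phi>_0 loc.span_zero)
    then have "loc.span (v ` {..<r}) = {0} \<or> loc.span (v ` {..<r}) = UNIV"
      by (intro simple) auto
    moreover have "v 0 \<in> loc.span (v ` {..<r})" using r by (auto intro: loc.span_base)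
    moreover have "v 0 \<noteq> 0"
      using loc.nonzero_if_is_basis[OF basis, of "(0, 0)"] m r by (simp add: v_def)
    ultimately show ?thesis by auto
  qed
  then show ?thesis by (intro isoclinic_chain_of_standard_basis[OF r coprime, of v] independent v)
qed

text \<open>On the Hodge basis, \<open>p ^ Max_mset E * w i\<close> is a p-power multiple of
  \<open>\<phi> (u i)\<close>. Coefficients are moved inside \<open>\<phi>\<close> by surjectivity
  of the Frobenius on W(k).\<close>

lemma scale_CHAR_power_in_range:
  assumes "hodge_slopes scale \<phi> E"
  shows "\<exists>y. scale (of_nat CHAR('k) ^ Max_mset E) x = \<phi> y"
proof -
  obtain n :: nat and h u w where w: "is_basis scale {..<n} w"
    and \<phi>_u: "\<And>i. i < n \<Longrightarrow> \<phi> (u i) = scale (of_nat CHAR('k) ^ h i) (w i)"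
    and E: "E = image_mset h (mset_set {..<n})"
    using assms unfolding hodge_slopes_def by blast
  have h: "h i \<le> Max_mset E" if "i < n" for i using that by (simp add: E)
  have "x \<in> span (w ` {..<n})" using w by (simp add: is_basis_def)
  then show ?thesis
  proof (induction rule: span_induct_alt)
    case base
    have "\<phi> 0 = 0" using add[of 0 0] by simp
    then show ?case by (intro exI[of _ 0]) simp
  next
    case (step c x y)
    then obtain i z where i: "i < n" "x = w i" and z: "scale (of_nat CHAR('k) ^ Max_mset E) y = \<phi> z"
      by blast
    obtain d where d: "witt_frob d = c" using surj_witt_frob by (metis surjD)
    have "of_nat CHAR('k) ^ Max_mset E = of_nat CHAR('k) ^ (Max_mset E - h i) * (of_nat CHAR('k) ^ h i :: 'k witt)"
      using h[OF i(1)] by (simp flip: power_add)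
    then have "scale (of_nat CHAR('k) ^ Max_mset E) (scale c x) =
        \<phi> (scale (d * of_nat CHAR('k) ^ (Max_mset E - h i)) (u i))"
      by (simp add: semilinear \<phi>_u i witt_frob_mult witt_frob_power d mult_ac)
    then have "scale (of_nat CHAR('k) ^ Max_mset E) (scale c x + y) =
        \<phi> (scale (d * of_nat CHAR('k) ^ (Max_mset E - h i)) (u i) + z)"
      by (simp only: scale_right_distrib z add)
    then show ?case by blast
  qed
qed

end

text \<open>If \<open>i \<le> r - \<lceil>s / h\<rceil>\<close>, then \<open>i s / r\<close> is
  bounded by the first entry of the maximum. Otherwise
  \<open>r - i \<le> \<lfloor>s / h\<rfloor>\<close>, and \<open>(r - i) (h - s / r)\<close> is
  bounded by the second.\<close>

lemma slope_bounds:
  fixes s :: int and r h i :: nat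
  defines "j \<equiv> max
      \<lfloor>of_int (int r - \<lceil>of_int s / of_nat h :: rat\<rceil>) * (of_int s / of_nat r :: rat)\<rfloor>
      \<lfloor>of_int \<lfloor>of_int s / of_nat h :: rat\<rfloor> * (of_nat h - of_int s / of_nat r :: rat)\<rfloor>"
  assumes "r > 0" "h \<ge> 1" "0 \<le> s" "s \<le> int h * int r"
  shows "0 \<le> j"
    and "i < r \<Longrightarrow> int i * s div int r \<le> j \<or> (int r - int i) * (int h * int r - s) div int r \<le> j"
proof -
  define q where "q = (of_int s / of_nat h :: rat)"
  define t where "t = (of_int s / of_nat r :: rat)"
  have "of_int s \<le> (of_int (int h * int r) :: rat)" using assms(5) by (simp only: of_int_le_iff)
  then have hr: "of_int s \<le> (of_nat h * of_nat r :: rat)" by simp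
  have t: "0 \<le> t" "t \<le> of_nat h"
    using assms(2,4) hr by (auto simp: t_def pos_divide_le_eq)
  have "q \<le> of_nat r" using assms(3) hr by (simp add: q_def pos_divide_le_eq mult.commute)
  then have q: "\<lceil>q\<rceil> \<le> int r" by (simp add: ceiling_le_iff)
  have j: "j = max \<lfloor>of_int (int r - \<lceil>q\<rceil>) * t\<rfloor> \<lfloor>of_int \<lfloor>q\<rfloor> * (of_nat h - t)\<rfloor>"
    by (simp add: j_def q_def t_def)
  have "0 \<le> of_int (int r - \<lceil>q\<rceil>) * t" using q t by (intro mult_nonneg_nonneg) auto
  then show "0 \<le> j" unfolding j by (simp add: le_max_iff_disj)
  assume i: "i < r"
  have f1: "int i * s div int r = \<lfloor>of_nat i * t\<rfloor>"
    using floor_divide_of_int_eq[of "int i * s" "int r", where ?'a = rat] by (simp add: t_def)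
  have "of_int ((int r - int i) * (int h * int r - s)) / of_int (int r) = (of_int (int r - int i) * (of_nat h - t) :: rat)"
    using assms(2) by (simp add: t_def field_simps)
  then have f2: "(int r - int i) * (int h * int r - s) div int r = \<lfloor>of_int (int r - int i) * (of_nat h - t)\<rfloor>"
    using floor_divide_of_int_eq[of "(int r - int i) * (int h * int r - s)" "int r", where ?'a = rat]
    by (simp only:)
  show "int i * s div int r \<le> j \<or> (int r - int i) * (int h * int r - s) div int r \<le> j"
  proof (cases "int i \<le> int r - \<lceil>q\<rceil>")
    case True
    then have "(of_nat i :: rat) \<le> of_int (int r - \<lceil>q\<rceil>)" by linarith
    then have "of_nat i * t \<le> of_int (int r - \<lceil>q\<rceil>) * t" using t by (intro mult_right_mono) auto
    then show ?thesis unfolding j f1 by (auto simp: le_max_iff_disj intro: floor_mono)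
  next
    case False
    then have "int r - int i < \<lceil>q\<rceil>" by simp
    then have "of_int (int r - int i) < q" by (simp only: less_ceiling_iff)
    then have "int r - int i \<le> \<lfloor>q\<rfloor>" by (simp add: le_floor_iff)
    then have "(of_int (int r - int i) :: rat) \<le> of_int \<lfloor>q\<rfloor>" by (simp only: of_int_le_iff)
    then have "of_int (int r - int i) * (of_nat h - t) \<le> of_int \<lfloor>q\<rfloor> * (of_nat h - t)"
      using t by (intro mult_right_mono) auto
    then show ?thesis unfolding j f2 by (auto simp: le_max_iff_disj intro: floor_mono)
  qed
qed

lemma linear_automorphism_inv:
  assumes "linear_automorphism scale h"
  shows "linear_automorphism scale (inv h)"
proof -
  interpret module_hom scale scale h using assms by (simp add: linear_automorphism_def)
  have bij: "bij h" using assms by (simp add: linear_automorphism_def)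
  have h_inv: "h (inv h x) = x" and inv_h: "inv h (h x) = x" for x
    using bij by (simp_all add: bij_is_surj surj_f_inv_f bij_is_inj)
  have "module_hom scale scale (inv h)"
  proof
    fix x y c
    have "inv h (x + y) = inv h (h (inv h x + inv h y))" by (simp only: add h_inv)
    then show "inv h (x + y) = inv h x + inv h y" by (simp only: inv_h)
    have "inv h (scale c x) = inv h (h (scale c (inv h x)))" by (simp only: scale h_inv)
    then show "inv h (scale c x) = scale c (inv h x)" by (simp only: inv_h)
  qed
  then show ?thesis using bij by (simp add: linear_automorphism_def bij_imp_bij_inv)
qed

section \<open>Isomorphism with nearby crystals and the final bound\<close>

context f_crystal
begin

lemma subspace_range_incl: "module.subspace wscale (range incl)"
proof -
  interpret W: module wscale by (rule module_wscale)
  show ?thesis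
    unfolding W.subspace_def
  proof (intro conjI ballI allI)
    show "0 \<in> range incl" by (rule range_eqI[of _ _ 0]) (simp add: incl_def)
    show "x + y \<in> range incl" if "x \<in> range incl" "y \<in> range incl" for x y
      using that by (auto simp flip: incl_add)
    show "wscale c x \<in> range incl" if "x \<in> range incl" for c x
      using that by (auto simp: wscale_incl)
  qed
qed

lemma loc_map_range_incl: "x \<in> range incl \<Longrightarrow> loc_map \<phi> x \<in> range incl"
  by (auto simp: loc_map_incl[OF add])

text \<open>The congruence makes \<open>g - 1\<close> map \<open>M\<close> into
  \<open>H (a + r (2 j + 1))\<close>. Of the \<open>2 j + 1\<close> powers of p, \<open>j\<close>
  are spent on comparing \<open>M\<close> with \<open>H (a + r j)\<close>; the others leave the gain
  \<open>D = r j + 1\<close>, enough for \<open>H (a + D) \<subseteq> M\<close>.\<close>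

lemma crystals_isomorphic_if_near_identity:
  assumes chain: "isoclinic_chain wscale e r (loc_map \<phi>) s"
    and s: "0 \<le> s" and j: "0 \<le> j"
    and Ma: "range incl \<subseteq> lattice_chain.H wscale e r a"
    and aM: "lattice_chain.H wscale e r (a + int r * j) \<subseteq> range incl"
    and g: "linear_automorphism scale g"
    and near: "\<And>x. \<exists>y. g x - x = scale (of_nat CHAR('k) ^ nat (2 * j + 1)) y"
  shows "crystals_isomorphic scale (g \<circ> \<phi>) \<phi>"
proof -
  interpret C: isoclinic_chain wscale e r "loc_map \<phi>" s by (rule chain)
  interpret g: module_hom scale scale g using g by (simp add: linear_automorphism_def)
  have gadd: "\<And>x y. g (x + y) = g x + g y" by (rule g.add)
  define d where "d v = loc_map g v - v" for v :: "('m, 'k) ploc"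
  have d_power: "d (wscale (C.\<pi> ^ k) v) = wscale (C.\<pi> ^ k) (d v)" for k v
    using loc_map_vscale_p_power[of g "int k", OF gadd]
    by (simp add: d_def wscale_CHAR_power[symmetric] C.scale_right_diff_distrib)
  have d_incl: "d v \<in> C.H (a + int r * (2 * j + 1))" if "v \<in> range incl" for v
  proof -
    obtain x where x: "v = incl x" using \<open>v \<in> range incl\<close> by blast
    obtain y where y: "g x - x = scale (C.\<pi> ^ nat (2 * j + 1)) y" using near by blast
    then have "incl (g x) = incl (x + scale (C.\<pi> ^ nat (2 * j + 1)) y)" by (simp add: algebra_simps)
    then have "d v = wscale (C.\<pi> ^ nat (2 * j + 1)) (incl y)"
      by (simp only: d_def x loc_map_incl[OF gadd] incl_add wscale_incl add_diff_cancel_left')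
    also have "\<dots> \<in> C.H (a + int (r * nat (2 * j + 1)))"
      using Ma unfolding C.H_shift_iff by auto
    finally show ?thesis using j by simp
  qed
  define D where "D = int r * j + 1"
  have d_e: "d (e n) \<in> C.H (n + D)" for n
  proof -
    \<comment> \<open>The representative of \<open>n\<close> modulo \<open>r\<close> among the first
      \<open>r\<close> indices whose vectors surely lie in \<open>M\<close>. The largest of these,
      \<open>a + r j + r - 1\<close>, plus \<open>D\<close> is exactly
      \<open>a + r (2 j + 1)\<close>. Powers of p then carry the estimate to all
      \<open>n\<close>.\<close>
    define n' where "n' = a + int r * j + (n - (a + int r * j)) mod int r"
    have n': "a + int r * j \<le> n'" "n' < a + int r * j + int r"
      using C.r_pos by (auto simp: n'_def)
    have "e n' \<in> range incl" using aM C.e_in_H n'(1) by blast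
    then have d': "d (e n') \<in> C.H (n' + D)"
      by (rule C.H_mono[OF d_incl]) (use n'(2) in \<open>simp add: D_def algebra_simps\<close>)
    have "int r dvd (n - (a + int r * j)) - (n - (a + int r * j)) mod int r"
      by (rule dvd_minus_mod)
    then have "int r dvd n - n'" by (simp add: n'_def algebra_simps)
    then obtain t where t: "n - n' = int r * t" by (rule dvdE)
    show ?thesis
    proof (cases "t \<ge> 0")
      case True
      then have n: "n = n' + int (r * nat t)" using t by simp
      have "d (e n) = wscale (C.\<pi> ^ nat t) (d (e n'))"
        unfolding n C.shift_power[of e, OF C.e_shift] d_power ..
      also have "\<dots> \<in> C.H (n' + D + int (r * nat t))" using d' unfolding C.H_shift_iff .
      finally show ?thesis by (simp add: n algebra_simps)
    next
      case False
      then have n: "n' = n + int (r * nat (- t))" using t by simp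
      have "wscale (C.\<pi> ^ nat (- t)) (d (e n)) \<in> C.H (n + D + int (r * nat (- t)))"
        using d' unfolding n C.shift_power[of e, OF C.e_shift] d_power by (simp only: ac_simps)
      then show ?thesis unfolding C.H_shift_iff .
    qed
  qed
  have g\<phi>_add: "(g \<circ> \<phi>) (x + y) = (g \<circ> \<phi>) x + (g \<circ> \<phi>) y" for x y by (simp add: add gadd)
  have loc_map_comp: "loc_map (g \<circ> \<phi>) v = loc_map g (loc_map \<phi> v)" for v :: "('m, 'k) ploc"
  proof -
    obtain x b where "v = loc_frac x b" by (rule loc_frac_cases)
    then show ?thesis by (simp add: loc_map_frac[OF gadd] loc_map_frac[OF add] loc_map_frac[OF g\<phi>_add])
  qed
  interpret P: perturbed_chain wscale e r "loc_map \<phi>" s "loc_map (g \<circ> \<phi>)" D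
  proof
    fix x y :: "('m, 'k) ploc" and b n
    show "loc_map (g \<circ> \<phi>) (x + y) = loc_map (g \<circ> \<phi>) x + loc_map (g \<circ> \<phi>) y"
      by (rule loc_map_add) (rule g\<phi>_add)
    show "loc_map (g \<circ> \<phi>) (wscale b x) = wscale (witt_frob b) (loc_map (g \<circ> \<phi>) x)"
      by (rule loc_map_wscale) (rule g\<phi>_add, simp add: semilinear g.scale)
    show "loc_map (g \<circ> \<phi>) (e n) - e (n + s) \<in> C.H (n + s + D)"
      using d_e[of "n + s"] by (simp only: loc_map_comp C.\<Phi>_e d_def)
    show "D \<ge> 1" "s \<ge> 0" using s j by (simp_all add: D_def)
  qed
  have "C.H (a + D) \<subseteq> range incl"
    using aM C.H_antimono[of "a + int r * j" "a + D"] by (auto simp: D_def)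
  from P.ex_conjugation[OF subspace_range_incl loc_map_range_incl Ma this] obtain h where
    h: "bij_betw h (range incl) (range incl)"
      "\<And>x y. x \<in> range incl \<Longrightarrow> y \<in> range incl \<Longrightarrow> h (x + y) = h x + h y"
      "\<And>c x. x \<in> range incl \<Longrightarrow> h (wscale c x) = wscale c (h x)"
      "\<And>x. x \<in> range incl \<Longrightarrow> h (loc_map \<phi> x) = loc_map (g \<circ> \<phi>) (h x)"
    by metis
  have inj: "inj incl" by (rule injI) (simp add: incl_eq_iff)
  \<comment> \<open>The automorphism of the image of \<open>M\<close> is transported back to
    \<open>M\<close>.\<close>
  define k where "k x = inv incl (h (incl x))" for x
  have k: "incl (k x) = h (incl x)" for x
    unfolding k_def using h(1) by (intro f_inv_into_f) (auto simp: bij_betw_def)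
  have "module_hom scale scale k"
  proof
    fix x y c
    have "incl (k (x + y)) = incl (k x + k y)" by (simp add: k incl_add h(2))
    then show "k (x + y) = k x + k y" by (simp only: incl_eq_iff)
    have "incl (k (scale c x)) = incl (scale c (k x))" by (simp add: k h(3) flip: wscale_incl)
    then show "k (scale c x) = scale c (k x)" by (simp only: incl_eq_iff)
  qed
  moreover have "bij k"
  proof (rule bijI)
    show "inj k"
    proof (rule injI)
      fix x y assume "k x = k y"
      then have "h (incl x) = h (incl y)" by (metis k)
      then have "incl x = incl y" using h(1) by (auto simp: bij_betw_def dest: inj_onD)
      then show "x = y" by (simp only: incl_eq_iff)
    qed
    have "\<exists>x. k x = y" for y
    proof -
      have "incl y \<in> h ` range incl" using h(1) by (simp add: bij_betw_def)
      then obtain x where "incl y = h (incl x)" by blast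
      then have "incl (k x) = incl y" by (simp only: k)
      then show ?thesis by (auto simp: incl_eq_iff)
    qed
    then show "surj k" by (metis surjI surj_def)
  qed
  ultimately have aut: "linear_automorphism scale k" by (simp add: linear_automorphism_def)
  have comm: "k (\<phi> x) = g (\<phi> (k x))" for x
  proof -
    have "incl (k (\<phi> x)) = h (loc_map \<phi> (incl x))" by (simp only: k loc_map_incl[OF add])
    also have "\<dots> = loc_map (g \<circ> \<phi>) (incl (k x))" using h(4) by (simp add: k)
    also have "\<dots> = incl (g (\<phi> (k x)))" by (simp add: loc_map_incl[OF g\<phi>_add])
    finally show ?thesis by (simp only: incl_eq_iff)
  qed
  \<comment> \<open>The map \<open>k\<close> goes from \<open>\<phi>\<close> to
    \<open>g \<circ> \<phi>\<close>; the isomorphism asked for has the opposite direction.\<close>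
  have "inv k \<circ> (g \<circ> \<phi>) = \<phi> \<circ> inv k"
  proof
    fix x
    have "g (\<phi> x) = k (\<phi> (inv k x))"
      unfolding comm using \<open>bij k\<close> by (simp add: bij_is_surj surj_f_inv_f)
    then show "(inv k \<circ> (g \<circ> \<phi>)) x = (\<phi> \<circ> inv k) x"
      using \<open>bij k\<close> by (simp add: bij_is_inj)
  qed
  then show ?thesis
    unfolding crystals_isomorphic_def using linear_automorphism_inv[OF aut] by blast
qed

lemma isomorphism_number_le:
  assumes "isosimple scale \<phi>" "newton_slopes scale \<phi> N"
    and r: "r > 0" and "coprime s (int r)" "set_mset N = {of_int s / of_nat r}"
    and hodge: "hodge_slopes scale \<phi> E" and h: "h = Max_mset E" "h \<ge> 1"
  shows "int (isomorphism_number scale \<phi>) \<le>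
    2 * max
      \<lfloor>of_int (int r - \<lceil>of_int s / of_nat h :: rat\<rceil>) * (of_int s / of_nat r :: rat)\<rfloor>
      \<lfloor>of_int \<lfloor>of_int s / of_nat h :: rat\<rfloor> * (of_nat h - of_int s / of_nat r :: rat)\<rfloor>
    + 1" (is "_ \<le> 2 * ?j + 1")
proof -
  obtain e where chain: "isoclinic_chain wscale e r (loc_map \<phi>) s"
    using ex_isoclinic_chain[OF assms(1-5)] by blast
  interpret C: isoclinic_chain wscale e r "loc_map \<phi>" s by (rule chain)
  have V_M: "\<exists>y\<in>range incl. wscale (C.\<pi> ^ h) x = loc_map \<phi> y" if x: "x \<in> range incl" for x
  proof -
    obtain z where z: "x = incl z" using x by blast
    obtain y where "scale (C.\<pi> ^ h) z = \<phi> y"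
      using scale_CHAR_power_in_range[OF hodge] h(1) by blast
    then have "wscale (C.\<pi> ^ h) x = loc_map \<phi> (incl y)"
      by (simp only: z wscale_incl loc_map_incl[OF add])
    then show ?thesis by blast
  qed
  obtain m0 where m0: "C.H m0 \<subseteq> range incl"
  proof -
    have "\<forall>b. \<exists>c x. wscale (C.\<pi> ^ c) (e (int b)) = incl x" using ex_wscale_CHAR_incl by blast
    then obtain c x where c: "\<And>b. wscale (C.\<pi> ^ c b) (e (int b)) = incl (x b)" by metis
    \<comment> \<open>A common exponent: \<open>p ^ K\<close> clears the denominators of
      \<open>e 0, ..., e (r - 1)\<close> at once, and these multiples form the basis of
      \<open>H (r K)\<close>.\<close>
    define K where "K = sum c {..<r}"
    have "e (int r * int K + int b) \<in> range incl" if b: "b < r" for b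
    proof -
      have "c b \<le> K" unfolding K_def using b by (intro member_le_sum) auto
      then obtain q where q: "K = c b + q" by (rule le_Suc_ex[elim_format]) blast
      have "e (int r * int K + int b) = wscale (C.\<pi> ^ q) (wscale (C.\<pi> ^ c b) (e (int b)))"
        using C.shift_power[of e "int b" K, OF C.e_shift]
        by (simp add: q power_add ac_simps)
      also have "\<dots> = incl (scale (C.\<pi> ^ q) (x b))" by (simp only: c wscale_incl)
      finally show ?thesis by blast
    qed
    then have "C.H (int r * int K) \<subseteq> range incl"
      by (auto simp: C.H_def intro!: C.subspace_sum[OF subspace_range_incl] C.subspace_scale[OF subspace_range_incl])
    then show ?thesis by (rule that)
  qed
  obtain m1 where m1: "range incl \<subseteq> C.H m1"
  proof -
    obtain B where B: "finite B" "span B = UNIV" using free by blast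
    \<comment> \<open>The finitely many generators of \<open>M\<close> lie in a common member of the
      chain.\<close>
    have "\<exists>n. \<forall>b\<in>B. incl b \<in> C.H n"
      using B(1)
    proof (induction B)
      case (insert b B)
      then obtain n where n: "\<forall>b\<in>B. incl b \<in> C.H n" by blast
      obtain m where m: "incl b \<in> C.H m" using C.H_exhaustive by blast
      show ?case
        using n m by (intro exI[of _ "min n m"]) (auto intro: C.H_mono)
    qed simp
    then obtain n where n: "\<And>b. b \<in> B \<Longrightarrow> incl b \<in> C.H n" by blast
    have "incl x \<in> C.H n" for x
    proof -
      have "x \<in> span B" by (simp add: B(2))
      then show ?thesis
      proof (induction rule: span_induct_alt)
        case base
        show ?case by (simp add: incl_def)
      next
        case (step c x y)
        then show ?case using n by (simp add: incl_add C.H_add C.H_scale flip: wscale_incl)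
      qed
    qed
    then show ?thesis by (intro that) auto
  qed
  from C.ex_sandwich[OF subspace_range_incl loc_map_range_incl V_M m0 m1] obtain a where a: "range incl \<subseteq> C.H a"
    and s: "0 \<le> s" "s \<le> int h * int r"
    and sub: "\<And>j. (\<And>i. i < r \<Longrightarrow> int i * s div int r \<le> j \<or> (int r - int i) * (int h * int r - s) div int r \<le> j)
      \<Longrightarrow> C.H (a + int r * j) \<subseteq> range incl"
    by metis
  have j: "0 \<le> ?j" by (rule slope_bounds(1)[OF r h(2) s])
  have "C.H (a + int r * ?j) \<subseteq> range incl"
    by (rule sub) (rule slope_bounds(2)[OF r h(2) s])
  note iso = crystals_isomorphic_if_near_identity[OF chain s(1) j a this]
  have "isomorphism_number scale \<phi> \<le> nat (2 * ?j + 1)"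
    unfolding isomorphism_number_def by (rule Least_le) (use iso in blast)
  then show ?thesis using j by linarith
qed

end

theorem theorem1p3:
  fixes scale :: "'k::{alg_closed_field, field_prime_char} witt \<Rightarrow> 'm::ab_group_add \<Rightarrow> 'm"
    and \<phi> :: "'m \<Rightarrow> 'm"
    and s :: int and r e :: nat
    and N :: "rat multiset" and E :: "nat multiset"
  assumes "f_crystal scale \<phi>"
    and "isosimple scale \<phi>"
    and "newton_slopes scale \<phi> N"
    and "r > 0" and "coprime s (int r)" and "set_mset N = {of_int s / of_nat r}"
    and "hodge_slopes scale \<phi> E"
    and "e = Max_mset E"
    and "e \<ge> 1"
  shows "int (isomorphism_number scale \<phi>) \<le>
    2 * max
      \<lfloor>of_int (int r - \<lceil>of_int s / of_nat e :: rat\<rceil>) * (of_int s / of_nat r :: rat)\<rfloor>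
      \<lfloor>of_int \<lfloor>of_int s / of_nat e :: rat\<rfloor> * (of_nat e - of_int s / of_nat r :: rat)\<rfloor>
    + 1"
proof -
  interpret f_crystal scale \<phi> by fact
  show ?thesis using assms(2-9) by (rule isomorphism_number_le)
qed

end
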